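(* Let $Z\in\mathbb{D}^{1,2}$ have zero mean and let $g(z)=E\big(\langle DZ,-DL^{-1}Z\rangle_{\mathfrak{H}}\,\big|\,Z=z\big)$. Assume that there exists $\sigma_{\min}>0$ such that $$g(Z)\geq\sigma_{\min}^{2}\quad\text{almost surely.}$$ Then $Z$ has a density $\rho$, the support of $\rho$ is $\mathbb{R}$, and for almost every $z\in\mathbb{R}$, $$\rho(z)=\frac{E|Z|}{2g(z)}\,\exp\left(-\int_{0}^{z}\frac{x\,dx}{g(x)}\right).$$
   Context: $\mathfrak{H}$ is a real separable Hilbert space and $X=\{X(h):h\in\mathfrak{H}\}$ is a centered isonormal Gaussian process over $\mathfrak{H}$ on a probability space $(\Omega,\mathscr{F},P)$, i.e. a centered jointly Gaussian family with $E(X(h)X(k))=\langle h,k\rangle_{\mathfrak{H}}$; $\mathscr{F}$ is the $\sigma$-field generated by $X$. Malliavin derivative: for a smooth cylindrical variable $F=\psi(X(\phi_1),\ldots,X(\phi_n))$ ($\psi:\mathbb{R}^n\to\mathbb{R}$ smooth with compact support, $\phi_i\in\mathfrak{H}$), $DF=\sum_{i}\frac{\partial\psi}{\partial x_i}(X(\phi_1),\ldots,X(\phi_n))\phi_i\in L^2(\Omega,\mathfrak{H})$. $\mathbb{D}^{1,2}$ is the closure of the set of smooth cylindrical variables under the norm $\|F\|_{1,2}^2=E(F^2)+E(\|DF\|_{\mathfrak{H}}^2)$, and $D$ is extended to it by closure. $J_m$ is the orthogonal projection of $L^2(\Omega,\mathscr{F},P)$ onto the $m$-th Wiener chaos of $X$.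 For $Z\in L^2(\Omega,\mathscr{F},P)$, $L^{-1}Z=\sum_{m\ge1}-\frac1m J_m(Z)$, which lies in $\mathbb{D}^{1,2}$ (it is the pseudo-inverse of the Ornstein-Uhlenbeck generator $L=\sum_{m\ge0}-mJ_m$). The function $g:\mathbb{R}\to\mathbb{R}$ is a Borel function, determined almost everywhere with respect to the law of $Z$, with $g(Z)=E(\langle DZ,-DL^{-1}Z\rangle_{\mathfrak{H}}\mid Z)$ almost surely. "Density" means density of the law of $Z$ with respect to Lebesgue measure. *)

theory Defs
  imports "HOL-Probability.Probability"
begin

section \<open>Isonormal Gaussian processes\<close>

text \<open>Constants count as (degenerate) Gaussian variables, as is needed for \<open>X 0 = 0\<close>.\<close>

definition gaussian_rv :: "'a measure \<Rightarrow> ('a \<Rightarrow> real) \<Rightarrow> bool" where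
  "gaussian_rv M Y \<longleftrightarrow> Y \<in> borel_measurable M \<and>
     ((\<exists>\<mu>. AE \<omega> in M. Y \<omega> = \<mu>) \<or>
      (\<exists>\<mu> \<sigma>. \<sigma> > 0 \<and> distributed M lborel Y (\<lambda>x. ennreal (normal_density \<mu> \<sigma> x))))"

definition isonormal_process ::
    "'a measure \<Rightarrow> ('h::{real_inner, banach, second_countable_topology} \<Rightarrow> 'a \<Rightarrow> real) \<Rightarrow> bool" where
  "isonormal_process M X \<longleftrightarrow>
     prob_space M \<and>
     (\<forall>(n::nat) (c::nat \<Rightarrow> real) h. gaussian_rv M (\<lambda>\<omega>. \<Sum>i<n. c i * X (h i) \<omega>)) \<and>
     (\<forall>h. (LINT \<omega>|M. X h \<omega>) = 0) \<and>
     (\<forall>h k. (LINT \<omega>|M. X h \<omega> * X k \<omega>) = h \<bullet> k)"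

definition sets_generated_by :: "'a measure \<Rightarrow> ('h \<Rightarrow> 'a \<Rightarrow> real) \<Rightarrow> 'a set set" where
  "sets_generated_by M X =
     sigma_sets (space M) {X h -` B \<inter> space M |h B. B \<in> sets borel}"

section \<open>Square-integrable variables\<close>

text \<open>Elements of \<open>L\<^sup>2\<close> are represented by functions; equality in \<open>L\<^sup>2\<close> is almost sure equality.\<close>

definition in_L2 ::
    "'a measure \<Rightarrow> ('a \<Rightarrow> 'b::{real_normed_vector, second_countable_topology}) \<Rightarrow> bool" where
  "in_L2 M F \<longleftrightarrow> F \<in> borel_measurable M \<and> integrable M (\<lambda>\<omega>. (norm (F \<omega>))\<^sup>2)"

definition L2_tendsto ::
    "'a measure \<Rightarrow> (nat \<Rightarrow> 'a \<Rightarrow> 'b::{real_normed_vector, second_countable_topology}) \<Rightarrow>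
     ('a \<Rightarrow> 'b) \<Rightarrow> bool" where
  "L2_tendsto M F G \<longleftrightarrow> (\<forall>k. in_L2 M (F k)) \<and> in_L2 M G \<and>
     (\<lambda>k. LINT \<omega>|M. (norm (F k \<omega> - G \<omega>))\<^sup>2) \<longlonglongrightarrow> 0"

section \<open>Smooth compactly supported functions on \<open>\<real>\<^sup>n\<close>\<close>

text \<open>
  The dimension \<open>n\<close> has to vary, so a function on \<open>\<real>\<^sup>n\<close> is a function on \<open>nat \<Rightarrow> real\<close> that depends
  only on the coordinates \<open>i < n\<close>. For such functions, continuity in the product topology of
  \<open>nat \<Rightarrow> real\<close> is continuity on \<open>\<real>\<^sup>n\<close>. Smooth means that the iterated partial derivatives of every
  order exist and are continuous.
\<close>

definition pderivative :: "nat \<Rightarrow> ((nat \<Rightarrow> real) \<Rightarrow> real) \<Rightarrow> (nat \<Rightarrow> real) \<Rightarrow> real" where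
  "pderivative i f x = deriv (\<lambda>t. f (x(i := t))) (x i)"

definition fun_on_Rn :: "nat \<Rightarrow> ((nat \<Rightarrow> real) \<Rightarrow> real) \<Rightarrow> bool" where
  "fun_on_Rn n f \<longleftrightarrow> (\<forall>x y. (\<forall>i<n. x i = y i) \<longrightarrow> f x = f y)"

definition smooth_on_Rn :: "nat \<Rightarrow> ((nat \<Rightarrow> real) \<Rightarrow> real) \<Rightarrow> bool" where
  "smooth_on_Rn n f \<longleftrightarrow> fun_on_Rn n f \<and>
     (\<forall>js. set js \<subseteq> {..<n} \<longrightarrow>
        continuous_on UNIV (foldr pderivative js f) \<and>
        (\<forall>i<n. \<forall>x. (\<lambda>t. foldr pderivative js f (x(i := t))) differentiable (at (x i))))"

definition compact_support_on_Rn :: "nat \<Rightarrow> ((nat \<Rightarrow> real) \<Rightarrow> real) \<Rightarrow> bool" where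
  "compact_support_on_Rn n f \<longleftrightarrow> (\<exists>R. \<forall>x. f x \<noteq> 0 \<longrightarrow> (\<forall>i<n. \<bar>x i\<bar> \<le> R))"

section \<open>Malliavin derivative\<close>

text \<open>\<open>smooth_cylindrical X F G\<close>: \<open>F\<close> is a smooth cylindrical variable and \<open>G\<close> its derivative,
  computed from some representation of \<open>F\<close>.\<close>

definition smooth_cylindrical ::
    "('h::{real_inner, banach, second_countable_topology} \<Rightarrow> 'a \<Rightarrow> real) \<Rightarrow>
     ('a \<Rightarrow> real) \<Rightarrow> ('a \<Rightarrow> 'h) \<Rightarrow> bool" where
  "smooth_cylindrical X F G \<longleftrightarrow>
     (\<exists>n \<psi> \<phi>. 1 \<le> n \<and> smooth_on_Rn n \<psi> \<and> compact_support_on_Rn n \<psi> \<and>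
        F = (\<lambda>\<omega>. \<psi> (\<lambda>i. X (\<phi> i) \<omega>)) \<and>
        G = (\<lambda>\<omega>. \<Sum>i<n. pderivative i \<psi> (\<lambda>j. X (\<phi> j) \<omega>) *\<^sub>R \<phi> i))"

text \<open>The closure of the graph of the derivative: convergence \<open>F k \<rightarrow> Z\<close> in \<open>L\<^sup>2(\<Omega>)\<close> together with
  \<open>D (F k) \<rightarrow> U\<close> in \<open>L\<^sup>2(\<Omega>, H)\<close> is convergence for the norm of \<open>D12\<close>.\<close>

definition has_malliavin_derivative ::
    "'a measure \<Rightarrow> ('h::{real_inner, banach, second_countable_topology} \<Rightarrow> 'a \<Rightarrow> real) \<Rightarrow>
     ('a \<Rightarrow> real) \<Rightarrow> ('a \<Rightarrow> 'h) \<Rightarrow> bool" where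
  "has_malliavin_derivative M X Z U \<longleftrightarrow>
     (\<exists>F G. (\<forall>k. smooth_cylindrical X (F k) (G k)) \<and> L2_tendsto M F Z \<and> L2_tendsto M G U)"

definition D12 ::
    "'a measure \<Rightarrow> ('h::{real_inner, banach, second_countable_topology} \<Rightarrow> 'a \<Rightarrow> real) \<Rightarrow>
     ('a \<Rightarrow> real) set" where
  "D12 M X = {Z. \<exists>U. has_malliavin_derivative M X Z U}"

text \<open>By closability the derivative is unique up to almost sure equality; a version is chosen.\<close>

definition malliavin_D ::
    "'a measure \<Rightarrow> ('h::{real_inner, banach, second_countable_topology} \<Rightarrow> 'a \<Rightarrow> real) \<Rightarrow>
     ('a \<Rightarrow> real) \<Rightarrow> 'a \<Rightarrow> 'h" where
  "malliavin_D M X Z = (SOME U. has_malliavin_derivative M X Z U)"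

section \<open>Wiener chaos and the pseudo-inverse of the Ornstein-Uhlenbeck generator\<close>

fun hermite :: "nat \<Rightarrow> real \<Rightarrow> real" where
  "hermite 0 x = 1"
| "hermite (Suc 0) x = x"
| "hermite (Suc (Suc m)) x = x * hermite (Suc m) x - real (Suc m) * hermite m x"

text \<open>The \<open>m\<close>-th chaos is the closed linear span in \<open>L\<^sup>2\<close> of the variables \<open>hermite m (X h)\<close> with
  \<open>norm h = 1\<close>; the case \<open>m = 0\<close> is separate because a trivial \<open>H\<close> has no unit vectors.\<close>

definition wiener_chaos ::
    "'a measure \<Rightarrow> ('h::{real_inner, banach, second_countable_topology} \<Rightarrow> 'a \<Rightarrow> real) \<Rightarrow>
     nat \<Rightarrow> ('a \<Rightarrow> real) set" where
  "wiener_chaos M X m =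
     (if m = 0 then {Y. Y \<in> borel_measurable M \<and> (\<exists>c. AE \<omega> in M. Y \<omega> = c)}
      else {Y. \<exists>F.
        (\<forall>k. \<exists>(n::nat) (c::nat \<Rightarrow> real) h. (\<forall>i<n. norm (h i) = 1) \<and>
               F k = (\<lambda>\<omega>. \<Sum>i<n. c i * hermite m (X (h i) \<omega>))) \<and>
        L2_tendsto M F Y})"

definition chaos_proj ::
    "'a measure \<Rightarrow> ('h::{real_inner, banach, second_countable_topology} \<Rightarrow> 'a \<Rightarrow> real) \<Rightarrow>
     nat \<Rightarrow> ('a \<Rightarrow> real) \<Rightarrow> 'a \<Rightarrow> real" where
  "chaos_proj M X m Z =
     (SOME Y. Y \<in> wiener_chaos M X m \<and>
        (\<forall>W \<in> wiener_chaos M X m. (LINT \<omega>|M. (Z \<omega> - Y \<omega>) * W \<omega>) = 0))"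

definition OU_pinv ::
    "'a measure \<Rightarrow> ('h::{real_inner, banach, second_countable_topology} \<Rightarrow> 'a \<Rightarrow> real) \<Rightarrow>
     ('a \<Rightarrow> real) \<Rightarrow> 'a \<Rightarrow> real" where
  "OU_pinv M X Z =
     (SOME Y. L2_tendsto M (\<lambda>N \<omega>. \<Sum>m = 1..N. - (1 / real m) * chaos_proj M X m Z \<omega>) Y)"

section \<open>Support of a density\<close>

text \<open>The complement of the largest open set on which \<open>\<rho>\<close> vanishes almost everywhere; it does not
  depend on the version of \<open>\<rho>\<close> and is the support of the measure with density \<open>\<rho>\<close>.\<close>

definition density_support :: "(real \<Rightarrow> real) \<Rightarrow> real set" where
  "density_support \<rho> = - \<Union>{U. open U \<and> (AE x in lborel. x \<in> U \<longrightarrow> \<rho> x = 0)}"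

end

theory Submission
  imports Defs "HOL-Computational_Algebra.Polynomial" "HOL-Real_Asymp.Real_Asymp"
begin

text \<open>
  The key is the identity \<open>E[F Z] = E\<langle>DF, -DL\<^sup>-\<^sup>1Z\<rangle>\<close>, obtained chaos by chaos: Gaussian integration by
  parts gives \<open>E\<langle>DF, DY\<rangle> = m E[F Y]\<close> for \<open>Y\<close> in the \<open>m\<close>-th chaos, and \<open>Z\<close> is the sum of its chaos
  components because a square-integrable variable orthogonal to all polynomials in the \<open>X h\<close> vanishes.
  For \<open>F = sin (t Z)\<close> and \<open>F = cos (t Z) - 1\<close> the identity says that the measure \<open>g d\<mu>\<close>, where \<open>\<mu>\<close> is the
  law of \<open>Z\<close>, has the same Fourier transform as the measure with density \<open>\<phi> z = E[Z; Z > z]\<close>. Hence \<open>\<mu>\<close>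
  has density \<open>\<phi> / g\<close>, so that \<open>\<phi>\<close> solves \<open>\<phi>' z = - z \<phi> z / g z\<close> with \<open>\<phi> 0 = E\<bar>Z\<bar> / 2\<close>.
\<close>

section \<open>Square-integrable variables\<close>

text \<open>Testing on the integral of an indicator would call for a chain rule for Lipschitz
  functions of Z. Trigonometric functions avoid it: \<open>sin (t * F)\<close> and
  \<open>cos (t * F) - 1\<close> are smooth cylindrical whenever F is (subtracting 1 preserves
  compact support), and only expectations are passed to the limit. The price is Levy's uniqueness
  theorem and an integral equation for \<phi> whose coefficient is merely measurable.
  \<open>malliavin_D\<close>, \<open>chaos_proj\<close> and \<open>OU_pinv\<close> are choices among
  admissible versions. Each needs an existence proof before anything can be said of it, and the
  derivative needs uniqueness too: the identity is obtained for the termwise derivative of the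
  series defining L^-1 Z, whereas g refers to the chosen version. Neither multiple integrals nor a
  divergence operator occurs. Integration by parts is reduced to one standard normal variable by the
  independence of X h from all X k with k orthogonal to h, which in turn comes from one-dimensional
  characteristic functions of linear combinations.\<close>

lemma power2_norm_add_le:
  fixes x y :: "'b::real_normed_vector"
  shows "(norm (x + y))\<^sup>2 \<le> 2 * (norm x)\<^sup>2 + 2 * (norm y)\<^sup>2"
proof -
  have "(norm (x + y))\<^sup>2 \<le> (norm x + norm y)\<^sup>2"
    by (intro power_mono norm_triangle_ineq) auto
  also have "\<dots> \<le> 2 * (norm x)\<^sup>2 + 2 * (norm y)\<^sup>2"
    using sum_squares_bound[of "norm x" "norm y"] by (simp add: power2_sum)
  finally show ?thesis .
qed

lemma in_L2_measurable [measurable_dest]: "in_L2 M F \<Longrightarrow> F \<in> borel_measurable M"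
  by (simp add: in_L2_def)

lemma in_L2_integrable_power2: "in_L2 M F \<Longrightarrow> integrable M (\<lambda>\<omega>. (norm (F \<omega>))\<^sup>2)"
  by (simp add: in_L2_def)

lemma in_L2_real_iff:
  "in_L2 M (F :: 'a \<Rightarrow> real) \<longleftrightarrow> F \<in> borel_measurable M \<and> integrable M (\<lambda>\<omega>. (F \<omega>)\<^sup>2)"
  by (simp add: in_L2_def)

lemma in_L2_bound:
  fixes F :: "'a \<Rightarrow> 'b::{real_normed_vector, second_countable_topology}"
    and G :: "'a \<Rightarrow> 'c::{real_normed_vector, second_countable_topology}"
  assumes "in_L2 M G" "F \<in> borel_measurable M" "AE \<omega> in M. norm (F \<omega>) \<le> norm (G \<omega>)"
  shows "in_L2 M F"
  unfolding in_L2_def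
proof (intro conjI)
  show "integrable M (\<lambda>\<omega>. (norm (F \<omega>))\<^sup>2)"
    using assms(2,3)
    by (intro Bochner_Integration.integrable_bound[OF in_L2_integrable_power2[OF assms(1)]])
      (auto elim!: eventually_mono intro!: power_mono)
qed (use assms in auto)

lemma in_L2_zero [simp]: "in_L2 M (\<lambda>_. 0)"
  by (simp add: in_L2_def)

lemma in_L2_add:
  fixes F G :: "'a \<Rightarrow> 'b::{real_normed_vector, second_countable_topology}"
  assumes "in_L2 M F" "in_L2 M G"
  shows "in_L2 M (\<lambda>\<omega>. F \<omega> + G \<omega>)"
  unfolding in_L2_def
proof (intro conjI)
  have [measurable]: "F \<in> borel_measurable M" "G \<in> borel_measurable M"
    using assms by (auto simp: in_L2_def)
  show "integrable M (\<lambda>\<omega>. (norm (F \<omega> + G \<omega>))\<^sup>2)"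
    by (rule Bochner_Integration.integrable_bound
          [of _ "\<lambda>\<omega>. 2 * (norm (F \<omega>))\<^sup>2 + 2 * (norm (G \<omega>))\<^sup>2"])
      (use assms power2_norm_add_le in \<open>auto simp: in_L2_def\<close>)
qed (use assms in \<open>auto simp: in_L2_def\<close>)

lemma in_L2_scaleR:
  fixes F :: "'a \<Rightarrow> 'b::{real_normed_vector, second_countable_topology}"
  assumes "in_L2 M F"
  shows "in_L2 M (\<lambda>\<omega>. c *\<^sub>R F \<omega>)"
  using assms by (auto simp: in_L2_def power_mult_distrib)

lemma in_L2_cmult: "in_L2 M F \<Longrightarrow> in_L2 M (\<lambda>\<omega>. c * F \<omega> :: real)"
  using in_L2_scaleR[of M F c] by simp

lemma in_L2_uminus:
  fixes F :: "'a \<Rightarrow> 'b::{real_normed_vector, second_countable_topology}"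
  shows "in_L2 M F \<Longrightarrow> in_L2 M (\<lambda>\<omega>. - F \<omega>)"
  using in_L2_scaleR[of M F "-1"] by simp

lemma in_L2_diff:
  fixes F G :: "'a \<Rightarrow> 'b::{real_normed_vector, second_countable_topology}"
  assumes "in_L2 M F" "in_L2 M G"
  shows "in_L2 M (\<lambda>\<omega>. F \<omega> - G \<omega>)"
  using in_L2_add[OF assms(1) in_L2_uminus[OF assms(2)]] by simp

lemma in_L2_sum:
  fixes F :: "'i \<Rightarrow> 'a \<Rightarrow> 'b::{real_normed_vector, second_countable_topology}"
  assumes "\<And>i. i \<in> I \<Longrightarrow> in_L2 M (F i)"
  shows "in_L2 M (\<lambda>\<omega>. \<Sum>i\<in>I. F i \<omega>)"
  using assms by (induction I rule: infinite_finite_induct) (auto intro: in_L2_add)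

lemma (in finite_measure) in_L2_const [simp]: "in_L2 M (\<lambda>_. c)"
  by (simp add: in_L2_def)

lemma (in finite_measure) in_L2_bounded:
  assumes "F \<in> borel_measurable M" "\<And>\<omega>. \<omega> \<in> space M \<Longrightarrow> norm (F \<omega>) \<le> B"
  shows "in_L2 M F"
proof (rule in_L2_bound[OF in_L2_const[of B] assms(1)])
  show "AE \<omega> in M. norm (F \<omega>) \<le> norm B"
    using assms(2) by (intro AE_I2) (auto intro: order_trans[OF _ abs_ge_self])
qed

lemma in_L2_mult_bounded:
  fixes F :: "'a \<Rightarrow> 'b::{real_normed_vector, second_countable_topology}"
  assumes "in_L2 M F" "c \<in> borel_measurable M" "\<And>\<omega>. \<bar>c \<omega>\<bar> \<le> B"
  shows "in_L2 M (\<lambda>\<omega>. c \<omega> *\<^sub>R F \<omega>)"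
proof (rule in_L2_bound[OF in_L2_scaleR[OF assms(1), of B]])
  show "AE \<omega> in M. norm (c \<omega> *\<^sub>R F \<omega>) \<le> norm (B *\<^sub>R F \<omega>)"
    using assms(3) by (intro AE_I2) (auto intro!: mult_right_mono order_trans[OF _ abs_ge_self])
qed (use assms in measurable)

lemma norm_mult_le_sum_power2: "norm x * norm y \<le> (norm x)\<^sup>2 + (norm y)\<^sup>2"
  using sum_squares_bound[of "norm x" "norm y"] zero_le_power2[of "norm x"] zero_le_power2[of "norm y"]
    mult_nonneg_nonneg[OF norm_ge_zero norm_ge_zero, of x y] by linarith

lemma integrable_L2_inner:
  fixes F G :: "'a \<Rightarrow> 'b::{real_inner, second_countable_topology}"
  assumes "in_L2 M F" "in_L2 M G"
  shows "integrable M (\<lambda>\<omega>. F \<omega> \<bullet> G \<omega>)"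
proof (rule Bochner_Integration.integrable_bound[of _ "\<lambda>\<omega>. (norm (F \<omega>))\<^sup>2 + (norm (G \<omega>))\<^sup>2"])
  show "AE \<omega> in M. norm (F \<omega> \<bullet> G \<omega>) \<le> norm ((norm (F \<omega>))\<^sup>2 + (norm (G \<omega>))\<^sup>2)"
    by (intro AE_I2) (simp, rule order_trans[OF Cauchy_Schwarz_ineq2 norm_mult_le_sum_power2])
qed (use assms in \<open>auto simp: in_L2_def\<close>)

lemma integrable_L2_mult:
  fixes F G :: "'a \<Rightarrow> real"
  shows "in_L2 M F \<Longrightarrow> in_L2 M G \<Longrightarrow> integrable M (\<lambda>\<omega>. F \<omega> * G \<omega>)"
  using integrable_L2_inner[of M F G] by simp

lemma (in finite_measure) integrable_L2:
  fixes F :: "'a \<Rightarrow> 'b::{banach, second_countable_topology}"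
  assumes "in_L2 M F"
  shows "integrable M F"
proof (rule Bochner_Integration.integrable_bound[of _ "\<lambda>\<omega>. (norm (F \<omega>))\<^sup>2 + 1"])
  show "AE \<omega> in M. norm (F \<omega>) \<le> norm ((norm (F \<omega>))\<^sup>2 + 1)"
  proof (intro AE_I2)
    fix \<omega>
    have "2 * norm (F \<omega>) * 1 \<le> (norm (F \<omega>))\<^sup>2 + 1\<^sup>2"
      by (rule sum_squares_bound)
    then show "norm (F \<omega>) \<le> norm ((norm (F \<omega>))\<^sup>2 + 1)"
      using norm_ge_zero[of "F \<omega>"] zero_le_power2[of "norm (F \<omega>)"] by (simp del: norm_ge_zero)
  qed
qed (use assms in \<open>auto simp: in_L2_def\<close>)

lemma L2_norm_add:
  fixes F G :: "'a \<Rightarrow> 'b::{real_inner, second_countable_topology}"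
  assumes "in_L2 M F" "in_L2 M G"
  shows "(LINT \<omega>|M. (norm (F \<omega> + t *\<^sub>R G \<omega>))\<^sup>2) = (LINT \<omega>|M. (norm (F \<omega>))\<^sup>2)
    + 2 * t * (LINT \<omega>|M. F \<omega> \<bullet> G \<omega>) + t\<^sup>2 * (LINT \<omega>|M. (norm (G \<omega>))\<^sup>2)"
proof -
  have "(norm (F \<omega> + t *\<^sub>R G \<omega>))\<^sup>2 = F \<omega> \<bullet> F \<omega> + 2 * t * (F \<omega> \<bullet> G \<omega>) + t\<^sup>2 * (G \<omega> \<bullet> G \<omega>)" for \<omega>
    unfolding power2_norm_eq_inner
    by (simp add: inner_add_left inner_add_right inner_commute power2_eq_square algebra_simps)
  then show ?thesis
    using integrable_L2_inner[OF assms] integrable_L2_inner[OF assms(1,1)]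
      integrable_L2_inner[OF assms(2,2)]
    by (simp add: power2_norm_eq_inner)
qed

text \<open>The quadratic polynomial E|F + t G|^2 in t is nonnegative; its minimum over t gives the
  inequality.\<close>

lemma L2_Cauchy_Schwarz:
  fixes F G :: "'a \<Rightarrow> 'b::{real_inner, second_countable_topology}"
  assumes "in_L2 M F" "in_L2 M G"
  shows "(LINT \<omega>|M. F \<omega> \<bullet> G \<omega>)\<^sup>2 \<le> (LINT \<omega>|M. (norm (F \<omega>))\<^sup>2) * (LINT \<omega>|M. (norm (G \<omega>))\<^sup>2)"
proof -
  define a b c where "a = (LINT \<omega>|M. (norm (F \<omega>))\<^sup>2)" and "b = (LINT \<omega>|M. F \<omega> \<bullet> G \<omega>)"
    and "c = (LINT \<omega>|M. (norm (G \<omega>))\<^sup>2)"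
  have pos: "0 \<le> a + 2 * t * b + t\<^sup>2 * c" for t
    unfolding a_def b_def c_def L2_norm_add[OF assms, symmetric] by simp
  have "0 \<le> c" by (simp add: c_def)
  have "b\<^sup>2 \<le> a * c"
  proof (cases "c = 0")
    case True
    have "b = 0"
    proof (rule ccontr)
      assume "b \<noteq> 0"
      \<comment> \<open>This t makes \<open>a + 2 * t * b\<close> equal to -1, while the quadratic
        term is absent.\<close>
      then have "2 * (- (a + 1) / (2 * b)) * b = - (a + 1)" by simp
      with pos[of "- (a + 1) / (2 * b)"] True show False by simp
    qed
    then show ?thesis using True by simp
  next
    case False
    with \<open>0 \<le> c\<close> pos[of "- b / c"] show ?thesis
      by (simp add: field_simps power2_eq_square)
  qed
  then show ?thesis by (simp add: a_def b_def c_def)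
qed

lemma L2_tendstoD:
  assumes "L2_tendsto M F f"
  shows "in_L2 M (F k)" "in_L2 M f" "(\<lambda>k. LINT \<omega>|M. (norm (F k \<omega> - f \<omega>))\<^sup>2) \<longlonglongrightarrow> 0"
  using assms by (auto simp: L2_tendsto_def)

lemma L2_tendsto_subseq:
  assumes "L2_tendsto M F f" "strict_mono r"
  shows "L2_tendsto M (\<lambda>k. F (r k)) f"
  using assms LIMSEQ_subseq_LIMSEQ[OF L2_tendstoD(3)[OF assms(1)] assms(2)]
  by (simp add: L2_tendsto_def o_def)

lemma L2_tendsto_bound:
  assumes "\<And>k. in_L2 M (F k)" "in_L2 M f" "\<And>k. (LINT \<omega>|M. (norm (F k \<omega> - f \<omega>))\<^sup>2) \<le> b k" "b \<longlonglongrightarrow> 0"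
  shows "L2_tendsto M F f"
  unfolding L2_tendsto_def
proof (intro conjI allI)
  show "(\<lambda>k. LINT \<omega>|M. (norm (F k \<omega> - f \<omega>))\<^sup>2) \<longlonglongrightarrow> 0"
    by (rule tendsto_sandwich[OF _ _ tendsto_const assms(4)]) (use assms in auto)
qed (use assms in auto)

lemma L2_tendsto_const: "in_L2 M f \<Longrightarrow> L2_tendsto M (\<lambda>_. f) f"
  by (simp add: L2_tendsto_def)

lemma L2_tendsto_add:
  fixes F G :: "nat \<Rightarrow> 'a \<Rightarrow> 'b::{real_normed_vector, second_countable_topology}"
  assumes F: "L2_tendsto M F f" and G: "L2_tendsto M G g"
  shows "L2_tendsto M (\<lambda>k \<omega>. F k \<omega> + G k \<omega>) (\<lambda>\<omega>. f \<omega> + g \<omega>)"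
proof (rule L2_tendsto_bound)
  note [simp] = L2_tendstoD(1,2)[OF F] L2_tendstoD(1,2)[OF G] in_L2_diff[THEN in_L2_integrable_power2]
  show "in_L2 M (\<lambda>\<omega>. F k \<omega> + G k \<omega>)" "in_L2 M (\<lambda>\<omega>. f \<omega> + g \<omega>)" for k
    by (auto intro!: in_L2_add)
  show "(\<lambda>k. 2 * (LINT \<omega>|M. (norm (F k \<omega> - f \<omega>))\<^sup>2) + 2 * (LINT \<omega>|M. (norm (G k \<omega> - g \<omega>))\<^sup>2)) \<longlonglongrightarrow> 0"
    using tendsto_add[OF tendsto_mult_left[OF L2_tendstoD(3)[OF F], of 2]
        tendsto_mult_left[OF L2_tendstoD(3)[OF G], of 2]] by simp
  show "(LINT \<omega>|M. (norm (F k \<omega> + G k \<omega> - (f \<omega> + g \<omega>)))\<^sup>2)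
      \<le> 2 * (LINT \<omega>|M. (norm (F k \<omega> - f \<omega>))\<^sup>2) + 2 * (LINT \<omega>|M. (norm (G k \<omega> - g \<omega>))\<^sup>2)" for k
  proof -
    have "(LINT \<omega>|M. (norm (F k \<omega> + G k \<omega> - (f \<omega> + g \<omega>)))\<^sup>2)
      \<le> (LINT \<omega>|M. 2 * (norm (F k \<omega> - f \<omega>))\<^sup>2 + 2 * (norm (G k \<omega> - g \<omega>))\<^sup>2)"
    proof (rule integral_mono)
      show "(norm (F k \<omega> + G k \<omega> - (f \<omega> + g \<omega>)))\<^sup>2
        \<le> 2 * (norm (F k \<omega> - f \<omega>))\<^sup>2 + 2 * (norm (G k \<omega> - g \<omega>))\<^sup>2" for \<omega>
        using power2_norm_add_le[of "F k \<omega> - f \<omega>" "G k \<omega> - g \<omega>"] by (simp add: add_diff_add)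
    qed (auto intro!: in_L2_diff[THEN in_L2_integrable_power2] in_L2_add)
    then show ?thesis by simp
  qed
qed

lemma L2_tendsto_scaleR:
  fixes F :: "nat \<Rightarrow> 'a \<Rightarrow> 'b::{real_normed_vector, second_countable_topology}"
  assumes F: "L2_tendsto M F f"
  shows "L2_tendsto M (\<lambda>k \<omega>. c *\<^sub>R F k \<omega>) (\<lambda>\<omega>. c *\<^sub>R f \<omega>)"
proof (rule L2_tendsto_bound)
  show "(LINT \<omega>|M. (norm (c *\<^sub>R F k \<omega> - c *\<^sub>R f \<omega>))\<^sup>2) \<le> c\<^sup>2 * (LINT \<omega>|M. (norm (F k \<omega> - f \<omega>))\<^sup>2)" for k
    by (simp add: scaleR_diff_right[symmetric] power_mult_distrib del: scaleR_diff_right)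
  show "(\<lambda>k. c\<^sup>2 * (LINT \<omega>|M. (norm (F k \<omega> - f \<omega>))\<^sup>2)) \<longlonglongrightarrow> 0"
    using tendsto_mult_left[OF L2_tendstoD(3)[OF F], of "c\<^sup>2"] by simp
qed (use L2_tendstoD[OF F] in \<open>auto intro: in_L2_scaleR\<close>)

lemma L2_tendsto_diff:
  fixes F G :: "nat \<Rightarrow> 'a \<Rightarrow> 'b::{real_normed_vector, second_countable_topology}"
  assumes F: "L2_tendsto M F f" and G: "L2_tendsto M G g"
  shows "L2_tendsto M (\<lambda>k \<omega>. F k \<omega> - G k \<omega>) (\<lambda>\<omega>. f \<omega> - g \<omega>)"
  using L2_tendsto_add[OF F L2_tendsto_scaleR[OF G, of "-1"]] by simp

lemma L2_tendsto_sum: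
  fixes F :: "'i \<Rightarrow> nat \<Rightarrow> 'a \<Rightarrow> 'b::{real_normed_vector, second_countable_topology}"
  assumes "\<And>i. i \<in> I \<Longrightarrow> L2_tendsto M (F i) (f i)"
  shows "L2_tendsto M (\<lambda>k \<omega>. \<Sum>i\<in>I. F i k \<omega>) (\<lambda>\<omega>. \<Sum>i\<in>I. f i \<omega>)"
  using assms
proof (induction I rule: infinite_finite_induct)
  case (insert x I)
  then show ?case using L2_tendsto_add[of M "F x" "f x"] by simp
qed (auto intro: L2_tendsto_const)

text \<open>Bilinear expansion around the limits: each of the three error terms has a factor tending
  to 0 in L2, so Cauchy-Schwarz removes it.\<close>

lemma L2_inner_tendsto:
  fixes F G :: "nat \<Rightarrow> 'a \<Rightarrow> 'b::{real_inner, second_countable_topology}"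
  assumes F: "L2_tendsto M F f" and G: "L2_tendsto M G g"
  shows "(\<lambda>k. LINT \<omega>|M. F k \<omega> \<bullet> G k \<omega>) \<longlonglongrightarrow> (LINT \<omega>|M. f \<omega> \<bullet> g \<omega>)"
proof -
  note F' = L2_tendstoD[OF F] and G' = L2_tendstoD[OF G]
  have zero: "(\<lambda>k. LINT \<omega>|M. U k \<omega> \<bullet> V k \<omega>) \<longlonglongrightarrow> 0"
    if UV: "\<And>k. in_L2 M (U k)" "\<And>k. in_L2 M (V k)"
      and lim: "(\<lambda>k. (LINT \<omega>|M. (norm (U k \<omega>))\<^sup>2) * (LINT \<omega>|M. (norm (V k \<omega>))\<^sup>2)) \<longlonglongrightarrow> 0"
    for U V :: "nat \<Rightarrow> 'a \<Rightarrow> 'b"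
  proof -
    have "(\<lambda>k. (LINT \<omega>|M. U k \<omega> \<bullet> V k \<omega>)\<^sup>2) \<longlonglongrightarrow> 0"
      by (rule tendsto_sandwich[OF _ _ tendsto_const lim]) (auto intro!: always_eventually L2_Cauchy_Schwarz UV)
    then have "(\<lambda>k. sqrt ((LINT \<omega>|M. U k \<omega> \<bullet> V k \<omega>)\<^sup>2)) \<longlonglongrightarrow> sqrt 0"
      by (intro tendsto_real_sqrt)
    then show ?thesis by (simp add: tendsto_rabs_zero_iff)
  qed
  have 1: "(\<lambda>k. LINT \<omega>|M. (F k \<omega> - f \<omega>) \<bullet> (G k \<omega> - g \<omega>)) \<longlonglongrightarrow> 0"
    using F' G' tendsto_mult[OF F'(3) G'(3)] by (intro zero) (auto intro: in_L2_diff)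
  have 2: "(\<lambda>k. LINT \<omega>|M. (F k \<omega> - f \<omega>) \<bullet> g \<omega>) \<longlonglongrightarrow> 0"
    using F' G' tendsto_mult_right[OF F'(3)] by (intro zero) (auto intro: in_L2_diff)
  have 3: "(\<lambda>k. LINT \<omega>|M. f \<omega> \<bullet> (G k \<omega> - g \<omega>)) \<longlonglongrightarrow> 0"
    using F' G' tendsto_mult_left[OF G'(3)] by (intro zero) (auto intro: in_L2_diff)
  have "(LINT \<omega>|M. (F k \<omega> - f \<omega>) \<bullet> (G k \<omega> - g \<omega>)) + (LINT \<omega>|M. (F k \<omega> - f \<omega>) \<bullet> g \<omega>)
      + (LINT \<omega>|M. f \<omega> \<bullet> (G k \<omega> - g \<omega>)) + (LINT \<omega>|M. f \<omega> \<bullet> g \<omega>) = (LINT \<omega>|M. F k \<omega> \<bullet> G k \<omega>)" for k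
  proof -
    note i = integrable_L2_inner[OF F'(1) G'(1), of k k] integrable_L2_inner[OF F'(1) G'(2), of k]
      integrable_L2_inner[OF F'(2) G'(1), of k] integrable_L2_inner[OF F'(2) G'(2)]
    show ?thesis
      using i by (simp add: inner_diff_left inner_diff_right)
  qed
  then show ?thesis
    using tendsto_add[OF tendsto_add[OF tendsto_add[OF 1 2] 3] tendsto_const[of "LINT \<omega>|M. f \<omega> \<bullet> g \<omega>"]]
    by simp
qed

lemma L2_mult_tendsto:
  fixes F G :: "nat \<Rightarrow> 'a \<Rightarrow> real"
  assumes "L2_tendsto M F f" "L2_tendsto M G g"
  shows "(\<lambda>k. LINT \<omega>|M. F k \<omega> * G k \<omega>) \<longlonglongrightarrow> (LINT \<omega>|M. f \<omega> * g \<omega>)"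
  using L2_inner_tendsto[OF assms] by simp

lemma (in finite_measure) L2_tendsto_AE_subseq:
  fixes F :: "nat \<Rightarrow> 'a \<Rightarrow> 'b::{real_normed_vector, second_countable_topology}"
  assumes F: "L2_tendsto M F f"
  shows "\<exists>r. strict_mono r \<and> (AE \<omega> in M. (\<lambda>k. F (r k) \<omega>) \<longlonglongrightarrow> f \<omega>)"
proof -
  have "\<exists>r. strict_mono r \<and> (AE \<omega> in M. (\<lambda>k. (norm (F (r k) \<omega> - f \<omega>))\<^sup>2) \<longlonglongrightarrow> 0)"
    using L2_tendstoD[OF F] in_L2_diff[THEN in_L2_integrable_power2]
    by (intro tendsto_L1_AE_subseq) auto
  then obtain r where r: "strict_mono r" "AE \<omega> in M. (\<lambda>k. (norm (F (r k) \<omega> - f \<omega>))\<^sup>2) \<longlonglongrightarrow> 0"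
    by blast
  from r(2) have "AE \<omega> in M. (\<lambda>k. F (r k) \<omega>) \<longlonglongrightarrow> f \<omega>"
  proof eventually_elim
    case (elim \<omega>)
    then have "(\<lambda>k. sqrt ((norm (F (r k) \<omega> - f \<omega>))\<^sup>2)) \<longlonglongrightarrow> sqrt 0"
      by (intro tendsto_real_sqrt)
    then show ?case
      by (simp add: LIM_zero_iff tendsto_norm_zero_iff)
  qed
  with r(1) show ?thesis by blast
qed

lemma L2_tendsto_dominated:
  fixes F :: "nat \<Rightarrow> 'a \<Rightarrow> 'b::{real_normed_vector, second_countable_topology}"
  assumes F: "\<And>k. F k \<in> borel_measurable M" and f: "f \<in> borel_measurable M"
    and lim: "AE \<omega> in M. (\<lambda>k. F k \<omega>) \<longlonglongrightarrow> f \<omega>"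
    and w: "in_L2 M w" and bd: "\<And>k. AE \<omega> in M. norm (F k \<omega>) \<le> (w \<omega> :: real)"
  shows "L2_tendsto M F f"
proof -
  have bd': "AE \<omega> in M. \<forall>k. norm (F k \<omega>) \<le> w \<omega>" using bd by (simp add: AE_all_countable)
  have fb: "AE \<omega> in M. norm (f \<omega>) \<le> w \<omega>"
    using lim bd' by eventually_elim (rule LIMSEQ_le_const2[OF tendsto_norm], auto)
  have L2F: "in_L2 M (F k)" for k
    using bd[of k] by (intro in_L2_bound[OF w F]) (auto elim!: eventually_mono)
  have L2f: "in_L2 M f"
    using fb by (intro in_L2_bound[OF w f]) (auto elim!: eventually_mono)
  have "(\<lambda>k. LINT \<omega>|M. (norm (F k \<omega> - f \<omega>))\<^sup>2) \<longlonglongrightarrow> (LINT \<omega>|M. 0)"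
  \<comment> \<open>Both \<open>F k\<close> and its limit are bounded by w, hence their squared
    distance by (2w)^2.\<close>
  proof (rule integral_dominated_convergence[where w = "\<lambda>\<omega>. 4 * (w \<omega>)\<^sup>2"])
    show "integrable M (\<lambda>\<omega>. 4 * (w \<omega>)\<^sup>2)" using w by (simp add: in_L2_real_iff)
    show "AE \<omega> in M. (\<lambda>k. (norm (F k \<omega> - f \<omega>))\<^sup>2) \<longlonglongrightarrow> 0"
      using lim
    proof eventually_elim
      case (elim \<omega>)
      then have "(\<lambda>k. (norm (F k \<omega> - f \<omega>))\<^sup>2) \<longlonglongrightarrow> (norm (f \<omega> - f \<omega>))\<^sup>2"
        by (intro tendsto_intros)
      then show ?case by simp
    qed
    show "AE \<omega> in M. norm ((norm (F k \<omega> - f \<omega>))\<^sup>2) \<le> 4 * (w \<omega>)\<^sup>2" for k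
      using bd' fb
    proof eventually_elim
      case (elim \<omega>)
      have "norm (F k \<omega> - f \<omega>) \<le> 2 * w \<omega>"
        using elim(1)[rule_format, of k] elim(2) norm_triangle_ineq4[of "F k \<omega>" "f \<omega>"] by linarith
      then have "(norm (F k \<omega> - f \<omega>))\<^sup>2 \<le> (2 * w \<omega>)\<^sup>2" by (intro power_mono) auto
      then show ?case by (simp add: power_mult_distrib)
    qed
  qed (use F f in measurable)
  with L2F L2f show ?thesis by (simp add: L2_tendsto_def)
qed

text \<open>Riesz-Fischer for Banach-valued functions; it produces the limits of derivatives and of
  chaos series. A rapidly Cauchy subsequence converges almost everywhere, and Fatou's lemma turns
  this into L2 convergence of the whole sequence.\<close>

lemma (in finite_measure) L2_complete:
  fixes F :: "nat \<Rightarrow> 'a \<Rightarrow> 'b::{banach, second_countable_topology}"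
  assumes F: "\<And>n. in_L2 M (F n)"
    and Cauchy: "\<And>e. e > 0 \<Longrightarrow> \<exists>N. \<forall>m\<ge>N. \<forall>n\<ge>N. (LINT \<omega>|M. (norm (F m \<omega> - F n \<omega>))\<^sup>2) < e"
  shows "\<exists>f. L2_tendsto M F f"
proof -
  have [measurable]: "F n \<in> borel_measurable M" for n using F by (simp add: in_L2_def)
  have int: "integrable M (\<lambda>\<omega>. (norm (F m \<omega> - F n \<omega>))\<^sup>2)" for m n
    using in_L2_diff[OF F F] by (rule in_L2_integrable_power2)
  define N where "N k = (SOME N. \<forall>m\<ge>N. \<forall>n\<ge>N. (LINT \<omega>|M. (norm (F m \<omega> - F n \<omega>))\<^sup>2) < (1/4)^k)" for k :: nat
  have N: "(LINT \<omega>|M. (norm (F m \<omega> - F n \<omega>))\<^sup>2) < (1/4)^k" if "m \<ge> N k" "n \<ge> N k" for m n k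
    using someI_ex[OF Cauchy[of "(1/4)^k"]] that unfolding N_def by (simp add: zero_less_power)
  \<comment> \<open>The partial sums of \<open>N\<close> dominate all earlier thresholds at
    once.\<close>
  define r where "r k = (\<Sum>j\<le>k. N j)" for k
  have rN: "r j \<ge> N k" if "k \<le> j" for j k
    unfolding r_def using that by (intro member_le_sum) auto
  define D where "D k \<omega> = F (r (Suc k)) \<omega> - F (r k) \<omega>" for k \<omega>
  have [measurable]: "D k \<in> borel_measurable M" for k unfolding D_def by measurable
  have Dint: "integrable M (\<lambda>\<omega>. (norm (D k \<omega>))\<^sup>2)" for k unfolding D_def by (rule int)
  have Dbound: "(LINT \<omega>|M. 2^k * (norm (D k \<omega>))\<^sup>2 + (1/2)^k) \<le> (1/2)^k * (1 + measure M (space M))" for k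
  proof -
    have "(LINT \<omega>|M. (norm (D k \<omega>))\<^sup>2) \<le> (1/4)^k"
      unfolding D_def using N[OF rN rN, of k "Suc k" k] by simp
    then have "2^k * (LINT \<omega>|M. (norm (D k \<omega>))\<^sup>2) \<le> 2^k * (1/4)^k"
      by (intro mult_left_mono) auto
    also have "2^k * (1/4)^k = (1/2 :: real)^k"
      by (simp add: power_mult_distrib[symmetric])
    finally show ?thesis using Dint by (simp add: algebra_simps)
  qed
  have nD: "(\<integral>\<^sup>+\<omega>. ennreal (norm (D k \<omega>)) \<partial>M) \<le> ennreal ((1/2)^k * (1 + measure M (space M)))" for k
  proof -
    \<comment> \<open>Weighted AM-GM: the squared norm integrates to at most 4^-k, so with the
      weight 2^k both terms on the right integrate to order 2^-k. This makes the norms of the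
      increments summable.\<close>
    have le: "norm (D k \<omega>) \<le> 2^k * (norm (D k \<omega>))\<^sup>2 + (1/2)^k" for \<omega>
    proof -
      define s :: real where "s = sqrt (2 ^ k)"
      have s: "s > 0" "s\<^sup>2 = 2^k" "(1/s)\<^sup>2 = (1/2)^k"
        by (simp_all add: s_def power_divide)
      have "2 * (s * norm (D k \<omega>)) * (1/s) \<le> (s * norm (D k \<omega>))\<^sup>2 + (1/s)\<^sup>2"
        by (rule sum_squares_bound)
      then have "2 * norm (D k \<omega>) \<le> 2^k * (norm (D k \<omega>))\<^sup>2 + (1/2)^k"
        using s by (simp add: power_mult_distrib)
      then show ?thesis using norm_ge_zero[of "D k \<omega>"] by linarith
    qed
    have "(\<integral>\<^sup>+\<omega>. ennreal (norm (D k \<omega>)) \<partial>M) \<le> (\<integral>\<^sup>+\<omega>. ennreal (2^k * (norm (D k \<omega>))\<^sup>2 + (1/2)^k) \<partial>M)"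
      by (intro nn_integral_mono ennreal_leI le)
    also have "\<dots> = ennreal (LINT \<omega>|M. 2^k * (norm (D k \<omega>))\<^sup>2 + (1/2)^k)"
      using Dint by (intro nn_integral_eq_integral) auto
    finally show ?thesis using Dbound[of k] ennreal_leI order_trans by blast
  qed
  have "(\<integral>\<^sup>+\<omega>. (\<Sum>k. ennreal (norm (D k \<omega>))) \<partial>M) = (\<Sum>k. \<integral>\<^sup>+\<omega>. ennreal (norm (D k \<omega>)) \<partial>M)"
    by (intro nn_integral_suminf) auto
  also have "\<dots> \<le> (\<Sum>k. ennreal ((1/2)^k * (1 + measure M (space M))))"
    by (intro suminf_le nD) auto
  also have "\<dots> < \<infinity>"
    by (subst suminf_ennreal_eq[OF _ summable_sums]) (auto intro!: summable_mult2 summable_geometric)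
  finally have "AE \<omega> in M. (\<Sum>k. ennreal (norm (D k \<omega>))) \<noteq> \<infinity>"
    by (intro nn_integral_PInf_AE) auto
  then have conv: "AE \<omega> in M. convergent (\<lambda>k. F (r k) \<omega>)"
  proof eventually_elim
    case (elim \<omega>)
    then have "summable (\<lambda>k. norm (D k \<omega>))"
      by (intro summable_suminf_not_top) auto
    then have "summable (\<lambda>k. D k \<omega>)" by (rule summable_norm_cancel)
    then have "convergent (\<lambda>n. \<Sum>k<n. D k \<omega>)" by (simp add: summable_iff_convergent)
    moreover have "(\<Sum>k<n. D k \<omega>) = F (r n) \<omega> - F (r 0) \<omega>" for n
      unfolding D_def by (rule sum_lessThan_telescope)
    ultimately have "convergent (\<lambda>n. (F (r n) \<omega> - F (r 0) \<omega>) + F (r 0) \<omega>)"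
      by (intro convergent_add convergent_const) simp
    then show ?case by simp
  qed
  define f where "f \<omega> = lim (\<lambda>k. F (r k) \<omega>)" for \<omega>
  have [measurable]: "f \<in> borel_measurable M"
    unfolding f_def by (intro borel_measurable_lim_metric) measurable
  have lim: "AE \<omega> in M. (\<lambda>k. F (r k) \<omega>) \<longlonglongrightarrow> f \<omega>"
    using conv unfolding f_def by (simp add: convergent_LIMSEQ_iff)
  \<comment> \<open>The second index of the Cauchy estimate runs to infinity along the subsequence,
    while n ranges over the whole sequence.\<close>
  have fatou: "(\<integral>\<^sup>+\<omega>. ennreal ((norm (F n \<omega> - f \<omega>))\<^sup>2) \<partial>M) \<le> ennreal ((1/4)^k)" if n: "n \<ge> N k" for n k
  proof -
    have "(\<integral>\<^sup>+\<omega>. ennreal ((norm (F n \<omega> - f \<omega>))\<^sup>2) \<partial>M)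
        = (\<integral>\<^sup>+\<omega>. liminf (\<lambda>j. ennreal ((norm (F n \<omega> - F (r j) \<omega>))\<^sup>2)) \<partial>M)"
    proof (intro nn_integral_cong_AE)
      show "AE \<omega> in M. ennreal ((norm (F n \<omega> - f \<omega>))\<^sup>2) = liminf (\<lambda>j. ennreal ((norm (F n \<omega> - F (r j) \<omega>))\<^sup>2))"
        using lim
      proof eventually_elim
        case (elim \<omega>)
        then have "(\<lambda>j. ennreal ((norm (F n \<omega> - F (r j) \<omega>))\<^sup>2)) \<longlonglongrightarrow> ennreal ((norm (F n \<omega> - f \<omega>))\<^sup>2)"
          by (intro tendsto_intros)
        then show ?case using lim_imp_Liminf[OF sequentially_bot] by metis
      qed
    qed
    also have "\<dots> \<le> liminf (\<lambda>j. \<integral>\<^sup>+\<omega>. ennreal ((norm (F n \<omega> - F (r j) \<omega>))\<^sup>2) \<partial>M)"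
      by (intro nn_integral_liminf) measurable
    also have "\<dots> \<le> ennreal ((1/4)^k)"
    proof (rule Liminf_le)
      show "\<forall>\<^sub>F j in sequentially. (\<integral>\<^sup>+\<omega>. ennreal ((norm (F n \<omega> - F (r j) \<omega>))\<^sup>2) \<partial>M) \<le> ennreal ((1/4)^k)"
        using eventually_ge_at_top[of k]
      proof eventually_elim
        case (elim j)
        have "(\<integral>\<^sup>+\<omega>. ennreal ((norm (F n \<omega> - F (r j) \<omega>))\<^sup>2) \<partial>M) = ennreal (LINT \<omega>|M. (norm (F n \<omega> - F (r j) \<omega>))\<^sup>2)"
          by (intro nn_integral_eq_integral int) auto
        also have "\<dots> \<le> ennreal ((1/4)^k)"
          using N[OF n rN[OF elim]] by (intro ennreal_leI) simp
        finally show ?case .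
      qed
    qed simp
    finally show ?thesis .
  qed
  have diffL2: "in_L2 M (\<lambda>\<omega>. F (N 0) \<omega> - f \<omega>)"
    unfolding in_L2_def
  proof (intro conjI integrableI_bounded)
    have "(\<integral>\<^sup>+\<omega>. ennreal ((norm (F (N 0) \<omega> - f \<omega>))\<^sup>2) \<partial>M) < \<infinity>"
      using fatou[of 0 "N 0"] by (rule le_less_trans) simp_all
    then show "(\<integral>\<^sup>+\<omega>. ennreal (norm ((norm (F (N 0) \<omega> - f \<omega>))\<^sup>2)) \<partial>M) < \<infinity>" by simp
  qed measurable
  have L2f: "in_L2 M f" using in_L2_diff[OF F[of "N 0"] diffL2] by simp
  have "(\<lambda>n. LINT \<omega>|M. (norm (F n \<omega> - f \<omega>))\<^sup>2) \<longlonglongrightarrow> 0"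
  proof (rule LIMSEQ_I)
    fix e :: real assume "e > 0"
    then obtain k where k: "(1/4)^k < e" using real_arch_pow_inv[of e "1/4"] by auto
    have "norm ((LINT \<omega>|M. (norm (F n \<omega> - f \<omega>))\<^sup>2) - 0) < e" if "n \<ge> N k" for n
    proof -
      have "ennreal (LINT \<omega>|M. (norm (F n \<omega> - f \<omega>))\<^sup>2) \<le> ennreal ((1/4)^k)"
        using fatou[OF that] in_L2_diff[OF F L2f, THEN in_L2_integrable_power2]
        by (subst nn_integral_eq_integral[symmetric]) auto
      then have "(LINT \<omega>|M. (norm (F n \<omega> - f \<omega>))\<^sup>2) \<le> (1/4)^k" by (simp add: ennreal_le_iff)
      with k show ?thesis by simp
    qed
    then show "\<exists>no. \<forall>n\<ge>no. norm ((LINT \<omega>|M. (norm (F n \<omega> - f \<omega>))\<^sup>2) - 0) < e" by blast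
  qed
  then show ?thesis using F L2f by (auto simp: L2_tendsto_def)
qed

section \<open>The density formula from Stein's identity\<close>

text \<open>Second-order control of exp on [-1, 1]; it bounds the remainders when the product of
  \<phi> and \<open>exp A\<close> is incremented in the integral equation below.\<close>

lemma exp_quadratic_bounds:
  fixes r :: real
  assumes "\<bar>r\<bar> \<le> 1"
  shows "\<bar>exp r - 1 - r\<bar> \<le> r\<^sup>2" "\<bar>exp r - 1\<bar> \<le> 2 * \<bar>r\<bar>"
proof -
  have upper: "exp r \<le> 1 + r + r\<^sup>2"
  proof (cases "r \<ge> 0")
    case True
    then show ?thesis using assms exp_bound[of r] by simp
  next
    case False
    have "(1 - r) * exp r \<le> exp (- r) * exp r"
      using exp_ge_add_one_self[of "- r"] by (intro mult_right_mono) auto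
    also have "\<dots> = 1" by (simp add: exp_minus)
    \<comment> \<open>The product is 1 - r^3, which is at least 1 for negative r.\<close>
    also have "1 \<le> (1 - r) * (1 + r + r\<^sup>2)"
      using False zero_le_power2[of r]
      by (simp add: algebra_simps power2_eq_square mult_nonpos_nonneg mult_nonneg_nonpos)
    finally show ?thesis using False by (simp add: mult_le_cancel_left)
  qed
  then show 1: "\<bar>exp r - 1 - r\<bar> \<le> r\<^sup>2" 
    using exp_ge_add_one_self[of r] zero_le_power2[of r] unfolding abs_le_iff by linarith
  have "r\<^sup>2 = \<bar>r\<bar> * \<bar>r\<bar>" by (simp add: power2_eq_square)
  also have "\<dots> \<le> 1 * \<bar>r\<bar>" by (rule mult_right_mono) (use assms in auto)
  finally have "r\<^sup>2 \<le> \<bar>r\<bar>" by simp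
  with 1 show "\<bar>exp r - 1\<bar> \<le> 2 * \<bar>r\<bar>" by linarith
qed

text \<open>The difference quotient at u is of order |v - u|, so G has derivative 0 throughout the
  interval.\<close>

lemma quadratic_increments_imp_eq:
  fixes G :: "real \<Rightarrow> real"
  assumes "x \<le> y" and d: "d > 0"
    and quad: "\<And>u v. x \<le> u \<Longrightarrow> u < v \<Longrightarrow> v \<le> y \<Longrightarrow> v - u \<le> d \<Longrightarrow> \<bar>G v - G u\<bar> \<le> C * (v - u)\<^sup>2"
  shows "G x = G y"
proof (cases "x = y")
  case False
  with \<open>x \<le> y\<close> have xy: "x < y" by simp
  have "(G has_vector_derivative 0) (at u within {x..y})" if u: "u \<in> {x..y}" for u
    unfolding has_vector_derivative_def has_derivative_within
  proof (intro conjI)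
    show "((\<lambda>v. (1 / norm (v - u)) *\<^sub>R (G v - (G u + (v - u) *\<^sub>R 0))) \<longlongrightarrow> 0) (at u within {x..y})"
    proof (rule Lim_null_comparison)
      show "\<forall>\<^sub>F v in at u within {x..y}. norm ((1 / norm (v - u)) *\<^sub>R (G v - (G u + (v - u) *\<^sub>R 0))) \<le> \<bar>C\<bar> * \<bar>v - u\<bar>"
        unfolding eventually_at
      proof (intro exI[of _ d] conjI d ballI impI)
        fix v assume v: "v \<in> {x..y}" "v \<noteq> u \<and> dist v u < d"
        have "\<bar>G v - G u\<bar> \<le> C * (v - u)\<^sup>2"
        proof (cases "u < v")
          case True
          then show ?thesis using v u by (intro quad) (auto simp: dist_real_def)
        next
          case False
          then have "\<bar>G u - G v\<bar> \<le> C * (u - v)\<^sup>2" using v u by (intro quad) (auto simp: dist_real_def)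
          then show ?thesis by (simp add: power2_commute abs_minus_commute)
        qed
        also have "\<dots> \<le> \<bar>C\<bar> * (v - u)\<^sup>2" by (intro mult_right_mono) auto
        also have "\<dots> = \<bar>C\<bar> * \<bar>v - u\<bar> * \<bar>v - u\<bar>" by (simp add: power2_eq_square mult.assoc)
        finally show "norm ((1 / norm (v - u)) *\<^sub>R (G v - (G u + (v - u) *\<^sub>R 0))) \<le> \<bar>C\<bar> * \<bar>v - u\<bar>"
          using v by (simp add: field_simps)
      qed
      have "((\<lambda>v. \<bar>C\<bar> * \<bar>v - u\<bar>) \<longlongrightarrow> \<bar>C\<bar> * \<bar>u - u\<bar>) (at u within {x..y})"
        by (intro tendsto_intros)
      then show "((\<lambda>v. \<bar>C\<bar> * \<bar>v - u\<bar>) \<longlongrightarrow> 0) (at u within {x..y})" by simp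
    qed
  qed (simp add: bounded_linear_scaleR_left)
  then have "((\<lambda>_. 0) has_integral (G y - G x)) {x..y}"
    using \<open>x \<le> y\<close> by (intro fundamental_theorem_of_calculus) auto
  then show ?thesis using has_integral_unique[OF has_integral_0] by fastforce
qed simp

text \<open>The kernel whose integral in \<open>x\<close> against a derivative \<open>F'\<close> is \<open>z * (F z - F 0)\<close>.\<close>

definition stein_kernel :: "real \<Rightarrow> real \<Rightarrow> real" where
  "stein_kernel z x = (if 0 \<le> x \<and> x < z then z else if z \<le> x \<and> x < 0 then - z else 0)"

lemma stein_kernel_nonneg: "stein_kernel z x \<ge> 0"
  by (simp add: stein_kernel_def)

text \<open>For z < 0 the interval is traversed backwards: the positive value -z of the kernel
  compensates the sign of the oriented integral from 0 to z. One nonnegative kernel thus serves both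
  signs.\<close>

lemma stein_kernel_integral:
  fixes F f :: "real \<Rightarrow> real"
  assumes deriv: "\<And>x. (F has_real_derivative f x) (at x)" and cont: "\<And>x. isCont f x"
  shows "integrable lborel (\<lambda>x. stein_kernel z x * f x)"
    and "(LINT x|lborel. stein_kernel z x * f x) = z * (F z - F 0)"
proof -
  have ii: "interval_lebesgue_integrable lborel (ereal 0) (ereal z) f"
    by (rule interval_integrable_isCont) (use cont in auto)
  have FTC: "(LBINT x=ereal 0..ereal z. f x) = F z - F 0"
  proof (rule interval_integral_FTC_finite)
    show "continuous_on {min 0 z..max 0 z} f"
      by (intro continuous_at_imp_continuous_on ballI cont)
    show "(F has_vector_derivative f x) (at x within {min 0 z..max 0 z})" for x
      using deriv has_field_derivative_at_within has_real_derivative_iff_has_vector_derivative by blast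
  qed
  \<comment> \<open>\<open>einterval\<close> is open while the kernel is half-open; the two can
    differ only at the endpoints.\<close>
  have ae: "AE x in lborel. x \<noteq> 0 \<and> x \<noteq> z"
    using AE_lborel_singleton[of 0] AE_lborel_singleton[of z] by eventually_elim auto
  have [measurable]: "f \<in> borel_measurable borel"
    by (intro borel_measurable_continuous_onI continuous_at_imp_continuous_on ballI cont)
  have m: "(\<lambda>x. stein_kernel z x) \<in> borel_measurable borel"
    unfolding stein_kernel_def by measurable
  note [measurable] = m
  have "integrable lborel (\<lambda>x. stein_kernel z x * f x) \<and>
    (LINT x|lborel. stein_kernel z x * f x) = z * (LBINT x=ereal 0..ereal z. f x)"
  proof (cases "0 \<le> z")
    case True
    then have si: "integrable lborel (\<lambda>x. indicator (einterval 0 z) x *\<^sub>R f x)"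
      using ii by (simp add: interval_lebesgue_integrable_def set_integrable_def zero_ereal_def)
    have eq: "AE x in lborel. stein_kernel z x * f x = z * (indicator (einterval 0 z) x *\<^sub>R f x)"
      using ae by eventually_elim (use True in \<open>auto simp: stein_kernel_def einterval_def indicator_def\<close>)
    have "integrable lborel (\<lambda>x. z * (indicator (einterval 0 z) x *\<^sub>R f x))"
      using si by (rule integrable_mult_right)
    then have 1: "integrable lborel (\<lambda>x. stein_kernel z x * f x)"
      by (subst integrable_cong_AE[OF _ _ eq]) measurable
    have "(LINT x|lborel. stein_kernel z x * f x) = (LINT x|lborel. z * (indicator (einterval 0 z) x *\<^sub>R f x))"
      by (rule integral_cong_AE[OF _ _ eq]) measurable
    also have "\<dots> = z * (LBINT x=ereal 0..ereal z. f x)"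
      using True by (simp add: interval_lebesgue_integral_def set_lebesgue_integral_def zero_ereal_def)
    finally show ?thesis using 1 by simp
  next
    case False
    then have si: "integrable lborel (\<lambda>x. indicator (einterval z 0) x *\<^sub>R f x)"
      using ii by (simp add: interval_lebesgue_integrable_def set_integrable_def zero_ereal_def)
    have eq: "AE x in lborel. stein_kernel z x * f x = - z * (indicator (einterval z 0) x *\<^sub>R f x)"
      using ae by eventually_elim (use False in \<open>auto simp: stein_kernel_def einterval_def indicator_def\<close>)
    have "integrable lborel (\<lambda>x. - z * (indicator (einterval z 0) x *\<^sub>R f x))"
      using si by (rule integrable_mult_right)
    then have 1: "integrable lborel (\<lambda>x. stein_kernel z x * f x)"
      by (subst integrable_cong_AE[OF _ _ eq]) measurable
    have "(LINT x|lborel. stein_kernel z x * f x) = (LINT x|lborel. - z * (indicator (einterval z 0) x *\<^sub>R f x))"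
      by (rule integral_cong_AE[OF _ _ eq]) measurable
    also have "\<dots> = z * (LBINT x=ereal 0..ereal z. f x)"
      using False by (simp add: interval_lebesgue_integral_def set_lebesgue_integral_def zero_ereal_def)
    finally show ?thesis using 1 by simp
  qed
  then show "integrable lborel (\<lambda>x. stein_kernel z x * f x)"
    and "(LINT x|lborel. stein_kernel z x * f x) = z * (F z - F 0)"
    using FTC by auto
qed

section \<open>The truncated mean E[Z; Z > x] of a centered variable\<close>

context prob_space
begin

definition tail_mean :: "('a \<Rightarrow> real) \<Rightarrow> real \<Rightarrow> real" where
  "tail_mean Z x = (LINT \<omega>|M. Z \<omega> * indicator {x<..} (Z \<omega>))"

context
  fixes Z :: "'a \<Rightarrow> real"
  assumes Zm [measurable]: "Z \<in> borel_measurable M" and Z2: "integrable M (\<lambda>\<omega>. (Z \<omega>)\<^sup>2)"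
    and mean: "(LINT \<omega>|M. Z \<omega>) = 0"
begin

lemma integrable_if_square: "integrable M Z"
  by (rule square_integrable_imp_integrable) (use Z2 in auto)

lemma integrable_tail: "integrable M (\<lambda>\<omega>. Z \<omega> * indicator A (Z \<omega>))" if [measurable]: "A \<in> sets borel" for A
  by (rule Bochner_Integration.integrable_bound[OF integrable_if_square]) (auto simp: indicator_def)

text \<open>For x < 0 the centering enters: E[Z; Z > x] = -E[Z; Z \<le> x], which is the lower
  branch of the kernel. In this form nonnegativity and the use of Fubini are immediate.\<close>

lemma tail_mean_eq_kernel: "tail_mean Z x = (LINT \<omega>|M. stein_kernel (Z \<omega>) x)"
proof (cases "0 \<le> x")
  case True
  then show ?thesis unfolding tail_mean_def
    by (intro Bochner_Integration.integral_cong) (auto simp: stein_kernel_def indicator_def)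
next
  case False
  have "(LINT \<omega>|M. stein_kernel (Z \<omega>) x) = (LINT \<omega>|M. Z \<omega> * indicator {x<..} (Z \<omega>) - Z \<omega>)"
    using False
    by (intro Bochner_Integration.integral_cong) (auto simp: stein_kernel_def indicator_def)
  also have "\<dots> = tail_mean Z x"
    unfolding tail_mean_def
    by (subst Bochner_Integration.integral_diff) (auto intro: integrable_tail integrable_if_square simp: mean)
  finally show ?thesis by simp
qed

lemma tail_mean_nonneg: "0 \<le> tail_mean Z x"
  unfolding tail_mean_eq_kernel by (simp add: stein_kernel_nonneg)

lemma tail_mean_le: "tail_mean Z x \<le> (LINT \<omega>|M. \<bar>Z \<omega>\<bar>)"
  unfolding tail_mean_def
  by (rule integral_mono[OF integrable_tail]) (auto intro: integrable_if_square simp: indicator_def)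

text \<open>The absolute value of Z is twice its positive part minus Z, and Z has mean 0.\<close>

lemma tail_mean_0: "tail_mean Z 0 = (LINT \<omega>|M. \<bar>Z \<omega>\<bar>) / 2"
proof -
  have "(LINT \<omega>|M. \<bar>Z \<omega>\<bar>) = (LINT \<omega>|M. 2 * (Z \<omega> * indicator {0<..} (Z \<omega>)) - Z \<omega>)"
    by (intro Bochner_Integration.integral_cong) (auto simp: indicator_def)
  also have "\<dots> = 2 * tail_mean Z 0"
    unfolding tail_mean_def
    by (subst Bochner_Integration.integral_diff) (auto intro: integrable_tail integrable_if_square simp: mean)
  finally show ?thesis by simp
qed

lemma tail_mean_measurable [measurable]: "tail_mean Z \<in> borel_measurable borel"
proof -
  have "(\<lambda>x. LINT \<omega>|M. stein_kernel (Z \<omega>) x) \<in> borel_measurable borel"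
    by (rule borel_measurable_lebesgue_integral) (unfold stein_kernel_def, measurable)
  then show ?thesis by (simp add: tail_mean_eq_kernel[abs_def])
qed

text \<open>Fubini applied to the kernel. Its total mass in x is z^2 (take F to be the identity), so
  square integrability of Z and the bound on f give absolute integrability on the product.\<close>

lemma tail_mean_integral:
  fixes F f :: "real \<Rightarrow> real"
  assumes deriv: "\<And>x. (F has_real_derivative f x) (at x)" and cont: "\<And>x. isCont f x"
    and bd: "\<And>x. \<bar>f x\<bar> \<le> 1"
  shows "integrable lborel (\<lambda>x. tail_mean Z x * f x)"
    and "(LINT x|lborel. tail_mean Z x * f x) = (LINT \<omega>|M. Z \<omega> * (F (Z \<omega>) - F 0))"
proof -
  interpret P: pair_sigma_finite M lborel ..
  have [measurable]: "f \<in> borel_measurable borel"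
    by (intro borel_measurable_continuous_onI continuous_at_imp_continuous_on ballI cont)
  have k1: "integrable lborel (\<lambda>x. stein_kernel z x)" "(LINT x|lborel. stein_kernel z x) = z\<^sup>2" for z
    using stein_kernel_integral[of "\<lambda>x. x" "\<lambda>_. 1" z] by (auto simp: power2_eq_square)
  note kf = stein_kernel_integral[OF deriv cont]
  have int: "integrable (M \<Otimes>\<^sub>M lborel) (\<lambda>p. stein_kernel (Z (fst p)) (snd p) * f (snd p))"
  proof (rule P.Fubini_integrable)
    show "(\<lambda>p. stein_kernel (Z (fst p)) (snd p) * f (snd p)) \<in> borel_measurable (M \<Otimes>\<^sub>M lborel)"
      unfolding stein_kernel_def by measurable
    have le: "(LINT x|lborel. norm (stein_kernel (Z \<omega>) x * f x)) \<le> (Z \<omega>)\<^sup>2" for \<omega>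
    proof -
      have "(LINT x|lborel. norm (stein_kernel (Z \<omega>) x * f x)) \<le> (LINT x|lborel. stein_kernel (Z \<omega>) x)"
      proof (rule integral_mono)
        show "integrable lborel (\<lambda>x. norm (stein_kernel (Z \<omega>) x * f x))"
          by (intro integrable_norm kf)
        show "norm (stein_kernel (Z \<omega>) x * f x) \<le> stein_kernel (Z \<omega>) x" for x
          using mult_left_mono[OF bd[of x] stein_kernel_nonneg[of "Z \<omega>" x]]
          by (simp add: abs_mult stein_kernel_nonneg)
      qed (rule k1)
      then show ?thesis by (simp add: k1)
    qed
    show "integrable M (\<lambda>\<omega>. LINT x|lborel. norm (stein_kernel (Z (fst (\<omega>, x))) (snd (\<omega>, x)) * f (snd (\<omega>, x))))"
    proof (rule Bochner_Integration.integrable_bound[OF Z2])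
      show "(\<lambda>\<omega>. LINT x|lborel. norm (stein_kernel (Z (fst (\<omega>, x))) (snd (\<omega>, x)) * f (snd (\<omega>, x)))) \<in> borel_measurable M"
        by (rule lborel.borel_measurable_lebesgue_integral) (unfold stein_kernel_def, measurable)
    qed (use le in \<open>auto intro!: AE_I2 order_trans[OF abs_of_nonneg[THEN eq_refl]]\<close>)
    show "AE \<omega> in M. integrable lborel (\<lambda>x. stein_kernel (Z (fst (\<omega>, x))) (snd (\<omega>, x)) * f (snd (\<omega>, x)))"
      using kf by simp
  qed
  have i: "integrable (M \<Otimes>\<^sub>M lborel) (\<lambda>(\<omega>, x). stein_kernel (Z \<omega>) x * f x)"
    using int by (simp add: case_prod_beta')
  then show "integrable lborel (\<lambda>x. tail_mean Z x * f x)"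
    using P.integrable_snd[OF i] by (simp add: tail_mean_eq_kernel)
  show "(LINT x|lborel. tail_mean Z x * f x) = (LINT \<omega>|M. Z \<omega> * (F (Z \<omega>) - F 0))"
    using P.Fubini_integral[OF i] kf(2) by (simp add: tail_mean_eq_kernel)
qed

end

end

section \<open>A linear integral equation with measurable coefficient\<close>

lemma set_integral_Ioc_bound:
  fixes f :: "real \<Rightarrow> real"
  assumes [measurable]: "f \<in> borel_measurable borel" and "u \<le> v"
    and bd: "\<And>y. u < y \<Longrightarrow> y \<le> v \<Longrightarrow> \<bar>f y\<bar> \<le> C"
  shows "set_integrable lborel {u<..v} f" and "\<bar>LBINT y:{u<..v}. f y\<bar> \<le> C * (v - u)"
proof -
  have ci: "integrable lborel (\<lambda>y. C * indicator {u<..v} y)"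
    by (intro integrable_mult_right integrable_real_indicator) (use \<open>u \<le> v\<close> in auto)
  have le: "norm (indicator {u<..v} y *\<^sub>R f y) \<le> C * indicator {u<..v} y" for y
    using bd[of y] by (auto simp: indicator_def)
  show si: "set_integrable lborel {u<..v} f"
    unfolding set_integrable_def
    by (rule Bochner_Integration.integrable_bound[OF ci])
      (use le in \<open>auto intro!: AE_I2 order_trans[OF _ abs_ge_self]\<close>)
  have "\<bar>LBINT y:{u<..v}. f y\<bar> \<le> (LINT y|lborel. norm (indicator {u<..v} y *\<^sub>R f y))"
    unfolding set_lebesgue_integral_def by (metis integral_norm_bound real_norm_def)
  also have "\<dots> \<le> (LINT y|lborel. C * indicator {u<..v} y)"
    by (rule integral_mono) (use si ci le in \<open>auto simp: set_integrable_def\<close>)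
  also have "\<dots> = C * (v - u)" using \<open>u \<le> v\<close> by simp
  finally show "\<bar>LBINT y:{u<..v}. f y\<bar> \<le> C * (v - u)" .
qed

text \<open>With \<open>A x\<close> the integral of \<open>a\<close> over \<open>{0..x}\<close>, the increments of \<open>\<lambda>x. \<phi> x * exp (A x)\<close> are
  quadratically small, so this function is constant although neither factor need be differentiable.\<close>

lemma linear_volterra_unique:
  fixes \<phi> a :: "real \<Rightarrow> real"
  assumes [measurable]: "a \<in> borel_measurable borel" "\<phi> \<in> borel_measurable borel"
    and a: "\<And>y. \<bar>a y\<bar> \<le> k * \<bar>y\<bar>" and k: "k > 0"
    and B: "\<And>y. \<bar>\<phi> y\<bar> \<le> B"
    and eq: "\<And>u v. u < v \<Longrightarrow> \<phi> v - \<phi> u = - (LBINT y:{u<..v}. a y * \<phi> y)"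
  shows "\<phi> x = \<phi> 0 * exp (- (LBINT y=0..ereal x. a y))"
proof -
  define A where "A x = (LBINT y=0..ereal x. a y)" for x
  define G where "G x = \<phi> x * exp (A x)" for x
  \<comment> \<open>The window of radius R contains 0 and x; the 1 keeps R, and with it
    \<open>K\<close>, positive when x = 0.\<close>
  define R where "R = \<bar>x\<bar> + 1"
  define K where "K = k * R"
  have R: "R > 0" and K: "K > 0" and B0: "B \<ge> 0" using k B[of 0] by (auto simp: R_def K_def)
  have aK: "\<bar>a y\<bar> \<le> K" if "\<bar>y\<bar> \<le> R" for y
    using order_trans[OF a mult_left_mono[OF that less_imp_le[OF k]]] by (simp add: K_def)
  have A_diff: "A v - A u = (LBINT y:{u<..v}. a y)" if "u \<le> v" "\<bar>u\<bar> \<le> R" "\<bar>v\<bar> \<le> R" for u v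
  proof -
    have "(LBINT y=0..ereal u. a y) + (LBINT y=ereal u..ereal v. a y) = (LBINT y=0..ereal v. a y)"
    proof (rule interval_integral_sum)
      have "set_integrable lborel {-R<..R} a"
        by (rule set_integral_Ioc_bound(1)[where C = K]) (use aK R in auto)
      then have "set_integrable lborel (einterval (min 0 (min (ereal u) (ereal v))) (max 0 (max (ereal u) (ereal v)))) a"
        by (rule set_integrable_subset)
          (use that R in \<open>auto simp: einterval_def min_def max_def zero_ereal_def split: if_splits\<close>)
      then show "interval_lebesgue_integrable lborel (min 0 (min (ereal u) (ereal v))) (max 0 (max (ereal u) (ereal v))) a"
        by (auto simp: interval_lebesgue_integrable_def min_def max_def zero_ereal_def)
    qed
    then show ?thesis
      using that by (simp add: A_def interval_integral_Ioc)
  qed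
  have A0: "A 0 = 0" by (simp add: A_def zero_ereal_def)
  have A_lip: "\<bar>A v - A u\<bar> \<le> K * (v - u)" if "u \<le> v" "\<bar>u\<bar> \<le> R" "\<bar>v\<bar> \<le> R" for u v
    unfolding A_diff[OF that] by (rule set_integral_Ioc_bound) (use that aK in auto)
  have A_bound: "\<bar>A u\<bar> \<le> K * R" if "\<bar>u\<bar> \<le> R" for u
  proof -
    have "\<bar>A u\<bar> \<le> K * \<bar>u\<bar>"
      using A_lip[of 0 u] A_lip[of u 0] A0 that R by (cases "0 \<le> u") auto
    also have "\<dots> \<le> K * R" using that K by (intro mult_left_mono) auto
    finally show ?thesis .
  qed
  \<comment> \<open>The integral equation itself makes \<phi> Lipschitz on the window.\<close>
  have \<phi>_lip: "\<bar>\<phi> v - \<phi> u\<bar> \<le> K * B * (v - u)" if "u < v" "\<bar>u\<bar> \<le> R" "\<bar>v\<bar> \<le> R" for u v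
  proof -
    have "\<bar>LBINT y:{u<..v}. a y * \<phi> y\<bar> \<le> K * B * (v - u)"
    proof (rule set_integral_Ioc_bound)
      show "\<bar>a y * \<phi> y\<bar> \<le> K * B" if "u < y" "y \<le> v" for y
        unfolding abs_mult using aK[of y] B[of y] K that \<open>\<bar>u\<bar> \<le> R\<close> \<open>\<bar>v\<bar> \<le> R\<close>
        by (intro mult_mono) auto
    qed (use that in auto)
    then show ?thesis using eq[OF that(1)] by simp
  qed
  \<comment> \<open>Steps of length at most 1 / K keep the increment of \<open>A\<close> within
    [-1, 1], where the bounds on exp apply.\<close>
  have G_quad: "\<bar>G v - G u\<bar> \<le> (4 * K\<^sup>2 * B * exp (K * R)) * (v - u)\<^sup>2"
    if uv: "u < v" "\<bar>u\<bar> \<le> R" "\<bar>v\<bar> \<le> R" and d: "v - u \<le> 1 / K" for u v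
  proof -
    define r h \<delta> where "r = A v - A u" and "h = v - u" and "\<delta> = \<phi> v - \<phi> u"
    have h: "h > 0" "K * h \<le> 1" using uv d K by (auto simp: h_def field_simps)
    have r: "\<bar>r\<bar> \<le> K * h" using A_lip[of u v] uv by (auto simp: r_def h_def)
    then have r1: "\<bar>r\<bar> \<le> 1" using h by linarith
    have \<delta>: "\<bar>\<delta>\<bar> \<le> K * B * h" using \<phi>_lip[OF uv] by (simp add: \<delta>_def h_def)
    have ia: "set_integrable lborel {u<..v} a"
      by (rule set_integral_Ioc_bound(1)[where C = K]) (use uv aK in auto)
    have ia\<phi>: "set_integrable lborel {u<..v} (\<lambda>y. a y * \<phi> y)"
    proof (rule set_integral_Ioc_bound(1)[where C = "K * B"])
      show "\<bar>a y * \<phi> y\<bar> \<le> K * B" if "u < y" "y \<le> v" for y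
        unfolding abs_mult using aK[of y] B[of y] K that uv
        by (intro mult_mono) auto
    qed (use uv in auto)
    \<comment> \<open>The first-order terms cancel: by the integral equation the increment of \<phi>
      is \<open>- \<phi> u * r\<close> up to an integral of the oscillation of \<phi>, which is
      itself of order h.\<close>
    have "\<delta> + \<phi> u * r = - (LBINT y:{u<..v}. a y * (\<phi> y - \<phi> u))"
    proof -
      have "(LBINT y:{u<..v}. a y * (\<phi> y - \<phi> u)) = (LBINT y:{u<..v}. a y * \<phi> y - \<phi> u * a y)"
        by (simp add: algebra_simps)
      also have "\<dots> = (LBINT y:{u<..v}. a y * \<phi> y) - \<phi> u * (LBINT y:{u<..v}. a y)"
        using ia ia\<phi> by (subst set_integral_diff(2)) auto
      finally show ?thesis
        using eq[OF uv(1)] A_diff[of u v] uv by (simp add: \<delta>_def r_def)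
    qed
    moreover have "\<bar>LBINT y:{u<..v}. a y * (\<phi> y - \<phi> u)\<bar> \<le> K * (K * B * h) * (v - u)"
    proof (rule set_integral_Ioc_bound)
      show "\<bar>a y * (\<phi> y - \<phi> u)\<bar> \<le> K * (K * B * h)" if y: "u < y" "y \<le> v" for y
      proof -
        have "\<bar>\<phi> y - \<phi> u\<bar> \<le> K * B * (y - u)" using y uv by (intro \<phi>_lip) auto
        also have "\<dots> \<le> K * B * h" using y K B0 by (intro mult_left_mono) (auto simp: h_def)
        finally show ?thesis
          unfolding abs_mult using aK[of y] K y uv by (intro mult_mono) auto
      qed
    qed (use uv in auto)
    ultimately have t2: "\<bar>\<delta> + \<phi> u * r\<bar> \<le> K\<^sup>2 * B * h\<^sup>2"
      by (simp add: power2_eq_square mult_ac h_def)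
    have "\<bar>\<delta> * (exp r - 1)\<bar> \<le> (K * B * h) * (2 * (K * h))"
      unfolding abs_mult using exp_quadratic_bounds(2)[OF r1] r \<delta> K B0 h
      by (intro mult_mono) auto
    then have t1: "\<bar>\<delta> * (exp r - 1)\<bar> \<le> 2 * (K\<^sup>2 * B * h\<^sup>2)"
      by (simp add: power2_eq_square mult_ac)
    have "r\<^sup>2 \<le> (K * h)\<^sup>2" using r by (simp add: abs_le_square_iff[symmetric])
    then have "\<bar>\<phi> u * (exp r - 1 - r)\<bar> \<le> B * (K * h)\<^sup>2"
      unfolding abs_mult using exp_quadratic_bounds(1)[OF r1] B[of u] B0
      by (intro mult_mono) auto
    then have t3: "\<bar>\<phi> u * (exp r - 1 - r)\<bar> \<le> K\<^sup>2 * B * h\<^sup>2"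
      by (simp add: power2_eq_square mult_ac)
    \<comment> \<open>Three terms, each quadratic in h: a product of two first-order increments, the
      cancellation above, and the Taylor remainder of exp. Their constants 2, 1 and 1 add up to the
      4.\<close>
    have "G v - G u = exp (A u) * (\<delta> * (exp r - 1) + (\<delta> + \<phi> u * r) + \<phi> u * (exp r - 1 - r))"
      by (simp add: G_def r_def \<delta>_def exp_diff field_simps)
    also have "\<bar>\<dots>\<bar> \<le> exp (K * R) * (4 * (K\<^sup>2 * B * h\<^sup>2))"
      unfolding abs_mult using t1 t2 t3 A_bound[of u] uv by (intro mult_mono) auto
    finally show ?thesis by (simp add: h_def mult_ac)
  qed
  have "G 0 = G x"
  proof (cases "0 \<le> x")
    case True
    show ?thesis
      by (rule quadratic_increments_imp_eq[OF True, of "1 / K" _ "4 * K\<^sup>2 * B * exp (K * R)"]) (use K G_quad in \<open>auto simp: R_def\<close>)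
  next
    case False
    then have "x \<le> 0" by simp
    have "G x = G 0"
      by (rule quadratic_increments_imp_eq[OF \<open>x \<le> 0\<close>, of "1 / K" _ "4 * K\<^sup>2 * B * exp (K * R)"]) (use K G_quad in \<open>auto simp: R_def\<close>)
    then show ?thesis by simp
  qed
  then have "\<phi> 0 = \<phi> x * exp (A x)" by (simp add: G_def A0)
  then show ?thesis by (simp add: A_def exp_minus field_simps)
qed


section \<open>The law of Z from its Fourier identities\<close>

context prob_space
begin

text \<open>Division by c, the variance of Z, turns both sides into probability measures, so Levy's
  uniqueness theorem applies. The characteristic functions agree because
  \<open>tail_mean_integral\<close>, used with a primitive of cos or sin, reproduces the left-hand
  sides of the trigonometric identities.\<close>

lemma stein_identity_weighted_law:
  fixes Z :: "'a \<Rightarrow> real" and g :: "real \<Rightarrow> real"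
  assumes Zm [measurable]: "Z \<in> borel_measurable M" and Z2: "integrable M (\<lambda>\<omega>. (Z \<omega>)\<^sup>2)"
    and mean: "(LINT \<omega>|M. Z \<omega>) = 0"
    and [measurable]: "g \<in> borel_measurable borel" and gint: "integrable M (\<lambda>\<omega>. g (Z \<omega>))"
    and gpos: "AE \<omega> in M. g (Z \<omega>) \<ge> 0"
    and c: "(LINT \<omega>|M. (Z \<omega>)\<^sup>2) = c" "(LINT \<omega>|M. g (Z \<omega>)) = c" "c > 0"
    and sin: "\<And>t. (LINT \<omega>|M. Z \<omega> * sin (t * Z \<omega>)) = t * (LINT \<omega>|M. g (Z \<omega>) * cos (t * Z \<omega>))"
    and cos: "\<And>t. (LINT \<omega>|M. Z \<omega> * (cos (t * Z \<omega>) - 1)) = - t * (LINT \<omega>|M. g (Z \<omega>) * sin (t * Z \<omega>))"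
  shows "distr (density M (\<lambda>\<omega>. ennreal (g (Z \<omega>) / c))) borel Z = density lborel (\<lambda>x. ennreal (tail_mean Z x / c))"
    (is "?M1 = ?M2")
proof -
  note TM = tail_mean_integral[OF Zm Z2 mean] tail_mean_nonneg[OF Zm Z2 mean]
  note [measurable] = tail_mean_measurable[OF Zm Z2 mean]
  have i\<phi>: "integrable lborel (tail_mean Z)" "(LINT x|lborel. tail_mean Z x) = c"
    using TM(1,2)[of "\<lambda>x. x" "\<lambda>_. 1"] c by (auto simp: power2_eq_square)
  have gpos': "AE \<omega> in M. 0 \<le> g (Z \<omega>) / c" using gpos c by (auto elim!: eventually_mono)
  interpret D: prob_space "density M (\<lambda>\<omega>. ennreal (g (Z \<omega>) / c))"
  proof
    show "emeasure (density M (\<lambda>\<omega>. ennreal (g (Z \<omega>) / c))) (space (density M (\<lambda>\<omega>. ennreal (g (Z \<omega>) / c)))) = 1"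
      using gint gpos' c
      by (simp add: emeasure_density nn_integral_eq_integral cong: nn_integral_cong_simp)
  qed
  have r1: "real_distribution ?M1" by (rule D.real_distribution_distr) simp
  have r2: "real_distribution ?M2"
  proof (intro real_distribution.intro prob_spaceI real_distribution_axioms.intro)
    have "(\<integral>\<^sup>+x. ennreal (tail_mean Z x / c) \<partial>lborel) = ennreal (LINT x|lborel. tail_mean Z x / c)"
      using i\<phi> TM(3) c by (intro nn_integral_eq_integral) auto
    also have "\<dots> = 1" using i\<phi> c by simp
    finally show "emeasure ?M2 (space ?M2) = 1"
      by (simp add: emeasure_density cong: nn_integral_cong_simp)
  qed simp
  have "char ?M1 t = char ?M2 t" for t
  proof (cases "t = 0")
    case True
    then show ?thesis by (simp add: real_distribution.char_zero[OF r1] real_distribution.char_zero[OF r2])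
  next
    case False
    have gi: "integrable M (\<lambda>\<omega>. complex_of_real (g (Z \<omega>) / c) * iexp (t * Z \<omega>))"
      by (rule Bochner_Integration.integrable_bound[OF integrable_divide[OF gint, of c]]) (auto simp: norm_mult norm_divide norm_exp_eq_Re)
    have ti: "integrable lborel (\<lambda>x. complex_of_real (tail_mean Z x / c) * iexp (t * x))"
      by (rule Bochner_Integration.integrable_bound[OF integrable_divide[OF i\<phi>(1), of c]]) (auto simp: norm_mult norm_divide norm_exp_eq_Re)
    have c1: "char ?M1 t = (CLINT \<omega>|M. complex_of_real (g (Z \<omega>) / c) * iexp (t * Z \<omega>))"
      unfolding char_def using gpos'
      by (simp add: integral_distr integral_density scaleR_conv_of_real)
    have c2: "char ?M2 t = (CLINT x|lborel. complex_of_real (tail_mean Z x / c) * iexp (t * x))"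
      unfolding char_def using TM(3) c
      by (simp add: integral_density scaleR_conv_of_real)
    \<comment> \<open>The primitive is \<open>sin (t * x) / t\<close>; dividing by t is the reason
      for treating frequency 0 apart.\<close>
    have tc: "(LINT x|lborel. tail_mean Z x * cos (t * x)) = (LINT \<omega>|M. g (Z \<omega>) * cos (t * Z \<omega>))"
    proof -
      have "(LINT x|lborel. tail_mean Z x * cos (t * x)) = (LINT \<omega>|M. Z \<omega> * (sin (t * Z \<omega>) / t - sin (t * 0) / t))"
        using False by (intro TM(2)) (auto intro!: derivative_eq_intros)
      also have "\<dots> = (LINT \<omega>|M. Z \<omega> * sin (t * Z \<omega>)) / t" by simp
      finally show ?thesis using sin[of t] False by simp
    qed
    have ts: "(LINT x|lborel. tail_mean Z x * sin (t * x)) = (LINT \<omega>|M. g (Z \<omega>) * sin (t * Z \<omega>))"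
    proof -
      have "(LINT x|lborel. tail_mean Z x * sin (t * x)) = (LINT \<omega>|M. Z \<omega> * (- cos (t * Z \<omega>) / t - - cos (t * 0) / t))"
        using False by (intro TM(2)) (auto intro!: derivative_eq_intros)
      also have "\<dots> = (LINT \<omega>|M. - (Z \<omega> * (cos (t * Z \<omega>) - 1)) / t)"
        by (intro Bochner_Integration.integral_cong) (use False in \<open>auto simp: field_simps\<close>)
      also have "\<dots> = - (LINT \<omega>|M. Z \<omega> * (cos (t * Z \<omega>) - 1)) / t" by simp
      finally show ?thesis using cos[of t] False by simp
    qed
    show ?thesis unfolding c1 c2
    proof (rule complex_eqI)
      show "Re (CLINT \<omega>|M. complex_of_real (g (Z \<omega>) / c) * iexp (t * Z \<omega>))
        = Re (CLINT x|lborel. complex_of_real (tail_mean Z x / c) * iexp (t * x))"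
        unfolding integral_Re[OF gi, symmetric] integral_Re[OF ti, symmetric]
        using tc by (simp add: Re_exp)
      show "Im (CLINT \<omega>|M. complex_of_real (g (Z \<omega>) / c) * iexp (t * Z \<omega>))
        = Im (CLINT x|lborel. complex_of_real (tail_mean Z x / c) * iexp (t * x))"
        unfolding integral_Im[OF gi, symmetric] integral_Im[OF ti, symmetric]
        using ts by (simp add: Im_exp)
    qed
  qed
  then show ?thesis by (intro Levy_uniqueness r1 r2) auto
qed

text \<open>The disjunction in the conclusion records positivity of \<rho> wherever
  \<open>g z \<ge> s\<close>; together with the almost everywhere bound on g it determines the
  support.\<close>

theorem stein_identity_density:
  fixes Z :: "'a \<Rightarrow> real" and g :: "real \<Rightarrow> real"
  assumes Zm [measurable]: "Z \<in> borel_measurable M" and Z2: "integrable M (\<lambda>\<omega>. (Z \<omega>)\<^sup>2)"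
    and mean: "(LINT \<omega>|M. Z \<omega>) = 0"
    and gm [measurable]: "g \<in> borel_measurable borel" and gint: "integrable M (\<lambda>\<omega>. g (Z \<omega>))"
    and s: "s > 0" and gs: "AE \<omega> in M. g (Z \<omega>) \<ge> s"
    and var: "(LINT \<omega>|M. (Z \<omega>)\<^sup>2) = (LINT \<omega>|M. g (Z \<omega>))"
    and sin: "\<And>t. (LINT \<omega>|M. Z \<omega> * sin (t * Z \<omega>)) = t * (LINT \<omega>|M. g (Z \<omega>) * cos (t * Z \<omega>))"
    and cos: "\<And>t. (LINT \<omega>|M. Z \<omega> * (cos (t * Z \<omega>) - 1)) = - t * (LINT \<omega>|M. g (Z \<omega>) * sin (t * Z \<omega>))"
  shows "\<exists>\<rho> :: real \<Rightarrow> real. (\<forall>z. 0 < \<rho> z \<or> (0 \<le> \<rho> z \<and> g z < s)) \<and> (AE z in lborel. g z \<ge> s) \<and>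
    distributed M lborel Z (\<lambda>z. ennreal (\<rho> z)) \<and>
    (AE z in lborel. \<rho> z = (LINT \<omega>|M. \<bar>Z \<omega>\<bar>) / (2 * g z) * exp (- (LBINT x=0..ereal z. x / g x)))"
proof -
  define c where "c = (LINT \<omega>|M. g (Z \<omega>))"
  \<comment> \<open>A truncated reciprocal of g: g is controlled only almost surely under the law of
    Z, whereas \<open>w\<close> is bounded by 1 / s everywhere, as the integral equation
    requires.\<close>
  define w where "w z = (if g z \<ge> s then 1 / g z else 0)" for z
  define \<phi> where "\<phi> = tail_mean Z"
  define \<rho> where "\<rho> x = \<phi> x * w x" for x
  have "s \<le> c"
    unfolding c_def using integral_ge_const[OF gint gs] by simp
  then have c: "c > 0" using s by simp
  have gpos: "AE \<omega> in M. g (Z \<omega>) \<ge> 0" using gs s by (auto elim!: eventually_mono)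
  have law: "distr (density M (\<lambda>\<omega>. ennreal (g (Z \<omega>) / c))) borel Z = density lborel (\<lambda>x. ennreal (\<phi> x / c))"
    unfolding \<phi>_def
    by (rule stein_identity_weighted_law[OF Zm Z2 mean gm gint gpos]) (use c var sin cos c_def in auto)
  have [measurable]: "\<phi> \<in> borel_measurable borel" "w \<in> borel_measurable borel"
    unfolding \<phi>_def w_def using tail_mean_measurable[OF Zm Z2 mean] by measurable
  have [measurable]: "\<rho> \<in> borel_measurable borel" unfolding \<rho>_def by measurable
  have w: "0 \<le> w z" "w z \<le> 1 / s" "g z \<ge> s \<Longrightarrow> w z = 1 / g z" for z
    using s by (auto simp: w_def frac_le)
  have \<phi>0: "\<phi> x \<ge> 0" for x unfolding \<phi>_def by (rule tail_mean_nonneg[OF Zm Z2 mean])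
  have \<rho>0: "\<rho> x \<ge> 0" for x unfolding \<rho>_def using w \<phi>0 by simp
  have nn: "(\<integral>\<^sup>+\<omega>. ennreal (g (Z \<omega>) / c) * f (Z \<omega>) \<partial>M) = (\<integral>\<^sup>+x. ennreal (\<phi> x / c) * f x \<partial>lborel)"
    if [measurable]: "f \<in> borel_measurable borel" for f
  proof -
    have "(\<integral>\<^sup>+\<omega>. ennreal (g (Z \<omega>) / c) * f (Z \<omega>) \<partial>M) = integral\<^sup>N (distr (density M (\<lambda>\<omega>. ennreal (g (Z \<omega>) / c))) borel Z) f"
      by (simp add: nn_integral_distr nn_integral_density)
    also have "\<dots> = (\<integral>\<^sup>+x. ennreal (\<phi> x / c) * f x \<partial>lborel)"
      unfolding law by (simp add: nn_integral_density)
    finally show ?thesis .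
  qed
  have "distr M lborel Z = density lborel (\<lambda>x. ennreal (\<rho> x))"
  proof (rule measure_eqI)
    fix B assume "B \<in> sets (distr M lborel Z)"
    then have [measurable]: "B \<in> sets borel" by simp
    \<comment> \<open>The law of Z is recovered from the weighted law by inserting the factor
      \<open>g / c * (c * w)\<close>, which is 1 almost surely.\<close>
    have "emeasure (distr M lborel Z) B = (\<integral>\<^sup>+x. indicator B x \<partial>distr M lborel Z)" by simp
    also have "\<dots> = (\<integral>\<^sup>+\<omega>. indicator B (Z \<omega>) \<partial>M)" by (subst nn_integral_distr) auto
    also have "(\<integral>\<^sup>+\<omega>. indicator B (Z \<omega>) \<partial>M) = (\<integral>\<^sup>+\<omega>. ennreal (g (Z \<omega>) / c) * (ennreal (c * w (Z \<omega>)) * indicator B (Z \<omega>)) \<partial>M)"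
    proof (rule nn_integral_cong_AE)
      show "AE \<omega> in M. indicator B (Z \<omega>) = ennreal (g (Z \<omega>) / c) * (ennreal (c * w (Z \<omega>)) * indicator B (Z \<omega>))"
        using gs
      proof eventually_elim
        case (elim \<omega>)
        have "ennreal (g (Z \<omega>) / c) * ennreal (c * w (Z \<omega>)) = 1"
          using elim c s w(3)[OF elim] by (simp add: ennreal_mult[symmetric])
        then show ?case by (simp add: mult.assoc[symmetric])
      qed
    qed
    also have "\<dots> = (\<integral>\<^sup>+x. ennreal (\<phi> x / c) * (ennreal (c * w x) * indicator B x) \<partial>lborel)"
      by (rule nn) measurable
    also have "\<dots> = (\<integral>\<^sup>+x. ennreal (\<rho> x) * indicator B x \<partial>lborel)"
      using c w \<phi>0 by (intro nn_integral_cong) (simp add: \<rho>_def mult.assoc[symmetric] ennreal_mult[symmetric])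
    also have "\<dots> = emeasure (density lborel (\<lambda>x. ennreal (\<rho> x))) B"
      by (simp add: emeasure_density)
    finally show "emeasure (distr M lborel Z) B = emeasure (density lborel (\<lambda>x. ennreal (\<rho> x))) B" .
  qed simp
  then have dist: "distributed M lborel Z (\<lambda>z. ennreal (\<rho> z))"
    by (simp add: distributed_def)
  have \<phi>_exp: "\<phi> x = \<phi> 0 * exp (- (LBINT y=0..ereal x. y * w y))" for x
  proof (rule linear_volterra_unique[where k = "1 / s" and B = "LINT \<omega>|M. \<bar>Z \<omega>\<bar>"])
    show "\<bar>y * w y\<bar> \<le> 1 / s * \<bar>y\<bar>" for y
      using mult_left_mono[OF w(2)[of y], of "\<bar>y\<bar>"] w(1)[of y] by (simp add: abs_mult)
    show "\<bar>\<phi> y\<bar> \<le> (LINT \<omega>|M. \<bar>Z \<omega>\<bar>)" for y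
      using tail_mean_le[OF Zm Z2 mean, of y] \<phi>0[of y] by (simp add: \<phi>_def)
    \<comment> \<open>The integrated form of \<phi>' = -y \<rho>: a difference of tails is
      E[Z; u < Z \<le> v], which is evaluated with the density just found.\<close>
    show "\<phi> v - \<phi> u = - (LBINT y:{u<..v}. y * w y * \<phi> y)" if "u < v" for u v
    proof -
      note iZ = integrable_tail[OF Zm Z2 mean]
      have "\<phi> u - \<phi> v = (LINT \<omega>|M. Z \<omega> * indicator {u<..} (Z \<omega>) - Z \<omega> * indicator {v<..} (Z \<omega>))"
        unfolding \<phi>_def tail_mean_def by (rule Bochner_Integration.integral_diff[symmetric]; rule iZ; simp)
      also have "\<dots> = (LINT \<omega>|M. Z \<omega> * indicator {u<..v} (Z \<omega>))"
        using that by (intro Bochner_Integration.integral_cong) (auto simp: indicator_def)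
      also have "\<dots> = (LINT y|lborel. \<rho> y * (y * indicator {u<..v} y))"
        using \<rho>0 by (intro distributed_integral[OF dist, symmetric]) auto
      also have "\<dots> = (LBINT y:{u<..v}. y * w y * \<phi> y)"
        unfolding set_lebesgue_integral_def
        by (intro Bochner_Integration.integral_cong) (auto simp: \<rho>_def)
      finally show ?thesis by simp
    qed
  qed (use s in auto)
  have \<phi>00: "\<phi> 0 = (LINT \<omega>|M. \<bar>Z \<omega>\<bar>) / 2" unfolding \<phi>_def by (rule tail_mean_0[OF Zm Z2 mean])
  \<comment> \<open>Otherwise Z = 0 almost surely, against the positive variance c.\<close>
  have "\<phi> 0 \<noteq> 0"
  proof
    assume "\<phi> 0 = 0"
    then have "(LINT \<omega>|M. \<bar>Z \<omega>\<bar>) = 0" using \<phi>00 by simp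
    then have "AE \<omega> in M. \<bar>Z \<omega>\<bar> = 0"
      using integral_nonneg_eq_0_iff_AE[of M "\<lambda>\<omega>. \<bar>Z \<omega>\<bar>"] integrable_if_square[OF Zm Z2 mean] by simp
    then have "(LINT \<omega>|M. (Z \<omega>)\<^sup>2) = (LINT \<omega>|M. 0)"
      by (intro integral_cong_AE) auto
    then show False using c var c_def by simp
  qed
  then have "\<phi> 0 > 0" using \<phi>0[of 0] by simp
  \<comment> \<open>Positivity everywhere makes Lebesgue measure absolutely continuous with respect
    to the weighted law, so the almost sure bound on \<open>g (Z \<omega>)\<close> becomes a
    Lebesgue almost everywhere bound on g.\<close>
  then have \<phi>pos: "\<phi> x > 0" for x using \<phi>_exp[of x] by simp
  have "(\<integral>\<^sup>+x. ennreal (\<phi> x / c) * indicator {z. \<not> g z \<ge> s} x \<partial>lborel) = 0"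
  proof -
    have "(\<integral>\<^sup>+\<omega>. ennreal (g (Z \<omega>) / c) * indicator {z. \<not> g z \<ge> s} (Z \<omega>) \<partial>M) = (\<integral>\<^sup>+\<omega>. 0 \<partial>M)"
      using gs by (intro nn_integral_cong_AE) (auto elim!: eventually_mono simp: indicator_def)
    then show ?thesis by (subst nn[symmetric]) auto
  qed
  then have "AE x in lborel. ennreal (\<phi> x / c) * indicator {z. \<not> g z \<ge> s} x = 0"
    by (subst (asm) nn_integral_0_iff_AE) auto
  then have gAE: "AE x in lborel. g x \<ge> s"
  proof eventually_elim
    case (elim x)
    have "ennreal (\<phi> x / c) \<noteq> 0" using \<phi>pos[of x] c by simp
    with elim show ?case by (auto simp: indicator_def split: if_splits)
  qed
  have "AE z in lborel. \<rho> z = (LINT \<omega>|M. \<bar>Z \<omega>\<bar>) / (2 * g z) * exp (- (LBINT x=0..ereal z. x / g x))"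
    using gAE
  proof eventually_elim
    case (elim z)
    have "(LBINT x=0..ereal z. x * w x) = (LBINT x=0..ereal z. x / g x)"
      using gAE by (intro interval_integral_cong_AE) (auto elim!: eventually_mono simp: w)
    then show ?case
      unfolding \<rho>_def \<phi>_exp[of z] \<phi>00 w(3)[OF elim] by simp
  qed
  moreover have "0 < \<rho> z \<or> (0 \<le> \<rho> z \<and> g z < s)" for z
    using \<rho>0[of z] \<phi>pos[of z] s by (auto simp: \<rho>_def w_def)
  ultimately show ?thesis using gAE dist by blast
qed

end

section \<open>Orthogonality to trigonometric functions\<close>

context prob_space
begin

text \<open>With c the common total mass, U / c and V / c are probability densities on M, and the
  laws of Y under them have equal characteristic functions. For c = 0 there is nothing to normalise,
  but then both weights vanish almost surely.\<close>

lemma trig_moments_eq_imp_eq: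
  fixes U V Y :: "'a \<Rightarrow> real"
  assumes UV: "integrable M U" "integrable M V" "\<And>\<omega>. U \<omega> \<ge> 0" "\<And>\<omega>. V \<omega> \<ge> 0"
    and Y [measurable]: "Y \<in> borel_measurable M"
    and cos: "\<And>t. (LINT \<omega>|M. U \<omega> * cos (t * Y \<omega>)) = (LINT \<omega>|M. V \<omega> * cos (t * Y \<omega>))"
    and sin: "\<And>t. (LINT \<omega>|M. U \<omega> * sin (t * Y \<omega>)) = (LINT \<omega>|M. V \<omega> * sin (t * Y \<omega>))"
    and B [measurable]: "B \<in> sets borel"
  shows "(LINT \<omega>|M. U \<omega> * indicator B (Y \<omega>)) = (LINT \<omega>|M. V \<omega> * indicator B (Y \<omega>))"
proof -
  define c where "c = (LINT \<omega>|M. U \<omega>)"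
  have cU: "c = (LINT \<omega>|M. U \<omega>)" and cV: "c = (LINT \<omega>|M. V \<omega>)" using cos[of 0] by (simp_all add: c_def)
  have "c \<ge> 0" unfolding c_def by (simp add: UV)
  show ?thesis
  proof (cases "c = 0")
    case True
    have 0: "(LINT \<omega>|M. W \<omega> * indicator B (Y \<omega>)) = 0"
      if W: "integrable M W" "\<And>\<omega>. W \<omega> \<ge> 0" "c = (LINT \<omega>|M. W \<omega>)" for W
    proof -
      have "AE \<omega> in M. W \<omega> = 0" using W True integral_nonneg_eq_0_iff_AE[OF W(1)] by simp
      then have "(LINT \<omega>|M. W \<omega> * indicator B (Y \<omega>)) = (LINT \<omega>|M. 0)"
        using W(1) by (intro integral_cong_AE) auto
      then show ?thesis by simp
    qed
    show ?thesis using 0[OF UV(1,3) cU] 0[OF UV(2,4) cV] by simp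
  next
    case False
    with \<open>c \<ge> 0\<close> have c: "c > 0" by simp
    define L where "L W = distr (density M (\<lambda>\<omega>. ennreal (W \<omega> / c))) borel Y" for W
    have rd: "real_distribution (L W)"
      and ch: "char (L W) t = Complex ((LINT \<omega>|M. W \<omega> * cos (t * Y \<omega>)) / c) ((LINT \<omega>|M. W \<omega> * sin (t * Y \<omega>)) / c)"
      and mB: "measure (L W) B = (LINT \<omega>|M. W \<omega> * indicator B (Y \<omega>)) / c"
      if W: "integrable M W" "\<And>\<omega>. W \<omega> \<ge> 0" "c = (LINT \<omega>|M. W \<omega>)" for W t
    proof -
      have [measurable]: "W \<in> borel_measurable M" using W(1) by auto
      interpret D: prob_space "density M (\<lambda>\<omega>. ennreal (W \<omega> / c))"
      proof
        show "emeasure (density M (\<lambda>\<omega>. ennreal (W \<omega> / c))) (space (density M (\<lambda>\<omega>. ennreal (W \<omega> / c)))) = 1"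
          using W c by (simp add: emeasure_density nn_integral_eq_integral cong: nn_integral_cong_simp)
      qed
      show "real_distribution (L W)" unfolding L_def by (rule D.real_distribution_distr) simp
      have i: "integrable M (\<lambda>\<omega>. complex_of_real (W \<omega> / c) * iexp (t * Y \<omega>))"
        by (rule Bochner_Integration.integrable_bound[OF integrable_divide[OF W(1), of c]])
          (auto simp: norm_mult norm_divide norm_exp_eq_Re)
      have "char (L W) t = (CLINT \<omega>|M. complex_of_real (W \<omega> / c) * iexp (t * Y \<omega>))"
        unfolding char_def L_def using W c
        by (simp add: integral_distr integral_density scaleR_conv_of_real)
      moreover have "Re (CLINT \<omega>|M. complex_of_real (W \<omega> / c) * iexp (t * Y \<omega>)) = (LINT \<omega>|M. W \<omega> * cos (t * Y \<omega>)) / c"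
        unfolding integral_Re[OF i, symmetric] by (simp add: Re_exp)
      moreover have "Im (CLINT \<omega>|M. complex_of_real (W \<omega> / c) * iexp (t * Y \<omega>)) = (LINT \<omega>|M. W \<omega> * sin (t * Y \<omega>)) / c"
        unfolding integral_Im[OF i, symmetric] by (simp add: Im_exp)
      ultimately show "char (L W) t = Complex ((LINT \<omega>|M. W \<omega> * cos (t * Y \<omega>)) / c) ((LINT \<omega>|M. W \<omega> * sin (t * Y \<omega>)) / c)"
        by (simp add: complex_eq_iff)
      have "measure (L W) B = (LINT x|L W. indicator B x)"
        by (simp add: L_def)
      also have "\<dots> = (LINT \<omega>|density M (\<lambda>\<omega>. ennreal (W \<omega> / c)). indicator B (Y \<omega>))"
        unfolding L_def by (intro integral_distr) auto
      also have "\<dots> = (LINT \<omega>|M. (W \<omega> / c) *\<^sub>R indicator B (Y \<omega>))"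
        using W(2) c by (intro integral_density) auto
      finally show "measure (L W) B = (LINT \<omega>|M. W \<omega> * indicator B (Y \<omega>)) / c"
        by simp
    qed
    have "char (L U) = char (L V)"
      using ch[OF UV(1,3) cU] ch[OF UV(2,4) cV] cos sin by (intro ext) simp
    then have "L U = L V"
      using rd[OF UV(1,3) cU] rd[OF UV(2,4) cV] by (intro Levy_uniqueness)
    then show ?thesis using mB[OF UV(1,3) cU] mB[OF UV(2,4) cV] c by simp
  qed
qed

text \<open>The signed version: the positive and the negative part of V have the same trigonometric
  moments.\<close>

lemma trig_moments_zero_imp_zero:
  fixes V Y :: "'a \<Rightarrow> real"
  assumes V: "integrable M V" and Y [measurable]: "Y \<in> borel_measurable M"
    and cos: "\<And>t. (LINT \<omega>|M. V \<omega> * cos (t * Y \<omega>)) = 0"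
    and sin: "\<And>t. (LINT \<omega>|M. V \<omega> * sin (t * Y \<omega>)) = 0"
    and B [measurable]: "B \<in> sets borel"
  shows "(LINT \<omega>|M. V \<omega> * indicator B (Y \<omega>)) = 0"
proof -
  define P N where "P \<omega> = max (V \<omega>) 0" and "N \<omega> = max (- V \<omega>) 0" for \<omega>
  have PN: "V \<omega> = P \<omega> - N \<omega>" for \<omega> by (simp add: P_def N_def max_def)
  have i: "integrable M P" "integrable M N" unfolding P_def N_def using V by auto
  have m: "integrable M (\<lambda>\<omega>. W \<omega> * f (Y \<omega>))"
    if "integrable M W" "\<And>x. \<bar>f x\<bar> \<le> 1" "f \<in> borel_measurable borel" for f :: "real \<Rightarrow> real" and W
  proof (rule Bochner_Integration.integrable_bound[OF that(1)])
    show "AE \<omega> in M. norm (W \<omega> * f (Y \<omega>)) \<le> norm (W \<omega>)"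
      using that(2) by (auto simp: abs_mult mult_left_le)
  qed (use that in measurable)
  have split: "(LINT \<omega>|M. V \<omega> * f (Y \<omega>)) = (LINT \<omega>|M. P \<omega> * f (Y \<omega>)) - (LINT \<omega>|M. N \<omega> * f (Y \<omega>))"
    if "\<And>x. \<bar>f x\<bar> \<le> 1" "f \<in> borel_measurable borel" for f
    unfolding PN left_diff_distrib using m[OF i(1) that] m[OF i(2) that] by simp
  have "(LINT \<omega>|M. P \<omega> * indicator B (Y \<omega>)) = (LINT \<omega>|M. N \<omega> * indicator B (Y \<omega>))"
  proof (rule trig_moments_eq_imp_eq[OF i _ _ Y])
    show "(LINT \<omega>|M. P \<omega> * cos (t * Y \<omega>)) = (LINT \<omega>|M. N \<omega> * cos (t * Y \<omega>))" for t
      using split[of "\<lambda>y. cos (t * y)"] cos[of t] by simp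
    show "(LINT \<omega>|M. P \<omega> * sin (t * Y \<omega>)) = (LINT \<omega>|M. N \<omega> * sin (t * Y \<omega>))" for t
      using split[of "\<lambda>y. sin (t * y)"] sin[of t] by simp
  qed (auto simp: P_def N_def)
  then show ?thesis using split[of "indicator B"] by (simp add: indicator_def)
qed

end

section \<open>Isonormal processes\<close>

locale isonormal = prob_space M for M :: "'a measure" +
  fixes X :: "'h::{real_inner, banach, second_countable_topology} \<Rightarrow> 'a \<Rightarrow> real"
  assumes isonormal: "isonormal_process M X"
begin

lemma gaussian_X: "gaussian_rv M (X h)"
proof -
  have "gaussian_rv M (\<lambda>\<omega>. \<Sum>i<(1::nat). (\<lambda>_. 1) i * X ((\<lambda>_. h) i) \<omega>)"
    using isonormal[unfolded isonormal_process_def, THEN conjunct2, THEN conjunct1, rule_format,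
        of "\<lambda>_. 1" "\<lambda>_. h" 1] .
  then show ?thesis by simp
qed

lemma X_measurable [measurable]: "X h \<in> borel_measurable M"
  using gaussian_X[of h] by (simp add: gaussian_rv_def)

lemma X_mean: "(LINT \<omega>|M. X h \<omega>) = 0"
  using isonormal by (simp add: isonormal_process_def)

lemma X_cov: "(LINT \<omega>|M. X h \<omega> * X k \<omega>) = h \<bullet> k"
  using isonormal by (simp add: isonormal_process_def)

text \<open>Derived from the Gaussian law: for h = 0 the covariance identity alone proves nothing,
  since the integral of a nonintegrable function is 0 by convention.\<close>

lemma X_L2: "in_L2 M (X h)"
  unfolding in_L2_real_iff
proof (intro conjI X_measurable)
  consider \<mu> where "AE \<omega> in M. X h \<omega> = \<mu>"
    | \<mu> \<sigma> where "\<sigma> > 0" "distributed M lborel (X h) (\<lambda>x. ennreal (normal_density \<mu> \<sigma> x))"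
    using gaussian_X[of h] unfolding gaussian_rv_def by blast
  then show "integrable M (\<lambda>\<omega>. (X h \<omega>)\<^sup>2)"
  proof cases
    case 1
    have ae: "AE \<omega> in M. (X h \<omega>)\<^sup>2 = \<mu>\<^sup>2" using 1 by auto
    show ?thesis by (subst integrable_cong_AE[OF _ _ ae]) auto
  next
    case 2
    have "integrable lborel (\<lambda>x. normal_density \<mu> \<sigma> x * (x - \<mu>)\<^sup>2)"
      "integrable lborel (\<lambda>x. normal_density \<mu> \<sigma> x * x)" "integrable lborel (\<lambda>x. normal_density \<mu> \<sigma> x)"
      using 2 by (auto intro: integrable_normal_moment integrable_normal_moment_nz_1)
    then have "integrable lborel (\<lambda>x. normal_density \<mu> \<sigma> x * (x - \<mu>)\<^sup>2 + 2 * \<mu> * (normal_density \<mu> \<sigma> x * x) - \<mu>\<^sup>2 * normal_density \<mu> \<sigma> x)"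
      by auto
    also have "(\<lambda>x. normal_density \<mu> \<sigma> x * (x - \<mu>)\<^sup>2 + 2 * \<mu> * (normal_density \<mu> \<sigma> x * x) - \<mu>\<^sup>2 * normal_density \<mu> \<sigma> x) = (\<lambda>x. normal_density \<mu> \<sigma> x * x\<^sup>2)"
      by (auto simp: fun_eq_iff power2_eq_square algebra_simps)
    finally show ?thesis
      using distributed_integrable[OF 2(2), of "\<lambda>x. x\<^sup>2"] by simp
  qed
qed

text \<open>Linearity is not postulated; the covariance forces the mean square of the difference to
  be 0.\<close>

lemma X_linear: "AE \<omega> in M. X (a *\<^sub>R h + b *\<^sub>R k) \<omega> = a * X h \<omega> + b * X k \<omega>"
proof -
  define l where "l = a *\<^sub>R h + b *\<^sub>R k"
  have i: "integrable M (\<lambda>\<omega>. X h \<omega> * X k \<omega>)" for h k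
    by (intro integrable_L2_mult X_L2)
  have eq: "(X l \<omega> - (a * X h \<omega> + b * X k \<omega>))\<^sup>2 = X l \<omega> * X l \<omega> - 2 * a * (X l \<omega> * X h \<omega>) - 2 * b * (X l \<omega> * X k \<omega>)
     + a\<^sup>2 * (X h \<omega> * X h \<omega>) + 2 * a * b * (X h \<omega> * X k \<omega>) + b\<^sup>2 * (X k \<omega> * X k \<omega>)" for \<omega>
    by (simp add: power2_eq_square algebra_simps)
  have int: "integrable M (\<lambda>\<omega>. (X l \<omega> - (a * X h \<omega> + b * X k \<omega>))\<^sup>2)"
    unfolding eq by (intro Bochner_Integration.integrable_add Bochner_Integration.integrable_diff integrable_mult_right i)
  have "(LINT \<omega>|M. (X l \<omega> - (a * X h \<omega> + b * X k \<omega>))\<^sup>2) = 0"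
    unfolding eq using i by (simp add: X_cov)
      (simp add: l_def inner_add_left inner_add_right inner_commute power2_eq_square algebra_simps)
  then have "AE \<omega> in M. (X l \<omega> - (a * X h \<omega> + b * X k \<omega>))\<^sup>2 = 0"
    using integral_nonneg_eq_0_iff_AE[OF int] by simp
  then show ?thesis by (auto elim!: eventually_mono simp: l_def)
qed

lemma X_scaleR: "AE \<omega> in M. X (a *\<^sub>R h) \<omega> = a * X h \<omega>"
  using X_linear[of a h 0 h] by simp

lemma X_zero: "AE \<omega> in M. X 0 \<omega> = 0"
  using X_linear[of 0 0 0 0] by simp

text \<open>One indicator is added at a time: by the product-to-sum formulas, \<open>cos (X k) * cos (t * X h)\<close> is a
  combination of trigonometric functions of \<open>X (k + t h)\<close> and \<open>X (k - t h)\<close>, which reduces the step to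
  uniqueness for one-dimensional characteristic functions.\<close>

lemma trig_orthogonal_cylinders:
  fixes V :: "'a \<Rightarrow> real"
  assumes K: "subspace K" and V: "integrable M V"
    and cos: "\<And>k. k \<in> K \<Longrightarrow> (LINT \<omega>|M. V \<omega> * cos (X k \<omega>)) = 0"
    and sin: "\<And>k. k \<in> K \<Longrightarrow> (LINT \<omega>|M. V \<omega> * sin (X k \<omega>)) = 0"
    and xs: "\<And>h B. (h, B) \<in> set xs \<Longrightarrow> h \<in> K \<and> B \<in> sets borel"
    and k: "k \<in> K"
  shows "(LINT \<omega>|M. V \<omega> * (\<Prod>(h, B)\<leftarrow>xs. indicator B (X h \<omega>)) * cos (X k \<omega>)) = 0 \<and>
    (LINT \<omega>|M. V \<omega> * (\<Prod>(h, B)\<leftarrow>xs. indicator B (X h \<omega>)) * sin (X k \<omega>)) = 0"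
  using xs k
proof (induction xs arbitrary: k)
  case Nil
  then show ?case using cos sin by simp
next
  case (Cons x xs)
  obtain h B where x: "x = (h, B)" by (cases x)
  have h: "h \<in> K" and [measurable]: "B \<in> sets borel" using Cons.prems(1)[of h B] by (auto simp: x)
  have xs: "\<And>h B. (h, B) \<in> set xs \<Longrightarrow> h \<in> K \<and> B \<in> sets borel" using Cons.prems(1) by auto
  \<comment> \<open>The weight carrying the indicators treated so far; the induction hypothesis says
    that it is orthogonal to all trigonometric variables from K.\<close>
  define W where "W \<omega> = V \<omega> * (\<Prod>(h, B)\<leftarrow>xs. indicator B (X h \<omega>))" for \<omega>
  have Wint: "integrable M W"
    unfolding W_def using xs
  proof (induction xs)
    case Nil
    then show ?case using V by simp
  next
    case (Cons y ys)
    obtain h' B' where y: "y = (h', B')" by (cases y)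
    have [measurable]: "B' \<in> sets borel" using Cons.prems[of h' B'] by (simp add: y)
    have i: "integrable M (\<lambda>\<omega>. V \<omega> * (\<Prod>(h, B)\<leftarrow>ys. indicator B (X h \<omega>)))"
      using Cons.prems by (intro Cons.IH) auto
    note [measurable] = borel_measurable_integrable[OF i]
    have "integrable M (\<lambda>\<omega>. (V \<omega> * (\<Prod>(h, B)\<leftarrow>ys. indicator B (X h \<omega>))) * indicator B' (X h' \<omega>))"
    proof (rule Bochner_Integration.integrable_bound[OF i])
      show "AE \<omega> in M. norm ((V \<omega> * (\<Prod>(h, B)\<leftarrow>ys. indicator B (X h \<omega>))) * indicator B' (X h' \<omega>))
        \<le> norm (V \<omega> * (\<Prod>(h, B)\<leftarrow>ys. indicator B (X h \<omega>)))"
        by (intro AE_I2) (simp add: indicator_def)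
    qed measurable
    then show ?case by (simp add: y mult_ac)
  qed
  have IH: "(LINT \<omega>|M. W \<omega> * cos (X k \<omega>)) = 0 \<and> (LINT \<omega>|M. W \<omega> * sin (X k \<omega>)) = 0" if "k \<in> K" for k
    unfolding W_def using Cons.IH xs that by blast
  have m: "integrable M (\<lambda>\<omega>. W \<omega> * f (X l \<omega>))"
    if "\<And>x. \<bar>f x\<bar> \<le> 1" "f \<in> borel_measurable borel" for f :: "real \<Rightarrow> real" and l
  proof (rule Bochner_Integration.integrable_bound[OF Wint])
    show "AE \<omega> in M. norm (W \<omega> * f (X l \<omega>)) \<le> norm (W \<omega>)"
      using that by (auto simp: abs_mult mult_left_le)
  qed (use that Wint in measurable)
  have mc: "integrable M (\<lambda>\<omega>. W \<omega> * cos (X l \<omega>))" and ms: "integrable M (\<lambda>\<omega>. W \<omega> * sin (X l \<omega>))" for l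
    by (rule m; simp)+
  define p q where "p t = k + t *\<^sub>R h" and "q t = k - t *\<^sub>R h" for t
  have pq: "p t \<in> K" "q t \<in> K" for t
    using K h Cons.prems(2) by (auto simp: p_def q_def subspace_add subspace_diff subspace_scale)
  have Xp: "AE \<omega> in M. X (p t) \<omega> = X k \<omega> + t * X h \<omega> \<and> X (q t) \<omega> = X k \<omega> - t * X h \<omega>" for t
    using X_linear[of 1 k t h] X_linear[of 1 k "- t" h] by eventually_elim (simp add: p_def q_def)
  note Wm [measurable] = borel_measurable_integrable[OF Wint]
  have cc: "(LINT \<omega>|M. (W \<omega> * cos (X k \<omega>)) * cos (t * X h \<omega>)) = 0" for t
  proof -
    have "AE \<omega> in M. (W \<omega> * cos (X k \<omega>)) * cos (t * X h \<omega>) = (W \<omega> * cos (X (p t) \<omega>) + W \<omega> * cos (X (q t) \<omega>)) / 2"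
      using Xp[of t] by eventually_elim (simp (no_asm_simp) add: cos_add cos_diff algebra_simps)
    then have "(LINT \<omega>|M. (W \<omega> * cos (X k \<omega>)) * cos (t * X h \<omega>)) = (LINT \<omega>|M. (W \<omega> * cos (X (p t) \<omega>) + W \<omega> * cos (X (q t) \<omega>)) / 2)"
      by (rule integral_cong_AE[rotated 2]) measurable
    then show ?thesis using IH[OF pq(1)[of t]] IH[OF pq(2)[of t]] mc by simp
  qed
  have cs: "(LINT \<omega>|M. (W \<omega> * cos (X k \<omega>)) * sin (t * X h \<omega>)) = 0" for t
  proof -
    have "AE \<omega> in M. (W \<omega> * cos (X k \<omega>)) * sin (t * X h \<omega>) = (W \<omega> * sin (X (p t) \<omega>) - W \<omega> * sin (X (q t) \<omega>)) / 2"
      using Xp[of t] by eventually_elim (simp (no_asm_simp) add: sin_add sin_diff algebra_simps)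
    then have "(LINT \<omega>|M. (W \<omega> * cos (X k \<omega>)) * sin (t * X h \<omega>)) = (LINT \<omega>|M. (W \<omega> * sin (X (p t) \<omega>) - W \<omega> * sin (X (q t) \<omega>)) / 2)"
      by (rule integral_cong_AE[rotated 2]) measurable
    then show ?thesis using IH[OF pq(1)[of t]] IH[OF pq(2)[of t]] ms by simp
  qed
  have sc: "(LINT \<omega>|M. (W \<omega> * sin (X k \<omega>)) * cos (t * X h \<omega>)) = 0" for t
  proof -
    have "AE \<omega> in M. (W \<omega> * sin (X k \<omega>)) * cos (t * X h \<omega>) = (W \<omega> * sin (X (p t) \<omega>) + W \<omega> * sin (X (q t) \<omega>)) / 2"
      using Xp[of t] by eventually_elim (simp (no_asm_simp) add: sin_add sin_diff algebra_simps)
    then have "(LINT \<omega>|M. (W \<omega> * sin (X k \<omega>)) * cos (t * X h \<omega>)) = (LINT \<omega>|M. (W \<omega> * sin (X (p t) \<omega>) + W \<omega> * sin (X (q t) \<omega>)) / 2)"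
      by (rule integral_cong_AE[rotated 2]) measurable
    then show ?thesis using IH[OF pq(1)[of t]] IH[OF pq(2)[of t]] ms by simp
  qed
  have ss: "(LINT \<omega>|M. (W \<omega> * sin (X k \<omega>)) * sin (t * X h \<omega>)) = 0" for t
  proof -
    have "AE \<omega> in M. (W \<omega> * sin (X k \<omega>)) * sin (t * X h \<omega>) = (W \<omega> * cos (X (q t) \<omega>) - W \<omega> * cos (X (p t) \<omega>)) / 2"
      using Xp[of t] by eventually_elim (simp (no_asm_simp) add: cos_add cos_diff algebra_simps)
    then have "(LINT \<omega>|M. (W \<omega> * sin (X k \<omega>)) * sin (t * X h \<omega>)) = (LINT \<omega>|M. (W \<omega> * cos (X (q t) \<omega>) - W \<omega> * cos (X (p t) \<omega>)) / 2)"
      by (rule integral_cong_AE[rotated 2]) measurable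
    then show ?thesis using IH[OF pq(1)[of t]] IH[OF pq(2)[of t]] mc by simp
  qed
  have "(LINT \<omega>|M. (W \<omega> * cos (X k \<omega>)) * indicator B (X h \<omega>)) = 0"
    by (rule trig_moments_zero_imp_zero[OF mc _ cc cs]) auto
  moreover have "(LINT \<omega>|M. (W \<omega> * sin (X k \<omega>)) * indicator B (X h \<omega>)) = 0"
    by (rule trig_moments_zero_imp_zero[OF ms _ sc ss]) auto
  ultimately show ?case by (simp add: x W_def mult_ac)
qed

text \<open>Finite cylinders form an intersection-stable generator, and the sets over which V
  integrates to 0 are closed under complements and disjoint unions. On a cylinder the trigonometric
  factor disappears for k = 0, where \<open>X 0\<close> is 0 almost surely and the cosine is
  1.\<close>

lemma trig_orthogonal_sigma:
  fixes V :: "'a \<Rightarrow> real"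
  assumes K: "subspace K" and V: "integrable M V"
    and cos: "\<And>k. k \<in> K \<Longrightarrow> (LINT \<omega>|M. V \<omega> * cos (X k \<omega>)) = 0"
    and sin: "\<And>k. k \<in> K \<Longrightarrow> (LINT \<omega>|M. V \<omega> * sin (X k \<omega>)) = 0"
    and A: "A \<in> sigma_sets (space M) {X k -` B \<inter> space M | k B. k \<in> K \<and> B \<in> sets borel}"
  shows "(LINT \<omega>:A|M. V \<omega>) = 0"
proof -
  define cyl where "cyl xs = {\<omega> \<in> space M. \<forall>(h, B)\<in>set xs. X h \<omega> \<in> B}" for xs :: "('h \<times> real set) list"
  define G where "G = {cyl xs | xs. \<forall>(h, B)\<in>set xs. h \<in> K \<and> B \<in> sets borel}"
  have "cyl xs \<in> sets M" if "\<forall>(h, B)\<in>set xs. h \<in> K \<and> B \<in> sets borel" for xs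
    using that
  proof (induction xs)
    case Nil
    then show ?case by (simp add: cyl_def)
  next
    case (Cons x xs)
    obtain h B where x: "x = (h, B)" by (cases x)
    have "cyl (x # xs) = (X h -` B \<inter> space M) \<inter> cyl xs" by (auto simp: cyl_def x)
    moreover have "X h -` B \<inter> space M \<in> sets M" using Cons.prems x by (intro measurable_sets[OF X_measurable]) auto
    ultimately show ?case using Cons by auto
  qed
  then have GM: "G \<subseteq> sets M" by (auto simp: G_def)
  have "{X k -` B \<inter> space M | k B. k \<in> K \<and> B \<in> sets borel} \<subseteq> G"
  proof safe
    fix k B assume "k \<in> K" "B \<in> sets (borel :: real measure)"
    moreover have "X k -` B \<inter> space M = cyl [(k, B)]" by (auto simp: cyl_def)
    ultimately show "X k -` B \<inter> space M \<in> G" unfolding G_def by (intro CollectI exI[of _ "[(k, B)]"]) auto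
  qed
  then have A': "A \<in> sigma_sets (space M) G" using A sigma_sets_mono' by blast
  have "Int_stable G"
  proof (rule Int_stableI)
    fix a b assume "a \<in> G" "b \<in> G"
    then obtain xs ys where "a = cyl xs" "b = cyl ys" "\<forall>(h, B)\<in>set xs. h \<in> K \<and> B \<in> sets borel"
      "\<forall>(h, B)\<in>set ys. h \<in> K \<and> B \<in> sets borel" by (auto simp: G_def)
    moreover have "cyl xs \<inter> cyl ys = cyl (xs @ ys)" by (auto simp: cyl_def)
    ultimately show "a \<inter> b \<in> G" unfolding G_def by (intro CollectI exI[of _ "xs @ ys"]) auto
  qed
  moreover have "G \<subseteq> Pow (space M)" using GM sets.space_closed by blast
  ultimately show ?thesis
    using A'
  proof (induction rule: sigma_sets_induct_disjoint)
    case (basic A)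
    then obtain xs where xs: "A = cyl xs" "\<forall>(h, B)\<in>set xs. h \<in> K \<and> B \<in> sets borel" by (auto simp: G_def)
    have "0 \<in> K" using K by (rule subspace_0)
    have ind: "(\<Prod>(h, B)\<leftarrow>xs. indicator B (X h \<omega>)) = (indicator A \<omega> :: real)" if "\<omega> \<in> space M" for \<omega>
      unfolding xs(1) using that by (induction xs) (auto simp: cyl_def indicator_def split: if_splits)
    have "(LINT \<omega>|M. V \<omega> * (\<Prod>(h, B)\<leftarrow>xs. indicator B (X h \<omega>)) * cos (X 0 \<omega>)) = 0"
      using trig_orthogonal_cylinders[OF K V cos sin _ \<open>0 \<in> K\<close>, of xs] xs(2) by auto
    also have "(LINT \<omega>|M. V \<omega> * (\<Prod>(h, B)\<leftarrow>xs. indicator B (X h \<omega>)) * cos (X 0 \<omega>)) = (LINT \<omega>|M. V \<omega> * indicator A \<omega> * cos (X 0 \<omega>))"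
      using ind by (intro Bochner_Integration.integral_cong) auto
    also have "\<dots> = (LINT \<omega>:A|M. V \<omega>)"
      unfolding set_lebesgue_integral_def
      using X_zero basic GM V by (intro integral_cong_AE) (auto elim!: eventually_mono)
    finally show ?case .
  next
    case empty
    then show ?case by (simp add: set_lebesgue_integral_def)
  next
    case (compl A)
    have AM: "A \<in> sets M" using compl(1) GM sets.sigma_sets_subset by blast
    have "(LINT \<omega>|M. V \<omega>) = 0"
    proof -
      have "(LINT \<omega>|M. V \<omega>) = (LINT \<omega>|M. V \<omega> * cos (X 0 \<omega>))"
        using X_zero V by (intro integral_cong_AE) (auto elim!: eventually_mono)
      then show ?thesis using cos[OF subspace_0[OF K]] by simp
    qed
    moreover have "(LINT \<omega>:(space M - A)|M. V \<omega>) = (LINT \<omega>|M. V \<omega> - indicator A \<omega> *\<^sub>R V \<omega>)"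
      unfolding set_lebesgue_integral_def by (intro Bochner_Integration.integral_cong) (auto simp: indicator_def)
    moreover have "integrable M (\<lambda>\<omega>. indicator A \<omega> *\<^sub>R V \<omega>)"
      using V AM by (rule integrable_mult_indicator[rotated])
    ultimately show ?case using compl(2) V by (simp add: set_lebesgue_integral_def)
  next
    case (union F)
    have "F i \<in> sets M" for i using union(2) GM sets.sigma_sets_subset by blast
    moreover have "set_integrable M (\<Union>i. F i) V"
      unfolding set_integrable_def using V calculation by (intro integrable_mult_indicator) auto
    ultimately have "(LINT \<omega>:(\<Union>i. F i)|M. V \<omega>) = (\<Sum>i. (LINT \<omega>:(F i)|M. V \<omega>))"
      using union(1) by (intro lebesgue_integral_countable_add) (auto simp: disjoint_family_on_def)
    then show ?case using union(3) by simp
  qed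
qed

end

section \<open>Gaussian moments, completeness of polynomials, independence\<close>

lemma poly_exp_bound:
  fixes p :: "real poly"
  shows "\<exists>C n. 0 \<le> C \<and> (\<forall>x. \<bar>poly p x\<bar> \<le> C * exp (real n * \<bar>x\<bar>))"
proof (induction p)
  case 0
  show ?case by (intro exI[of _ 0]) simp
next
  case (pCons a p)
  then obtain C n where C: "0 \<le> C" "\<And>x. \<bar>poly p x\<bar> \<le> C * exp (real n * \<bar>x\<bar>)" by blast
  \<comment> \<open>Each degree costs one unit in the exponent, through \<bar>x\<bar> \<le> exp
    \<bar>x\<bar>.\<close>
  have "\<bar>poly (pCons a p) x\<bar> \<le> (\<bar>a\<bar> + C) * exp (real (Suc n) * \<bar>x\<bar>)" for x
  proof -
    have "\<bar>poly (pCons a p) x\<bar> \<le> \<bar>a\<bar> + \<bar>x\<bar> * \<bar>poly p x\<bar>"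
      by (simp add: abs_mult[symmetric] abs_triangle_ineq)
    also have "\<dots> \<le> \<bar>a\<bar> * exp (real (Suc n) * \<bar>x\<bar>) + exp \<bar>x\<bar> * (C * exp (real n * \<bar>x\<bar>))"
    proof (intro add_mono mult_mono C)
      show "\<bar>a\<bar> \<le> \<bar>a\<bar> * exp (real (Suc n) * \<bar>x\<bar>)" using mult_left_mono[of 1 "exp (real (Suc n) * \<bar>x\<bar>)" "\<bar>a\<bar>"] by simp
      show "\<bar>x\<bar> \<le> exp \<bar>x\<bar>" using exp_ge_add_one_self[of "\<bar>x\<bar>"] by linarith
    qed auto
    also have "exp \<bar>x\<bar> * (C * exp (real n * \<bar>x\<bar>)) = C * exp (real (Suc n) * \<bar>x\<bar>)"
      by (simp add: exp_add[symmetric] algebra_simps)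
    finally show ?thesis by (simp add: algebra_simps)
  qed
  then show ?case using C(1) by (intro exI[of _ "\<bar>a\<bar> + C"] exI[of _ "Suc n"]) auto
qed

lemma poly_measurable [measurable (raw)]:
  "f \<in> borel_measurable M \<Longrightarrow> (\<lambda>\<omega>. poly p (f \<omega>) :: real) \<in> borel_measurable M"
  by (rule measurable_compose[OF _ borel_measurable_continuous_onI]) (auto intro: continuous_on_poly continuous_on_id)

text \<open>Completing the square: exponential tilting shifts the mean to a.\<close>

lemma std_normal_density_exp: "exp (a * x) * std_normal_density x = exp (a\<^sup>2 / 2) * normal_density a 1 x"
proof -
  have "a * x - x\<^sup>2 / 2 = a\<^sup>2 / 2 - (x - a)\<^sup>2 / 2" by (simp add: power2_eq_square field_simps)
  then have "exp (a * x) * exp (- x\<^sup>2 / 2) = exp (a\<^sup>2 / 2) * exp (- (x - a)\<^sup>2 / 2)"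
    by (simp add: exp_add[symmetric])
  then show ?thesis by (simp add: normal_density_def)
qed

lemma integrable_std_normal_exp_abs:
  "integrable lborel (\<lambda>x. std_normal_density x * exp (a * \<bar>x\<bar>))"
proof -
  have i: "integrable lborel (\<lambda>x. std_normal_density x * exp (b * x))" for b
  proof -
    have "std_normal_density x * exp (b * x) = exp (b\<^sup>2 / 2) * normal_density b 1 x" for x
      using std_normal_density_exp[of b x] by (simp add: mult.commute)
    then show ?thesis by simp
  qed
  show ?thesis
  proof (rule Bochner_Integration.integrable_bound[OF Bochner_Integration.integrable_add[OF i[of a] i[of "-a"]]])
    have "exp (a * \<bar>x\<bar>) \<le> exp (a * x) + exp (- a * x)" for x :: real
      by (cases "x \<ge> 0") auto
    then have "norm (std_normal_density x * exp (a * \<bar>x\<bar>)) \<le> std_normal_density x * (exp (a * x) + exp (- a * x))" for x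
      by (simp add: mult_left_mono)
    then show "AE x in lborel. norm (std_normal_density x * exp (a * \<bar>x\<bar>))
        \<le> norm (std_normal_density x * exp (a * x) + std_normal_density x * exp (- a * x))"
      by (intro AE_I2 order_trans[OF _ abs_ge_self[THEN order_trans[OF _ eq_refl[OF real_norm_def[symmetric]]]]])
        (simp add: distrib_left)
  qed measurable
qed

context isonormal
begin

text \<open>Variance 1 excludes the degenerate alternative in \<open>gaussian_rv\<close>; mean and
  variance then fix \<mu> and \<sigma>.\<close>

lemma X_unit_distributed:
  assumes "norm u = 1"
  shows "distributed M lborel (X u) std_normal_density"
proof -
  have var: "(LINT \<omega>|M. X u \<omega> * X u \<omega>) = 1" unfolding X_cov using assms by (simp add: norm_eq_1)
  consider \<mu> where "AE \<omega> in M. X u \<omega> = \<mu>"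
    | \<mu> \<sigma> where "\<sigma> > 0" "distributed M lborel (X u) (\<lambda>x. ennreal (normal_density \<mu> \<sigma> x))"
    using gaussian_X[of u] unfolding gaussian_rv_def by blast
  then show ?thesis
  proof cases
    case 1
    have "(LINT \<omega>|M. X u \<omega>) = (LINT \<omega>|M. \<mu>)" using 1 by (intro integral_cong_AE) auto
    then have "\<mu> = 0" using X_mean[of u] by (simp add: prob_space)
    then have "(LINT \<omega>|M. X u \<omega> * X u \<omega>) = (LINT \<omega>|M. 0)" using 1 by (intro integral_cong_AE) auto
    then show ?thesis using var by simp
  next
    case 2
    have "\<mu> = 0" using normal_distributed_expectation[OF 2] X_mean by simp
    moreover have "\<sigma>\<^sup>2 = 1"
      using normal_distributed_variance[OF 2] var by (simp add: X_mean power2_eq_square)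
    ultimately show ?thesis using 2 by (simp add: power2_eq_1_iff)
  qed
qed

lemma X_unit_law: "norm u = 1 \<Longrightarrow> distr M borel (X u) = std_normal_distribution"
  using distributed_distr_eq_density[OF X_unit_distributed] distr_cong[of M M borel lborel "X u" "X u"]
  by (simp add: sets_lborel)

text \<open>Facts about the standard normal law apply to unit vectors only; the vector 0 cannot be
  normalised and gives the constant 0.\<close>

lemma X_normalize:
  obtains u where "norm u = 1" "AE \<omega> in M. X h \<omega> = norm h * X u \<omega>"
    | "h = 0" "AE \<omega> in M. X h \<omega> = 0"
proof (cases "h = 0")
  case True
  then show ?thesis using that(2) X_zero by simp
next
  case False
  define u where "u = h /\<^sub>R norm h"
  have "norm u = 1" "h = norm h *\<^sub>R u" using False by (simp_all add: u_def)
  then show ?thesis using that(1)[of u] X_scaleR[of "norm h" u] by simp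
qed

lemma X_char: "(LINT \<omega>|M. cos (X h \<omega>)) = exp (- (norm h)\<^sup>2 / 2)" "(LINT \<omega>|M. sin (X h \<omega>)) = 0"
proof -
  have "(LINT \<omega>|M. cos (X h \<omega>)) = exp (- (norm h)\<^sup>2 / 2) \<and> (LINT \<omega>|M. sin (X h \<omega>)) = 0"
  proof (cases rule: X_normalize[of h])
    case (1 u)
    have i: "integrable M (\<lambda>\<omega>. iexp (norm h * X u \<omega>))" by (rule integrable_iexp) auto
    have ch: "(CLINT \<omega>|M. iexp (norm h * X u \<omega>)) = complex_of_real (exp (- (norm h)\<^sup>2 / 2))"
      using fun_cong[OF char_std_normal_distribution, of "norm h"]
      unfolding X_unit_law[OF 1(1), symmetric] char_def by (simp add: integral_distr)
    have "(LINT \<omega>|M. cos (X h \<omega>)) = (LINT \<omega>|M. cos (norm h * X u \<omega>))"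
      using 1(2) by (intro integral_cong_AE) (auto elim!: eventually_mono)
    moreover have "(LINT \<omega>|M. sin (X h \<omega>)) = (LINT \<omega>|M. sin (norm h * X u \<omega>))"
      using 1(2) by (intro integral_cong_AE) (auto elim!: eventually_mono)
    moreover have "(LINT \<omega>|M. cos (norm h * X u \<omega>)) = Re (CLINT \<omega>|M. iexp (norm h * X u \<omega>))"
      unfolding integral_Re[OF i, symmetric] by (simp add: Re_exp)
    moreover have "(LINT \<omega>|M. sin (norm h * X u \<omega>)) = Im (CLINT \<omega>|M. iexp (norm h * X u \<omega>))"
      unfolding integral_Im[OF i, symmetric] by (simp add: Im_exp)
    ultimately show ?thesis unfolding ch by simp
  next
    case 2
    have "(LINT \<omega>|M. cos (X h \<omega>)) = (LINT \<omega>|M. 1)"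
      by (rule integral_cong_AE) (use 2(2) in \<open>auto elim!: eventually_mono\<close>)
    moreover have "(LINT \<omega>|M. sin (X h \<omega>)) = (LINT \<omega>|M. 0)"
      by (rule integral_cong_AE) (use 2(2) in \<open>auto elim!: eventually_mono\<close>)
    ultimately show ?thesis using 2 by (simp add: prob_space)
  qed
  then show "(LINT \<omega>|M. cos (X h \<omega>)) = exp (- (norm h)\<^sup>2 / 2)" "(LINT \<omega>|M. sin (X h \<omega>)) = 0" by auto
qed

text \<open>These exponential moments dominate all polynomials in X h as well as the partial sums of
  the cosine and sine series.\<close>

lemma integrable_exp_abs_X: "integrable M (\<lambda>\<omega>. exp (a * \<bar>X h \<omega>\<bar>))"
proof (cases rule: X_normalize[of h])
  case (1 u)
  have i: "integrable M (\<lambda>\<omega>. exp (a * norm h * \<bar>X u \<omega>\<bar>))"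
    using distributed_integrable[OF X_unit_distributed[OF 1(1)], of "\<lambda>x. exp (a * norm h * \<bar>x\<bar>)"]
      integrable_std_normal_exp_abs[of "a * norm h"] by simp
  have e: "AE \<omega> in M. exp (a * norm h * \<bar>X u \<omega>\<bar>) = exp (a * \<bar>X h \<omega>\<bar>)"
    using 1(2) by eventually_elim (simp add: abs_mult mult.assoc)
  show ?thesis by (rule integrable_cong_AE_imp[OF i _ e]) measurable
next
  case 2
  have "integrable M (\<lambda>\<omega>. 1)" by simp
  then show ?thesis
    by (rule integrable_cong_AE_imp) (use 2(2) in \<open>auto elim!: eventually_mono\<close>)
qed

lemma exp_abs_X_L2: "in_L2 M (\<lambda>\<omega>. exp (a * \<bar>X h \<omega>\<bar>))"
  using integrable_exp_abs_X[of "2 * a" h] by (simp add: in_L2_real_iff exp_double[symmetric] mult.assoc)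

lemma poly_X_L2: "in_L2 M (\<lambda>\<omega>. poly p (X h \<omega>))"
proof -
  obtain C n where C: "0 \<le> C" "\<And>x. \<bar>poly p x\<bar> \<le> C * exp (real n * \<bar>x\<bar>)"
    using poly_exp_bound[of p] by blast
  show ?thesis
    by (rule in_L2_bound[OF in_L2_cmult[OF exp_abs_X_L2[of "real n" h], of C]])
      (use C in \<open>auto intro!: AE_I2 order_trans[OF C(2) abs_ge_self] simp: abs_mult\<close>)
qed

lemma poly_X_mult_L2: "in_L2 M (\<lambda>\<omega>. poly p (X h \<omega>) * poly q (X k \<omega>))"
proof (rule in_L2_bound[OF in_L2_add[OF poly_X_L2[of "p * p" h] poly_X_L2[of "q * q" k]]])
  show "AE \<omega> in M. norm (poly p (X h \<omega>) * poly q (X k \<omega>)) \<le> norm (poly (p * p) (X h \<omega>) + poly (q * q) (X k \<omega>))"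
  proof (rule AE_I2)
    fix \<omega>
    show "norm (poly p (X h \<omega>) * poly q (X k \<omega>)) \<le> norm (poly (p * p) (X h \<omega>) + poly (q * q) (X k \<omega>))"
      using norm_mult_le_sum_power2[of "poly p (X h \<omega>)" "poly q (X k \<omega>)"]
      by (simp add: power2_eq_square abs_mult)
  qed
qed measurable

text \<open>The power series of cos and sin may be integrated termwise against W, because their
  partial sums are dominated by \<open>exp \<bar>X h\<bar>\<close>, which is square integrable. So W
  is orthogonal to all trigonometric variables, and hence integrates to 0 over every set of the
  generated \<sigma>-field.\<close>

lemma AE_zero_if_orthogonal_powers:
  assumes sets: "sets M = sets_generated_by M X" and W: "in_L2 M W"
    and orth: "\<And>h m. (LINT \<omega>|M. W \<omega> * X h \<omega> ^ m) = 0"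
  shows "AE \<omega> in M. W \<omega> = (0::real)"
proof -
  have [measurable]: "W \<in> borel_measurable M" and Wi: "integrable M W" using W by (auto intro: integrable_L2)
  have powL2: "in_L2 M (\<lambda>\<omega>. X h \<omega> ^ m)" for h m
    using poly_X_L2[of "monom 1 m" h] by (simp add: poly_monom)
  have dom: "integrable M (\<lambda>\<omega>. \<bar>W \<omega>\<bar> * exp (1 * \<bar>X h \<omega>\<bar>))" for h
  proof -
    have "in_L2 M (\<lambda>\<omega>. \<bar>W \<omega>\<bar>)" by (rule in_L2_bound[OF W]) auto
    then show ?thesis by (intro integrable_L2_mult exp_abs_X_L2)
  qed
  have series: "(LINT \<omega>|M. W \<omega> * f (X h \<omega>)) = 0"
    if f: "\<And>x. (\<lambda>n. c n * x ^ n) sums f x" and c: "\<And>n. \<bar>c n\<bar> \<le> 1 / fact n" and [measurable]: "f \<in> borel_measurable borel"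
    for f :: "real \<Rightarrow> real" and c h
  proof -
    have "(\<lambda>N. LINT \<omega>|M. W \<omega> * (\<Sum>n<N. c n * X h \<omega> ^ n)) \<longlonglongrightarrow> (LINT \<omega>|M. W \<omega> * f (X h \<omega>))"
    proof (rule integral_dominated_convergence[OF _ _ dom[of h]])
      show "AE \<omega> in M. (\<lambda>N. W \<omega> * (\<Sum>n<N. c n * X h \<omega> ^ n)) \<longlonglongrightarrow> W \<omega> * f (X h \<omega>)"
        using f by (auto simp: sums_def intro!: tendsto_intros)
      show "AE \<omega> in M. norm (W \<omega> * (\<Sum>n<N. c n * X h \<omega> ^ n)) \<le> \<bar>W \<omega>\<bar> * exp (1 * \<bar>X h \<omega>\<bar>)" for N
      proof (rule AE_I2)
        fix \<omega>
        have "\<bar>\<Sum>n<N. c n * X h \<omega> ^ n\<bar> \<le> (\<Sum>n<N. \<bar>X h \<omega>\<bar> ^ n / fact n)"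
        proof (rule sum_abs[THEN order_trans], rule sum_mono)
          show "\<bar>c n * X h \<omega> ^ n\<bar> \<le> \<bar>X h \<omega>\<bar> ^ n / fact n" for n
            using mult_right_mono[OF c[of n], of "\<bar>X h \<omega>\<bar> ^ n"] by (simp add: abs_mult power_abs)
        qed
        also have "\<dots> \<le> exp \<bar>X h \<omega>\<bar>"
          using sum_le_suminf[OF summable_exp[of "\<bar>X h \<omega>\<bar>"], of "{..<N}"] 
          by (simp add: exp_def divide_inverse mult.commute scaleR_conv_of_real)
        finally show "norm (W \<omega> * (\<Sum>n<N. c n * X h \<omega> ^ n)) \<le> \<bar>W \<omega>\<bar> * exp (1 * \<bar>X h \<omega>\<bar>)"
          by (simp add: abs_mult mult_left_mono)
      qed
    qed measurable
    moreover have "(LINT \<omega>|M. W \<omega> * (\<Sum>n<N. c n * X h \<omega> ^ n)) = 0" for N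
    proof -
      have "(LINT \<omega>|M. W \<omega> * (\<Sum>n<N. c n * X h \<omega> ^ n)) = (LINT \<omega>|M. (\<Sum>n<N. c n * (W \<omega> * X h \<omega> ^ n)))"
        by (simp add: sum_distrib_left mult_ac)
      also have "\<dots> = (\<Sum>n<N. c n * (LINT \<omega>|M. W \<omega> * X h \<omega> ^ n))"
        using integrable_L2_mult[OF W powL2] by (subst Bochner_Integration.integral_sum) auto
      finally show ?thesis by (simp add: orth)
    qed
    ultimately show ?thesis by (simp add: LIMSEQ_const_iff)
  qed
  have cos: "(LINT \<omega>|M. W \<omega> * cos (X h \<omega>)) = 0" for h
    by (rule series[of cos_coeff]) (use cos_converges[where 'a = real] in \<open>simp_all, simp add: cos_coeff_def\<close>)
  have sin: "(LINT \<omega>|M. W \<omega> * sin (X h \<omega>)) = 0" for h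
    by (rule series[of sin_coeff]) (use sin_converges[where 'a = real] in \<open>simp_all, simp add: sin_coeff_def\<close>)
  have zero: "(LINT \<omega>:A|M. W \<omega>) = 0" if "A \<in> sets M" for A
  proof -
    have "A \<in> sigma_sets (space M) {X h -` B \<inter> space M | h B. h \<in> UNIV \<and> B \<in> sets borel}"
      using that unfolding sets sets_generated_by_def by simp
    then show ?thesis by (rule trig_orthogonal_sigma[OF subspace_UNIV Wi cos sin])
  qed
  \<comment> \<open>On a set where W has constant sign a vanishing integral forces W to vanish; this
    is applied to the sets W > 0 and W < 0.\<close>
  have "AE \<omega> in M. indicator {\<omega> \<in> space M. P (W \<omega>)} \<omega> * W \<omega> = 0"
    if [measurable]: "Measurable.pred borel P" and sgn: "(\<forall>x. P x \<longrightarrow> 0 \<le> x) \<or> (\<forall>x. P x \<longrightarrow> x \<le> 0)" for P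
  proof -
    define A where "A = {\<omega> \<in> space M. P (W \<omega>)}"
    have A: "A \<in> sets M" unfolding A_def by measurable
    have i: "integrable M (\<lambda>\<omega>. indicator A \<omega> * W \<omega>)"
      using integrable_mult_indicator[OF A Wi] by simp
    have z: "(LINT \<omega>|M. indicator A \<omega> * W \<omega>) = 0" using zero[OF A] by (simp add: set_lebesgue_integral_def)
    from sgn show ?thesis
    proof
      assume "\<forall>x. P x \<longrightarrow> 0 \<le> x"
      then show ?thesis
        using integral_nonneg_eq_0_iff_AE[OF i] z by (auto simp: A_def indicator_def)
    next
      assume "\<forall>x. P x \<longrightarrow> x \<le> 0"
      then have "AE \<omega> in M. - (indicator A \<omega> * W \<omega>) = 0"
        using integral_nonneg_eq_0_iff_AE[of M "\<lambda>\<omega>. - (indicator A \<omega> * W \<omega>)"] i z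
        by (auto simp: A_def indicator_def)
      then show ?thesis by (auto simp: A_def)
    qed
  qed
  from this[of "\<lambda>x. x > 0"] this[of "\<lambda>x. x < 0"] show ?thesis
    by (auto simp: indicator_def elim!: eventually_elim2 split: if_splits)
qed

text \<open>By Pythagoras the squared norm of v + t h is that of v plus t^2 when v is orthogonal to
  h, so characteristic functions factor. Thus cos (t X h) - exp (-t^2 / 2) and sin (t X h) are
  orthogonal to the trigonometric functions of every such X v, and so integrate to 0 over each event
  these variables generate. One-dimensional uniqueness then gives independence of X h from every
  such event. A whole sequence \<open>k\<close> is allowed so that all arguments of a cylindrical
  variable are covered at once.\<close>

lemma X_indep_orthogonal:
  assumes h: "norm h = 1" and k: "\<And>i::nat. h \<bullet> k i = 0"
  shows "distr M borel (X h) \<Otimes>\<^sub>M distr M borel (\<lambda>\<omega> i. X (k i) \<omega>)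
    = distr M (borel \<Otimes>\<^sub>M borel) (\<lambda>\<omega>. (X h \<omega>, \<lambda>i. X (k i) \<omega>))"
proof -
  define Y where "Y \<omega> i = X (k i) \<omega>" for \<omega> i
  have Ym [measurable]: "Y \<in> borel_measurable M"
    unfolding Y_def by (rule measurable_coordinatewise_then_product) measurable
  define K where "K = {v. h \<bullet> v = 0}"
  define gen where "gen = {X v -` B \<inter> space M | v B. v \<in> K \<and> B \<in> sets (borel :: real measure)}"
  have K: "subspace K" unfolding K_def subspace_def by (auto simp: inner_add_right)
  have genM: "gen \<subseteq> sets M" unfolding gen_def by (auto intro: measurable_sets[OF X_measurable])
  have norm_pm: "(norm (v + t *\<^sub>R h))\<^sup>2 = (norm v)\<^sup>2 + t\<^sup>2" "(norm (v - t *\<^sub>R h))\<^sup>2 = (norm v)\<^sup>2 + t\<^sup>2" if "v \<in> K" for v t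
    using that h unfolding K_def power2_norm_eq_inner
    by (simp_all add: inner_add_left inner_add_right inner_diff_left inner_diff_right inner_commute norm_eq_1 power2_eq_square)
  have ic: "integrable M (\<lambda>\<omega>. cos (X v \<omega>))" and isn: "integrable M (\<lambda>\<omega>. sin (X v \<omega>))" for v
    by (auto intro!: integrable_const_bound[where B = 1])
  have Xp: "AE \<omega> in M. X (v + t *\<^sub>R h) \<omega> = X v \<omega> + t * X h \<omega> \<and> X (v - t *\<^sub>R h) \<omega> = X v \<omega> - t * X h \<omega>" for v t
    using X_linear[of 1 v t h] X_linear[of 1 v "- t" h] by eventually_elim simp
  have prod: "(LINT \<omega>|M. cos (t * X h \<omega>) * cos (X v \<omega>)) = exp (- t\<^sup>2 / 2) * (LINT \<omega>|M. cos (X v \<omega>))"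
      "(LINT \<omega>|M. cos (t * X h \<omega>) * sin (X v \<omega>)) = 0"
      "(LINT \<omega>|M. sin (t * X h \<omega>) * cos (X v \<omega>)) = 0"
      "(LINT \<omega>|M. sin (t * X h \<omega>) * sin (X v \<omega>)) = 0" if v: "v \<in> K" for v t
  proof -
    have 1: "AE \<omega> in M. cos (t * X h \<omega>) * cos (X v \<omega>) = (cos (X (v + t *\<^sub>R h) \<omega>) + cos (X (v - t *\<^sub>R h) \<omega>)) / 2"
      using Xp[of v t] by eventually_elim (simp (no_asm_simp) add: cos_add cos_diff algebra_simps)
    have "(LINT \<omega>|M. cos (t * X h \<omega>) * cos (X v \<omega>)) = (LINT \<omega>|M. (cos (X (v + t *\<^sub>R h) \<omega>) + cos (X (v - t *\<^sub>R h) \<omega>)) / 2)"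
      by (rule integral_cong_AE[OF _ _ 1]) measurable
    also have "\<dots> = exp (- ((norm v)\<^sup>2 + t\<^sup>2) / 2)"
      using ic by (simp add: X_char norm_pm[OF v])
    finally show "(LINT \<omega>|M. cos (t * X h \<omega>) * cos (X v \<omega>)) = exp (- t\<^sup>2 / 2) * (LINT \<omega>|M. cos (X v \<omega>))"
      by (simp add: X_char exp_add[symmetric] field_simps)
    have 2: "AE \<omega> in M. cos (t * X h \<omega>) * sin (X v \<omega>) = (sin (X (v + t *\<^sub>R h) \<omega>) + sin (X (v - t *\<^sub>R h) \<omega>)) / 2"
      using Xp[of v t] by eventually_elim (simp (no_asm_simp) add: sin_add sin_diff algebra_simps)
    have "(LINT \<omega>|M. cos (t * X h \<omega>) * sin (X v \<omega>)) = (LINT \<omega>|M. (sin (X (v + t *\<^sub>R h) \<omega>) + sin (X (v - t *\<^sub>R h) \<omega>)) / 2)"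
      by (rule integral_cong_AE[OF _ _ 2]) measurable
    then show "(LINT \<omega>|M. cos (t * X h \<omega>) * sin (X v \<omega>)) = 0" using isn by (simp add: X_char)
    have 3: "AE \<omega> in M. sin (t * X h \<omega>) * cos (X v \<omega>) = (sin (X (v + t *\<^sub>R h) \<omega>) - sin (X (v - t *\<^sub>R h) \<omega>)) / 2"
      using Xp[of v t] by eventually_elim (simp (no_asm_simp) add: sin_add sin_diff algebra_simps)
    have "(LINT \<omega>|M. sin (t * X h \<omega>) * cos (X v \<omega>)) = (LINT \<omega>|M. (sin (X (v + t *\<^sub>R h) \<omega>) - sin (X (v - t *\<^sub>R h) \<omega>)) / 2)"
      by (rule integral_cong_AE[OF _ _ 3]) measurable
    then show "(LINT \<omega>|M. sin (t * X h \<omega>) * cos (X v \<omega>)) = 0" using isn by (simp add: X_char)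
    have 4: "AE \<omega> in M. sin (t * X h \<omega>) * sin (X v \<omega>) = (cos (X (v - t *\<^sub>R h) \<omega>) - cos (X (v + t *\<^sub>R h) \<omega>)) / 2"
      using Xp[of v t] by eventually_elim (simp (no_asm_simp) add: cos_add cos_diff algebra_simps)
    have "(LINT \<omega>|M. sin (t * X h \<omega>) * sin (X v \<omega>)) = (LINT \<omega>|M. (cos (X (v - t *\<^sub>R h) \<omega>) - cos (X (v + t *\<^sub>R h) \<omega>)) / 2)"
      by (rule integral_cong_AE[OF _ _ 4]) measurable
    then show "(LINT \<omega>|M. sin (t * X h \<omega>) * sin (X v \<omega>)) = 0" using ic by (simp add: X_char norm_pm[OF v])
  qed
  have bnd: "integrable M (\<lambda>\<omega>. cos (t * X h \<omega>))" "integrable M (\<lambda>\<omega>. sin (t * X h \<omega>))"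
    "integrable M (\<lambda>\<omega>. cos (t * X h \<omega>) * cos (X v \<omega>))" "integrable M (\<lambda>\<omega>. cos (t * X h \<omega>) * sin (X v \<omega>))" for t v
    by (auto intro!: integrable_const_bound[where B = 1] AE_I2 simp: abs_mult mult_le_one)
  have cosA: "(LINT \<omega>:A|M. cos (t * X h \<omega>)) = measure M A * exp (- t\<^sup>2 / 2)"
    and sinA: "(LINT \<omega>:A|M. sin (t * X h \<omega>)) = 0" if A: "A \<in> sigma_sets (space M) gen" for A t
  proof -
    have AM [measurable]: "A \<in> sets M" using A genM sets.sigma_sets_subset by blast
    have "(LINT \<omega>:A|M. cos (t * X h \<omega>) - exp (- t\<^sup>2 / 2)) = 0"
      by (rule trig_orthogonal_sigma[OF K _ _ _ A[unfolded gen_def]])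
        (use bnd ic isn prod in \<open>auto simp: left_diff_distrib X_char\<close>)
    moreover have "(LINT \<omega>:A|M. cos (t * X h \<omega>) - exp (- t\<^sup>2 / 2)) = (LINT \<omega>:A|M. cos (t * X h \<omega>)) - (LINT \<omega>:A|M. exp (- t\<^sup>2 / 2))"
      by (intro set_integral_diff(2); unfold set_integrable_def; intro integrable_mult_indicator AM bnd integrable_const)
    ultimately show "(LINT \<omega>:A|M. cos (t * X h \<omega>)) = measure M A * exp (- t\<^sup>2 / 2)"
      by (simp add: set_lebesgue_integral_def)
    show "(LINT \<omega>:A|M. sin (t * X h \<omega>)) = 0"
      by (rule trig_orthogonal_sigma[OF K _ _ _ A[unfolded gen_def]])
        (simp_all only: bnd prod)
  qed
  have ind: "measure M (A \<inter> (X h -` B \<inter> space M)) = measure M A * measure M (X h -` B \<inter> space M)"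
    if A: "A \<in> sigma_sets (space M) gen" and [measurable]: "B \<in> sets borel" for A B
  proof -
    have AM [measurable]: "A \<in> sets M" using A genM sets.sigma_sets_subset by blast
    have XB [measurable]: "X h -` B \<inter> space M \<in> sets M" by (rule measurable_sets[OF X_measurable]) simp
    have sp: "space M \<in> sigma_sets (space M) gen" by (rule sigma_sets_top)
    have iA: "integrable M (indicator A :: 'a \<Rightarrow> real)"
      by (rule integrable_const_bound[where B = 1]) auto
    \<comment> \<open>The weight \<open>indicator A\<close> and the constant weight P(A) have the
      same trigonometric moments in X h. Taking the whole space for A identifies exp (-t^2 / 2) with
      E[cos (t X h)].\<close>
    have "(LINT \<omega>|M. indicator A \<omega> * indicator B (X h \<omega>)) = (LINT \<omega>|M. measure M A * indicator B (X h \<omega>))"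
    proof (rule trig_moments_eq_imp_eq[OF iA integrable_const])
      show "(LINT \<omega>|M. indicator A \<omega> * cos (t * X h \<omega>)) = (LINT \<omega>|M. measure M A * cos (t * X h \<omega>))" for t
        using cosA[OF A, of t] cosA[OF sp, of t] set_integral_space[OF bnd(1)[of t]]
        by (simp add: set_lebesgue_integral_def[of M A] prob_space)
      show "(LINT \<omega>|M. indicator A \<omega> * sin (t * X h \<omega>)) = (LINT \<omega>|M. measure M A * sin (t * X h \<omega>))" for t
        using sinA[OF A, of t] sinA[OF sp, of t] set_integral_space[OF bnd(2)[of t]]
        by (simp add: set_lebesgue_integral_def[of M A] prob_space)
    qed auto
    moreover have "(LINT \<omega>|M. indicator A \<omega> * indicator B (X h \<omega>)) = (LINT \<omega>|M. indicator (A \<inter> (X h -` B \<inter> space M)) \<omega> :: real)"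
      using sets.sets_into_space[OF AM] by (intro Bochner_Integration.integral_cong) (auto simp: indicator_def)
    moreover have "(LINT \<omega>|M. indicator B (X h \<omega>)) = (LINT \<omega>|M. indicator (X h -` B \<inter> space M) \<omega> :: real)"
      by (intro Bochner_Integration.integral_cong) (auto simp: indicator_def)
    ultimately show ?thesis using AM XB by (simp add: Int_absorb2 sets.sets_into_space)
  qed
  \<comment> \<open>The Borel sets of \<open>nat \<Rightarrow> real\<close> are generated by the
    coordinates, and each coordinate of \<open>Y\<close> is one of the variables defining
    \<open>gen\<close>.\<close>
  have Y_gen: "Y -` B \<inter> space M \<in> sigma_sets (space M) gen" if "B \<in> sets borel" for B
  proof -
    have gP: "gen \<subseteq> Pow (space M)" using genM sets.space_closed by blast
    have "(\<lambda>\<omega>. Y \<omega> i) \<in> borel_measurable (sigma (space M) gen)" for i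
    proof (rule measurableI)
      fix B :: "real set" assume "B \<in> sets borel"
      then have "X (k i) -` B \<inter> space M \<in> gen" using k unfolding gen_def K_def by blast
      then show "(\<lambda>\<omega>. Y \<omega> i) -` B \<inter> space (sigma (space M) gen) \<in> sets (sigma (space M) gen)"
        using gP by (simp add: Y_def)
    qed simp
    then have "Y \<in> borel_measurable (sigma (space M) gen)"
      by (rule measurable_coordinatewise_then_product)
    then show ?thesis using measurable_sets[of Y "sigma (space M) gen" borel B] that gP by simp
  qed
  interpret DX: prob_space "distr M borel (X h)" by (rule prob_space_distr) simp
  interpret DY: prob_space "distr M borel Y" by (rule prob_space_distr) simp
  have "distr M borel (X h) \<Otimes>\<^sub>M distr M borel Y = distr M (borel \<Otimes>\<^sub>M borel) (\<lambda>\<omega>. (X h \<omega>, Y \<omega>))"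
  proof (rule pair_measure_eqI)
    fix A B assume "A \<in> sets (distr M borel (X h))" "B \<in> sets (distr M borel Y)"
    then have [measurable]: "A \<in> sets borel" "B \<in> sets borel" by auto
    have "emeasure (distr M borel (X h)) A * emeasure (distr M borel Y) B
      = ennreal (measure M (X h -` A \<inter> space M)) * ennreal (measure M (Y -` B \<inter> space M))"
      by (simp add: emeasure_distr emeasure_eq_measure)
    also have "\<dots> = ennreal (measure M ((Y -` B \<inter> space M) \<inter> (X h -` A \<inter> space M)))"
      by (subst ind[OF Y_gen]) (auto simp: ennreal_mult mult.commute)
    also have "(Y -` B \<inter> space M) \<inter> (X h -` A \<inter> space M) = (\<lambda>\<omega>. (X h \<omega>, Y \<omega>)) -` (A \<times> B) \<inter> space M" by auto
    finally show "emeasure (distr M borel (X h)) A * emeasure (distr M borel Y) B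
      = emeasure (distr M (borel \<Otimes>\<^sub>M borel) (\<lambda>\<omega>. (X h \<omega>, Y \<omega>))) (A \<times> B)"
      by (subst emeasure_distr) (measurable, simp add: emeasure_eq_measure)
  next
    show "sigma_finite_measure (distr M borel (X h))" "sigma_finite_measure (distr M borel Y)"
      by unfold_locales
    show "sets (distr M borel (X h) \<Otimes>\<^sub>M distr M borel Y) = sets (distr M (borel \<Otimes>\<^sub>M borel) (\<lambda>\<omega>. (X h \<omega>, Y \<omega>)))"
      unfolding sets_distr by (rule sets_pair_measure_cong) simp_all
  qed
  then show ?thesis by (simp add: Y_def[abs_def])
qed

end

section \<open>Functions on \<open>\<real>\<^sup>n\<close>\<close>

lemma smooth_on_RnD:
  assumes "smooth_on_Rn n \<psi>"
  shows "fun_on_Rn n \<psi>" "continuous_on UNIV \<psi>"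
    and "i < n \<Longrightarrow> ((\<lambda>t. \<psi> (x(i := t))) has_real_derivative pderivative i \<psi> x) (at (x i))"
    and "i < n \<Longrightarrow> continuous_on UNIV (pderivative i \<psi>)"
proof -
  note s = assms[unfolded smooth_on_Rn_def, THEN conjunct2, rule_format]
  show "fun_on_Rn n \<psi>" using assms by (simp add: smooth_on_Rn_def)
  show "continuous_on UNIV \<psi>" using s[of "[]"] by simp
  show "((\<lambda>t. \<psi> (x(i := t))) has_real_derivative pderivative i \<psi> x) (at (x i))" if "i < n"
    unfolding pderivative_def DERIV_deriv_iff_real_differentiable using s[of "[]"] that by simp
  show "continuous_on UNIV (pderivative i \<psi>)" if "i < n" using s[of "[i]"] that by simp
qed

lemma fun_on_Rn_pderivative:
  assumes "fun_on_Rn n f" "i < n"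
  shows "fun_on_Rn n (pderivative i f)"
  unfolding fun_on_Rn_def
proof (intro allI impI)
  fix x y :: "nat \<Rightarrow> real" assume "\<forall>i<n. x i = y i"
  then have "x i = y i" "(\<lambda>t. f (x(i := t))) = (\<lambda>t. f (y(i := t)))"
    using assms unfolding fun_on_Rn_def by (auto intro!: ext)
  then show "pderivative i f x = pderivative i f y" by (simp add: pderivative_def)
qed

text \<open>Where some coordinate exceeds R, f vanishes near the point along the line in direction
  i: by openness if that coordinate is i itself, along the whole line otherwise.\<close>

lemma compact_support_pderivative:
  assumes "compact_support_on_Rn n f" "i < n"
  shows "compact_support_on_Rn n (pderivative i f)"
proof -
  obtain R where R: "\<And>x j. f x \<noteq> 0 \<Longrightarrow> j < n \<Longrightarrow> \<bar>x j\<bar> \<le> R"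
    using assms(1) unfolding compact_support_on_Rn_def by blast
  have "\<bar>x j\<bar> \<le> R" if nz: "pderivative i f x \<noteq> 0" and j: "j < n" for x j
  proof (rule ccontr)
    assume *: "\<not> \<bar>x j\<bar> \<le> R"
    have "\<forall>\<^sub>F t in nhds (x i). f (x(i := t)) = 0"
    proof (cases "j = i")
      case True
      have "open {t. \<bar>t\<bar> > R}" by (intro open_Collect_less continuous_intros)
      then have "\<forall>\<^sub>F t in nhds (x i). t \<in> {t. \<bar>t\<bar> > R}"
        using * True by (intro eventually_nhds_in_open) auto
      then show ?thesis
      proof eventually_elim
        case (elim t)
        then show ?case using R[of "x(i := t)" i] assms(2) by fastforce
      qed
    next
      case False
      then have "f (x(i := t)) = 0" for t using R[of "x(i := t)" j] j * by auto
      then show ?thesis by simp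
    qed
    then have "deriv (\<lambda>t. f (x(i := t))) (x i) = deriv (\<lambda>t. 0) (x i)" by (intro deriv_cong_ev) auto
    then show False using nz by (simp add: pderivative_def)
  qed
  then show ?thesis unfolding compact_support_on_Rn_def by blast
qed

lemma compact_support_bounded:
  fixes f :: "(nat \<Rightarrow> real) \<Rightarrow> real"
  assumes "fun_on_Rn n f" "continuous_on UNIV f" "compact_support_on_Rn n f"
  shows "\<exists>B. \<forall>x. \<bar>f x\<bar> \<le> B"
proof -
  obtain R where R: "\<And>x j. f x \<noteq> 0 \<Longrightarrow> j < n \<Longrightarrow> \<bar>x j\<bar> \<le> R"
    using assms(3) unfolding compact_support_on_Rn_def by blast
  define S where "S i = (if i < n then {-R..R} else {0})" for i
  define K where "K = Pi\<^sub>E UNIV S"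
  have "compactin (product_topology (\<lambda>i. euclidean) UNIV) K"
    unfolding K_def compactin_PiE by (auto simp: S_def)
  then have "compact K" by (simp add: euclidean_product_topology)
  then have "compact (f ` K)"
    using assms(2) by (intro compact_continuous_image) (auto intro: continuous_on_subset)
  then have "bounded (f ` K)" by (rule compact_imp_bounded)
  then obtain B where "\<forall>y\<in>f ` K. norm y \<le> B" unfolding bounded_iff by blast
  then have B: "\<bar>f y\<bar> \<le> B" if "y \<in> K" for y using that by simp
  have "\<bar>f x\<bar> \<le> \<bar>B\<bar>" for x
  proof (cases "f x = 0")
    case False
    define y where "y i = (if i < n then x i else 0)" for i
    have "f x = f y" using assms(1) unfolding fun_on_Rn_def by (simp add: y_def)
    moreover have "y \<in> K" using R[OF False] by (auto simp: K_def S_def y_def abs_le_iff) (smt (verit))+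
    ultimately show ?thesis using B[of y] by simp
  qed simp
  then show ?thesis by blast
qed

text \<open>The chain rule from continuous partial derivatives, without a Frechet derivative on the
  product space: coordinates are moved one at a time, and each single move is treated by the mean
  value theorem.\<close>

lemma has_real_derivative_along_line:
  fixes f :: "(nat \<Rightarrow> real) \<Rightarrow> real"
  assumes f: "fun_on_Rn n f"
    and D: "\<And>i x. i < n \<Longrightarrow> ((\<lambda>t. f (x(i := t))) has_real_derivative D i x) (at (x i))"
    and cont: "\<And>i. i < n \<Longrightarrow> continuous_on UNIV (D i)"
  shows "((\<lambda>t. f (\<lambda>i. a i + t * v i)) has_real_derivative (\<Sum>i<n. v i * D i (\<lambda>i. a i + t * v i))) (at t)"
proof -
  define z where "z s i = a i + s * v i" for s i
  \<comment> \<open>Coordinates below m have moved to time s, the others still sit at time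
    t.\<close>
  define w where "w m s i = (if i < m then z s i else z t i)" for m s i
  have wt: "w m t = z t" for m by (auto simp: w_def)
  have "((\<lambda>s. f (w m s)) has_real_derivative (\<Sum>i<m. v i * D i (z t))) (at t)" if "m \<le> n" for m
    using that
  proof (induction m)
    case 0
    have "w 0 s = z t" for s by (auto simp: w_def)
    then show ?case by simp
  next
    case (Suc m)
    then have m: "m < n" by simp
    define q where "q s = f (w (Suc m) s) - f (w m s)" for s
    have "\<exists>\<theta>. 0 < \<theta> \<and> \<theta> < 1 \<and> q s = (s - t) * v m * D m ((w m s)(m := z (t + \<theta> * (s - t)) m))" for s
    proof -
      define k where "k \<theta> = f ((w m s)(m := z (t + \<theta> * (s - t)) m))" for \<theta>
      have "(k has_real_derivative (s - t) * v m * D m ((w m s)(m := z (t + \<theta> * (s - t)) m))) (at \<theta>)" for \<theta>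
      proof -
        have "((\<lambda>r. f (((w m s)(m := z (t + \<theta> * (s - t)) m))(m := r))) has_real_derivative
           D m ((w m s)(m := z (t + \<theta> * (s - t)) m))) (at (z (t + \<theta> * (s - t)) m))"
          using D[OF m, of "(w m s)(m := z (t + \<theta> * (s - t)) m)"] by simp
        moreover have "((\<lambda>\<theta>. z (t + \<theta> * (s - t)) m) has_real_derivative (s - t) * v m) (at \<theta>)"
          unfolding z_def by (auto intro!: derivative_eq_intros)
        ultimately show ?thesis
          unfolding k_def using DERIV_chain2[where g = "\<lambda>\<theta>. z (t + \<theta> * (s - t)) m"] by (fastforce simp: mult.commute)
      qed
      then obtain \<theta> where "0 < \<theta>" "\<theta> < 1" "k 1 - k 0 = (1 - 0) * ((s - t) * v m * D m ((w m s)(m := z (t + \<theta> * (s - t)) m)))"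
        using MVT2[of 0 1 k "\<lambda>\<theta>. (s - t) * v m * D m ((w m s)(m := z (t + \<theta> * (s - t)) m))"] by auto
      moreover have "(w m s)(m := z (t + 1 * (s - t)) m) = w (Suc m) s" "(w m s)(m := z (t + 0 * (s - t)) m) = w m s"
        by (auto simp: w_def less_Suc_eq)
      ultimately show ?thesis unfolding q_def k_def by (intro exI[of _ \<theta>]) simp
    qed
    then obtain \<theta> where \<theta>: "\<And>s. 0 < \<theta> s" "\<And>s. \<theta> s < 1"
      "\<And>s. q s = (s - t) * v m * D m ((w m s)(m := z (t + \<theta> s * (s - t)) m))" by metis
    \<comment> \<open>Joint continuity in the position of the moved coordinates and in the
      intermediate time lets s tend to t in both at once.\<close>
    define E where "E p = D m ((w m (fst p))(m := z (snd p) m))" for p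
    have "continuous_on UNIV (\<lambda>p. (w m (fst p))(m := z (snd p) m))"
    proof (rule continuous_on_coordinatewise_then_product)
      fix i
      show "continuous_on UNIV (\<lambda>p. ((w m (fst p))(m := z (snd p) m)) i)"
        by (cases "i = m"; cases "i < m") (auto simp: w_def z_def intro!: continuous_intros)
    qed
    then have "continuous_on UNIV E"
      unfolding E_def using continuous_on_compose2[OF cont[OF m]] by blast
    then have E: "isCont E (t, t)" by (simp add: continuous_on_eq_continuous_at)
    have "((\<lambda>s. t + \<theta> s * (s - t)) \<longlongrightarrow> t) (at t)"
    proof -
      have "((\<lambda>s. \<theta> s * (s - t)) \<longlongrightarrow> 0) (at t)"
      proof (rule Lim_null_comparison)
        show "\<forall>\<^sub>F s in at t. norm (\<theta> s * (s - t)) \<le> \<bar>s - t\<bar>"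
        proof (intro always_eventually allI)
          fix s
          have "\<bar>\<theta> s\<bar> \<le> 1" using \<theta>(1,2)[of s] by simp
          then show "norm (\<theta> s * (s - t)) \<le> \<bar>s - t\<bar>"
            using mult_right_mono[of "\<bar>\<theta> s\<bar>" 1 "\<bar>s - t\<bar>"] by (simp add: abs_mult)
        qed
        show "((\<lambda>s. \<bar>s - t\<bar>) \<longlongrightarrow> 0) (at t)"
          using tendsto_rabs_zero[OF LIM_zero[OF tendsto_ident_at]] by simp
      qed
      then show ?thesis using tendsto_add[OF tendsto_const[of t]] by fastforce
    qed
    then have "((\<lambda>s. E (s, t + \<theta> s * (s - t))) \<longlongrightarrow> E (t, t)) (at t)"
      by (intro isCont_tendsto_compose[OF E] tendsto_Pair tendsto_ident_at)
    moreover have "E (t, t) = D m (z t)" by (simp add: E_def wt)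
    ultimately have "((\<lambda>s. v m * E (s, t + \<theta> s * (s - t))) \<longlongrightarrow> v m * D m (z t)) (at t)"
      by (intro tendsto_mult_left) simp
    then have "(q has_real_derivative v m * D m (z t)) (at t)"
      unfolding has_field_derivative_iff
    proof (rule Lim_transform_eventually)
      have "q t = 0" by (simp add: q_def wt)
      then show "\<forall>\<^sub>F s in at t. v m * E (s, t + \<theta> s * (s - t)) = (q s - q t) / (s - t)"
        using \<theta>(3) by (auto simp: eventually_at_filter E_def)
    qed
    then have "((\<lambda>s. q s + f (w m s)) has_real_derivative v m * D m (z t) + (\<Sum>i<m. v i * D i (z t))) (at t)"
      using Suc by (intro DERIV_add) auto
    then show ?case by (simp add: q_def add.commute)
  qed
  from this[of n] have "((\<lambda>s. f (w n s)) has_real_derivative (\<Sum>i<n. v i * D i (z t))) (at t)" by simp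
  moreover have "f (w n s) = f (z s)" for s using f unfolding fun_on_Rn_def by (simp add: w_def)
  ultimately show ?thesis by (simp add: z_def[abs_def])
qed

section \<open>Gaussian integration by parts\<close>

text \<open>The standard normal density has derivative -x times itself, so the density times u is a
  primitive of the integrand; the growth bound makes it vanish at both ends.\<close>

lemma gaussian_integration_by_parts:
  fixes u u' :: "real \<Rightarrow> real"
  assumes d: "\<And>x. (u has_real_derivative u' x) (at x)" and c: "\<And>x. isCont u' x"
    and b: "\<And>x. \<bar>u x\<bar> \<le> C * exp (c * \<bar>x\<bar>)" and b': "\<And>x. \<bar>u' x\<bar> \<le> C * exp (c * \<bar>x\<bar>)"
  shows "(LINT x|std_normal_distribution. u' x - x * u x) = 0"
proof -
  have uc: "isCont u x" for x using d DERIV_isCont by blast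
  have [measurable]: "u \<in> borel_measurable borel" "u' \<in> borel_measurable borel"
    using uc c by (auto intro!: borel_measurable_continuous_onI continuous_at_imp_continuous_on)
  define F where "F x = std_normal_density x * u x" for x
  define f where "f x = std_normal_density x * (u' x - x * u x)" for x
  have C: "C \<ge> 0" using b[of 0] by simp
  have "((\<lambda>x. k * exp (- x\<^sup>2 / 2)) has_real_derivative - x * (k * exp (- x\<^sup>2 / 2))) (at x)" for k x :: real
    by (auto intro!: derivative_eq_intros)
  from this[of "1 / sqrt (2 * pi)"]
  have sd: "(std_normal_density has_real_derivative (- x * std_normal_density x)) (at x)" for x
    unfolding std_normal_density_def[abs_def] .
  have Fd: "(F has_real_derivative f x) (at x)" for x
    unfolding F_def f_def using DERIV_mult[OF sd d] by (simp add: algebra_simps)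
  have sc: "isCont std_normal_density x" for x using sd DERIV_isCont by blast
  have fc: "isCont f x" for x unfolding f_def by (intro continuous_intros sc c uc)
  have fi: "integrable lborel f"
  \<comment> \<open>The exponent \<open>c + 1\<close> absorbs the factor x through \<bar>x\<bar>
    \<le> exp \<bar>x\<bar>.\<close>
  proof (rule Bochner_Integration.integrable_bound[OF integrable_mult_right[OF integrable_std_normal_exp_abs[of "c + 1"], of "2 * C"]])
    have le: "norm (f x) \<le> 2 * C * (std_normal_density x * exp ((c + 1) * \<bar>x\<bar>))" for x
    proof -
      have "\<bar>x\<bar> \<le> exp \<bar>x\<bar>" "1 \<le> exp \<bar>x\<bar>" using exp_ge_add_one_self[of "\<bar>x\<bar>"] by linarith+
      then have "\<bar>x * u x\<bar> \<le> exp \<bar>x\<bar> * (C * exp (c * \<bar>x\<bar>))" "\<bar>u' x\<bar> \<le> exp \<bar>x\<bar> * (C * exp (c * \<bar>x\<bar>))"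
        using b[of x] b'[of x] C mult_mono[of 1 "exp \<bar>x\<bar>" "\<bar>u' x\<bar>" "C * exp (c * \<bar>x\<bar>)"]
        by (auto simp: abs_mult intro!: mult_mono)
      moreover have "exp \<bar>x\<bar> * (C * exp (c * \<bar>x\<bar>)) = C * exp ((c + 1) * \<bar>x\<bar>)"
        by (simp add: exp_add[symmetric] algebra_simps)
      ultimately have "\<bar>u' x - x * u x\<bar> \<le> 2 * C * exp ((c + 1) * \<bar>x\<bar>)" by linarith
      then have "std_normal_density x * \<bar>u' x - x * u x\<bar> \<le> std_normal_density x * (2 * C * exp ((c + 1) * \<bar>x\<bar>))"
        by (rule mult_left_mono) simp
      then show ?thesis by (simp add: f_def abs_mult mult_ac)
    qed
    show "AE x in lborel. norm (f x) \<le> norm (2 * C * (std_normal_density x * exp ((c + 1) * \<bar>x\<bar>)))"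
      using le by (intro AE_I2) (simp add: C)
  qed (unfold f_def, measurable)
  have Fb: "norm (F x) \<le> C * exp (- x\<^sup>2 / 2 + c * \<bar>x\<bar>)" for x
  proof -
    have "2 * pi \<ge> 1" using pi_ge_two by simp
    then have "1 / sqrt (2 * pi) \<le> 1" by simp
    then have "std_normal_density x \<le> exp (- x\<^sup>2 / 2)"
      unfolding std_normal_density_def using mult_right_mono[of "1 / sqrt (2 * pi)" 1 "exp (- x\<^sup>2 / 2)"] by simp
    then have "std_normal_density x * \<bar>u x\<bar> \<le> exp (- x\<^sup>2 / 2) * (C * exp (c * \<bar>x\<bar>))"
      using b[of x] by (intro mult_mono) auto
    also have "\<dots> = C * exp (- x\<^sup>2 / 2 + c * \<bar>x\<bar>)"
      unfolding exp_add by (simp add: mult_ac)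
    finally show ?thesis by (simp add: F_def abs_mult)
  qed
  have top: "(F \<longlongrightarrow> 0) at_top"
  proof (rule Lim_null_comparison)
    show "\<forall>\<^sub>F x in at_top. norm (F x) \<le> C * exp (- x\<^sup>2 / 2 + c * x)"
      using eventually_ge_at_top[of 0]
    proof eventually_elim
      case (elim x)
      then show ?case using Fb[of x] by simp
    qed
    show "((\<lambda>x. C * exp (- x\<^sup>2 / 2 + c * x)) \<longlongrightarrow> 0) at_top" by real_asymp
  qed
  have bot: "(F \<longlongrightarrow> 0) at_bot"
  proof (rule Lim_null_comparison)
    show "\<forall>\<^sub>F x in at_bot. norm (F x) \<le> C * exp (- x\<^sup>2 / 2 - c * x)"
      using eventually_le_at_bot[of 0]
    proof eventually_elim
      case (elim x)
      then show ?case using Fb[of x] by simp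
    qed
    show "((\<lambda>x. C * exp (- x\<^sup>2 / 2 - c * x)) \<longlongrightarrow> 0) at_bot" by real_asymp
  qed
  have "(LBINT x=-\<infinity>..\<infinity>. f x) = 0 - 0"
  proof (rule interval_integral_FTC_integrable)
    show "(F has_vector_derivative f x) (at x)" for x
      using Fd by (simp add: has_real_derivative_iff_has_vector_derivative)
    show "set_integrable lborel (einterval (-\<infinity>) \<infinity>) f" using fi by (simp add: set_integrable_def)
  qed (use fc top bot in \<open>auto simp: ereal_tendsto_simps\<close>)
  then have "(LINT x|lborel. f x) = 0"
    by (simp add: interval_lebesgue_integral_def set_lebesgue_integral_def)
  then show ?thesis unfolding f_def by (simp add: integral_density)
qed

context isonormal
begin

text \<open>Fubini for the product law of X h and the independent sequence. The growth constants may
  depend on y, since the inner integral is evaluated for one y at a time; integrability on the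
  product is the separate hypothesis \<open>i\<close>.\<close>

lemma orthogonal_integration_by_parts:
  fixes \<Phi> \<Phi>' :: "real \<Rightarrow> (nat \<Rightarrow> real) \<Rightarrow> real"
  assumes h: "norm h = 1" and k: "\<And>i. h \<bullet> k i = 0"
    and m [measurable]: "(\<lambda>p. \<Phi> (fst p) (snd p)) \<in> borel_measurable (borel \<Otimes>\<^sub>M borel)"
      "(\<lambda>p. \<Phi>' (fst p) (snd p)) \<in> borel_measurable (borel \<Otimes>\<^sub>M borel)"
    and d: "\<And>x y. ((\<lambda>x. \<Phi> x y) has_real_derivative \<Phi>' x y) (at x)"
    and c: "\<And>x y. isCont (\<lambda>x. \<Phi>' x y) x"
    and b: "\<And>y. \<exists>C c. \<forall>x. \<bar>\<Phi> x y\<bar> \<le> C * exp (c * \<bar>x\<bar>) \<and> \<bar>\<Phi>' x y\<bar> \<le> C * exp (c * \<bar>x\<bar>)"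
    and i: "integrable M (\<lambda>\<omega>. \<Phi>' (X h \<omega>) (\<lambda>i. X (k i) \<omega>) - X h \<omega> * \<Phi> (X h \<omega>) (\<lambda>i. X (k i) \<omega>))"
  shows "(LINT \<omega>|M. \<Phi>' (X h \<omega>) (\<lambda>i. X (k i) \<omega>) - X h \<omega> * \<Phi> (X h \<omega>) (\<lambda>i. X (k i) \<omega>)) = 0"
proof -
  define Y where "Y \<omega> i = X (k i) \<omega>" for \<omega> i
  have Ym [measurable]: "Y \<in> borel_measurable M"
    unfolding Y_def by (rule measurable_coordinatewise_then_product) measurable
  define T where "T x y = \<Phi>' x y - x * \<Phi> x y" for x y
  have Tm [measurable]: "case_prod T \<in> borel_measurable (borel \<Otimes>\<^sub>M borel)"
    unfolding T_def case_prod_beta' by measurable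
  have pm: "(\<lambda>\<omega>. (X h \<omega>, Y \<omega>)) \<in> M \<rightarrow>\<^sub>M borel \<Otimes>\<^sub>M borel" by measurable
  interpret DX: prob_space "distr M borel (X h)" by (rule prob_space_distr) simp
  interpret DY: prob_space "distr M borel Y" by (rule prob_space_distr) simp
  interpret P: pair_sigma_finite "distr M borel (X h)" "distr M borel Y" ..
  have law: "distr M borel (X h) \<Otimes>\<^sub>M distr M borel Y = distr M (borel \<Otimes>\<^sub>M borel) (\<lambda>\<omega>. (X h \<omega>, Y \<omega>))"
    using X_indep_orthogonal[OF h k] by (simp add: Y_def[abs_def])
  have "integrable (distr M (borel \<Otimes>\<^sub>M borel) (\<lambda>\<omega>. (X h \<omega>, Y \<omega>))) (case_prod T)"
    using i integrable_distr_eq[OF pm Tm] by (simp add: T_def Y_def[abs_def])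
  then have int: "integrable (distr M borel (X h) \<Otimes>\<^sub>M distr M borel Y) (case_prod T)"
    by (simp add: law)
  have "(LINT \<omega>|M. T (X h \<omega>) (Y \<omega>)) = integral\<^sup>L (distr M (borel \<Otimes>\<^sub>M borel) (\<lambda>\<omega>. (X h \<omega>, Y \<omega>))) (case_prod T)"
    by (subst integral_distr[OF pm Tm]) simp
  also have "\<dots> = (LINT y|distr M borel Y. (LINT x|distr M borel (X h). T x y))"
    unfolding law[symmetric] by (rule P.integral_snd[OF int, symmetric])
  also have "\<dots> = (LINT y|distr M borel Y. 0)"
  proof (rule Bochner_Integration.integral_cong[OF refl])
    fix y
    obtain C c' where "\<And>x. \<bar>\<Phi> x y\<bar> \<le> C * exp (c' * \<bar>x\<bar>)" "\<And>x. \<bar>\<Phi>' x y\<bar> \<le> C * exp (c' * \<bar>x\<bar>)"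
      using b[of y] by blast
    then show "(LINT x|distr M borel (X h). T x y) = 0"
      unfolding X_unit_law[OF h] T_def by (intro gaussian_integration_by_parts[OF d c])
  qed
  finally show ?thesis by (simp add: T_def Y_def[abs_def])
qed

end

lemma poly_exp_bound_deriv:
  fixes p :: "real poly"
  shows "\<exists>C n. 0 \<le> C \<and> (\<forall>x. \<bar>poly p x\<bar> \<le> C * exp (real n * \<bar>x\<bar>)
    \<and> \<bar>poly (pderiv p) x\<bar> \<le> C * exp (real n * \<bar>x\<bar>))"
proof -
  obtain C n where 1: "0 \<le> C" "\<And>x. \<bar>poly p x\<bar> \<le> C * exp (real n * \<bar>x\<bar>)" using poly_exp_bound by blast
  obtain D m where 2: "0 \<le> D" "\<And>x. \<bar>poly (pderiv p) x\<bar> \<le> D * exp (real m * \<bar>x\<bar>)" using poly_exp_bound by blast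
  have e: "C * exp (real n * \<bar>x\<bar>) \<le> (C + D) * exp (real (n + m) * \<bar>x\<bar>)"
    "D * exp (real m * \<bar>x\<bar>) \<le> (C + D) * exp (real (n + m) * \<bar>x\<bar>)" for x
    using 1 2 by (auto intro!: mult_mono mult_right_mono)
  show ?thesis
    using 1(1) 2(1) order_trans[OF 1(2) e(1)] order_trans[OF 2(2) e(2)]
    by (intro exI[of _ "C + D"] exI[of _ "n + m"]) auto
qed

context isonormal
begin

lemma cylindrical_measurable:
  assumes "continuous_on UNIV (\<psi> :: (nat \<Rightarrow> real) \<Rightarrow> real)"
  shows "(\<lambda>\<omega>. \<psi> (\<lambda>i. X (\<phi> i) \<omega>)) \<in> borel_measurable M"
  by (rule measurable_compose[OF measurable_coordinatewise_then_product borel_measurable_continuous_onI[OF assms]])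
    measurable

lemma smooth_cylindrical_L2:
  assumes "smooth_cylindrical X F G"
  shows "in_L2 M F" "in_L2 M G"
proof -
  obtain n \<psi> \<phi> where s: "smooth_on_Rn n \<psi>" "compact_support_on_Rn n \<psi>"
    and F: "F = (\<lambda>\<omega>. \<psi> (\<lambda>i. X (\<phi> i) \<omega>))"
    and G: "G = (\<lambda>\<omega>. \<Sum>i<n. pderivative i \<psi> (\<lambda>j. X (\<phi> j) \<omega>) *\<^sub>R \<phi> i)"
    using assms unfolding smooth_cylindrical_def by blast
  note sD = smooth_on_RnD[OF s(1)]
  obtain B where B: "\<And>x. \<bar>\<psi> x\<bar> \<le> B" using compact_support_bounded[OF sD(1,2) s(2)] by blast
  show "in_L2 M F" unfolding F
    by (rule in_L2_bounded[OF cylindrical_measurable[OF sD(2)]]) (use B in auto)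
  show "in_L2 M G" unfolding G
  proof (rule in_L2_sum)
    fix i assume "i \<in> {..<n}"
    then have i: "i < n" by simp
    obtain B where B: "\<And>x. \<bar>pderivative i \<psi> x\<bar> \<le> B"
      using compact_support_bounded[OF fun_on_Rn_pderivative[OF sD(1) i] sD(4)[OF i] compact_support_pderivative[OF s(2) i]] by blast
    show "in_L2 M (\<lambda>\<omega>. pderivative i \<psi> (\<lambda>j. X (\<phi> j) \<omega>) *\<^sub>R \<phi> i)"
      by (rule in_L2_mult_bounded[OF in_L2_const cylindrical_measurable[OF sD(4)[OF i]] B])
  qed
qed

text \<open>All arguments are split into a multiple of \<open>X h\<close> and a variable independent of \<open>X h\<close>.\<close>

lemma smooth_cylindrical_integration_by_parts:
  assumes FG: "smooth_cylindrical X F G" and h: "norm h = 1"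
  shows "(LINT \<omega>|M. (G \<omega> \<bullet> h) * poly p (X k \<omega>))
    = (LINT \<omega>|M. F \<omega> * (poly p (X k \<omega>) * X h \<omega> - (k \<bullet> h) * poly (pderiv p) (X k \<omega>)))"
proof -
  obtain n \<psi> \<phi> where s: "smooth_on_Rn n \<psi>" "compact_support_on_Rn n \<psi>"
    and F: "F = (\<lambda>\<omega>. \<psi> (\<lambda>i. X (\<phi> i) \<omega>))"
    and G: "G = (\<lambda>\<omega>. \<Sum>i<n. pderivative i \<psi> (\<lambda>j. X (\<phi> j) \<omega>) *\<^sub>R \<phi> i)"
    using FG unfolding smooth_cylindrical_def by blast
  note sD = smooth_on_RnD[OF s(1)]
  note L2 = smooth_cylindrical_L2[OF FG]
  obtain B0 where B0: "\<And>x. \<bar>\<psi> x\<bar> \<le> B0" using compact_support_bounded[OF sD(1,2) s(2)] by blast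
  have "\<exists>B. \<forall>x. \<bar>pderivative i \<psi> x\<bar> \<le> B" if i: "i < n" for i
    using compact_support_bounded[OF fun_on_Rn_pderivative[OF sD(1) i] sD(4)[OF i] compact_support_pderivative[OF s(2) i]] .
  then obtain B1 where B1: "\<And>i x. i < n \<Longrightarrow> \<bar>pderivative i \<psi> x\<bar> \<le> B1 i" by metis
  define c where "c i = \<phi> i \<bullet> h" for i
  define ck where "ck = k \<bullet> h"
  \<comment> \<open>Index 0 carries the component of k orthogonal to h, index \<open>Suc j\<close>
    that of \<open>\<phi> j\<close>.\<close>
  define kk where "kk i = (case i of 0 \<Rightarrow> k - ck *\<^sub>R h | Suc j \<Rightarrow> \<phi> j - c j *\<^sub>R h)" for i
  have orth: "h \<bullet> kk i = 0" for i
    using h by (cases i) (auto simp: kk_def c_def ck_def inner_diff_right inner_commute norm_eq_1)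
  \<comment> \<open>\<open>P\<close> puts the h-components back: at X h and \<open>Y\<close> it
    returns the original arguments almost surely.\<close>
  define P where "P x y i = y (Suc i) + x * c i" for x :: real and y :: "nat \<Rightarrow> real" and i
  define \<Phi> where "\<Phi> x y = \<psi> (P x y) * poly p (y 0 + x * ck)" for x y
  define \<Phi>' where "\<Phi>' x y = (\<Sum>i<n. c i * pderivative i \<psi> (P x y)) * poly p (y 0 + x * ck)
      + \<psi> (P x y) * (ck * poly (pderiv p) (y 0 + x * ck))" for x y
  define Y where "Y \<omega> i = X (kk i) \<omega>" for \<omega> i
  have XP: "AE \<omega> in M. P (X h \<omega>) (Y \<omega>) = (\<lambda>i. X (\<phi> i) \<omega>) \<and> Y \<omega> 0 + X h \<omega> * ck = X k \<omega>"
  proof -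
    have "AE \<omega> in M. X (kk (Suc i)) \<omega> = X (\<phi> i) \<omega> - c i * X h \<omega>" for i
      using X_linear[of 1 "\<phi> i" "- c i" h] by (simp add: kk_def)
    then have "AE \<omega> in M. \<forall>i. X (kk (Suc i)) \<omega> = X (\<phi> i) \<omega> - c i * X h \<omega>"
      by (simp add: AE_all_countable)
    moreover have "AE \<omega> in M. X (kk 0) \<omega> = X k \<omega> - ck * X h \<omega>"
      using X_linear[of 1 k "- ck" h] by (simp add: kk_def)
    ultimately show ?thesis
      by eventually_elim (auto simp: P_def Y_def fun_eq_iff mult.commute)
  qed
  have coord: "(\<lambda>q :: real \<times> (nat \<Rightarrow> real). snd q i) \<in> borel_measurable (borel \<Otimes>\<^sub>M borel)" for i
    by (rule measurable_compose[OF measurable_snd measurable_product_coordinates])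
  have lin: "(\<lambda>q :: real \<times> (nat \<Rightarrow> real). snd q i + fst q * a) \<in> borel_measurable (borel \<Otimes>\<^sub>M borel)" for i a
    by (intro borel_measurable_add coord) measurable
  have Pm [measurable]: "(\<lambda>q. P (fst q) (snd q)) \<in> borel_measurable (borel \<Otimes>\<^sub>M borel)"
  proof (rule measurable_coordinatewise_then_product)
    fix i
    show "(\<lambda>q. P (fst q) (snd q) i) \<in> borel_measurable (borel \<Otimes>\<^sub>M borel)"
      unfolding P_def by (rule lin)
  qed
  have [measurable]: "\<psi> \<in> borel_measurable borel" by (rule borel_measurable_continuous_onI[OF sD(2)])
  have pm [measurable]: "i < n \<Longrightarrow> pderivative i \<psi> \<in> borel_measurable borel" for i by (rule borel_measurable_continuous_onI[OF sD(4)])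
  have cP: "continuous_on UNIV (\<lambda>x. P x y)" for y
    by (rule continuous_on_coordinatewise_then_product) (auto simp: P_def intro!: continuous_intros)
  have pdm: "(\<lambda>q. \<Sum>i<n. c i * pderivative i \<psi> (P (fst q) (snd q))) \<in> borel_measurable (borel \<Otimes>\<^sub>M borel)"
    by (intro borel_measurable_sum borel_measurable_times borel_measurable_const measurable_compose[OF Pm pm]) simp
  note [measurable] = pdm lin
  have D: "((\<lambda>x. \<Phi> x y) has_real_derivative \<Phi>' x y) (at x)" for x y
  proof -
    have "((\<lambda>x. \<psi> (P x y)) has_real_derivative (\<Sum>i<n. c i * pderivative i \<psi> (P x y))) (at x)"
      unfolding P_def by (rule has_real_derivative_along_line[OF sD(1,3,4)])
    moreover have "((\<lambda>x. poly p (y 0 + x * ck)) has_real_derivative ck * poly (pderiv p) (y 0 + x * ck)) (at x)"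
      by (rule DERIV_chain2[OF poly_DERIV, THEN DERIV_cong]) (auto intro!: derivative_eq_intros)
    ultimately show ?thesis
      unfolding \<Phi>_def \<Phi>'_def by (rule DERIV_mult[THEN DERIV_cong]) (simp add: algebra_simps)
  qed
  have C: "isCont (\<lambda>x. \<Phi>' x y) x" for x y
  proof -
    have "continuous_on UNIV (\<lambda>x. \<Phi>' x y)"
      unfolding \<Phi>'_def
      by (intro continuous_intros continuous_on_compose2[OF sD(4) cP] continuous_on_compose2[OF sD(2) cP]) auto
    then show ?thesis by (simp add: continuous_on_eq_continuous_at)
  qed
  have bnd: "\<exists>C c. \<forall>x. \<bar>\<Phi> x y\<bar> \<le> C * exp (c * \<bar>x\<bar>) \<and> \<bar>\<Phi>' x y\<bar> \<le> C * exp (c * \<bar>x\<bar>)" for y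
  proof -
    obtain K N where K: "0 \<le> K" "\<And>x. \<bar>poly p x\<bar> \<le> K * exp (real N * \<bar>x\<bar>)"
      "\<And>x. \<bar>poly (pderiv p) x\<bar> \<le> K * exp (real N * \<bar>x\<bar>)" 
      using poly_exp_bound_deriv[of p] by blast
    \<comment> \<open>An exponential bound in x alone; for fixed y the factor coming from
      \<open>y 0\<close> is a constant.\<close>
    define E where "E x = K * exp (real N * \<bar>y 0\<bar>) * exp (real N * \<bar>ck\<bar> * \<bar>x\<bar>)" for x :: real
    have E0: "0 \<le> E x" for x using K(1) by (simp add: E_def)
    have "K * exp (real N * \<bar>y 0 + x * ck\<bar>) \<le> E x" for x
    proof -
      have "real N * \<bar>y 0 + x * ck\<bar> \<le> real N * (\<bar>y 0\<bar> + \<bar>x\<bar> * \<bar>ck\<bar>)"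
        by (intro mult_left_mono order_trans[OF abs_triangle_ineq]) (auto simp: abs_mult)
      also have "\<dots> = real N * \<bar>y 0\<bar> + real N * \<bar>ck\<bar> * \<bar>x\<bar>" by (simp add: algebra_simps)
      finally have "exp (real N * \<bar>y 0 + x * ck\<bar>) \<le> exp (real N * \<bar>y 0\<bar>) * exp (real N * \<bar>ck\<bar> * \<bar>x\<bar>)"
        by (simp add: exp_add[symmetric])
      then show ?thesis unfolding E_def mult.assoc by (intro mult_left_mono K)
    qed
    then have pE: "\<bar>poly p (y 0 + x * ck)\<bar> \<le> E x" "\<bar>poly (pderiv p) (y 0 + x * ck)\<bar> \<le> E x" for x
      using K(2,3)[of "y 0 + x * ck"] by (meson order_trans)+
    define S where "S = (\<Sum>i<n. \<bar>c i\<bar> * \<bar>B1 i\<bar>)"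
    have S0: "S \<ge> 0" unfolding S_def by (intro sum_nonneg) auto
    have Sb: "\<bar>\<Sum>i<n. c i * pderivative i \<psi> (P x y)\<bar> \<le> S" for x
      unfolding S_def
      by (rule order_trans[OF sum_abs sum_mono]) (use B1 in \<open>auto simp: abs_mult intro!: mult_left_mono order_trans[OF B1 abs_ge_self]\<close>)
    have B00: "0 \<le> B0" using B0[of "\<lambda>_. 0"] by simp
    have 1: "\<bar>\<Phi> x y\<bar> \<le> B0 * E x" for x
      unfolding \<Phi>_def abs_mult using B0 pE E0 B00 by (intro mult_mono) auto
    have "\<bar>(\<Sum>i<n. c i * pderivative i \<psi> (P x y)) * poly p (y 0 + x * ck)\<bar> \<le> S * E x" for x
      unfolding abs_mult using Sb pE E0 S0 by (intro mult_mono) auto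
    moreover have "\<bar>\<psi> (P x y) * (ck * poly (pderiv p) (y 0 + x * ck))\<bar> \<le> B0 * (\<bar>ck\<bar> * E x)" for x
      unfolding abs_mult using B0 pE E0 B00 by (intro mult_mono) auto
    ultimately have 2: "\<bar>\<Phi>' x y\<bar> \<le> S * E x + B0 * (\<bar>ck\<bar> * E x)" for x
      unfolding \<Phi>'_def by (intro order_trans[OF abs_triangle_ineq] add_mono)
    define C where "C = (S + B0 * \<bar>ck\<bar> + B0) * (K * exp (real N * \<bar>y 0\<bar>))"
    have CE: "C * exp (real N * \<bar>ck\<bar> * \<bar>x\<bar>) = S * E x + B0 * (\<bar>ck\<bar> * E x) + B0 * E x" for x
      by (simp add: C_def E_def algebra_simps)
    have nn: "0 \<le> S * E x" "0 \<le> B0 * (\<bar>ck\<bar> * E x)" "0 \<le> B0 * E x" for x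
      using S0 B00 E0 by auto
    show ?thesis
      by (intro exI[of _ C] exI[of _ "real N * \<bar>ck\<bar>"] allI conjI; unfold CE)
        (use 1 2 nn in \<open>smt (verit)\<close>)+
  qed
  \<comment> \<open>Differentiating in x, the cylindrical factor contributes the inner product of G
    with h by the chain rule, the polynomial factor that of k with h times the derivative of
    p.\<close>
  have AE_eq: "AE \<omega> in M. \<Phi>' (X h \<omega>) (\<lambda>i. X (kk i) \<omega>) - X h \<omega> * \<Phi> (X h \<omega>) (\<lambda>i. X (kk i) \<omega>)
    = (G \<omega> \<bullet> h) * poly p (X k \<omega>) - F \<omega> * (poly p (X k \<omega>) * X h \<omega> - (k \<bullet> h) * poly (pderiv p) (X k \<omega>))"
    using XP
  proof eventually_elim
    case (elim \<omega>)
    then have Yk: "(\<lambda>i. X (kk i) \<omega>) = Y \<omega>" by (simp add: Y_def[abs_def])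
    have "G \<omega> \<bullet> h = (\<Sum>i<n. c i * pderivative i \<psi> (\<lambda>i. X (\<phi> i) \<omega>))"
      by (simp add: G inner_sum_left c_def mult.commute)
    then show ?case
      unfolding Yk \<Phi>_def \<Phi>'_def using elim by (simp add: F ck_def algebra_simps)
  qed
  have pX: "in_L2 M (\<lambda>\<omega>. poly p (X k \<omega>) * X h \<omega>)"
    using poly_X_mult_L2[of p k "[:0, 1:]" h] by simp
  have i1: "integrable M (\<lambda>\<omega>. (G \<omega> \<bullet> h) * poly p (X k \<omega>))"
  proof -
    have "in_L2 M (\<lambda>\<omega>. poly p (X k \<omega>) *\<^sub>R h)"
      by (rule in_L2_bound[OF poly_X_L2[of p k]]) (auto simp: h)
    from integrable_L2_inner[OF L2(2) this] show ?thesis by (simp add: mult.commute)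
  qed
  have i2: "integrable M (\<lambda>\<omega>. F \<omega> * (poly p (X k \<omega>) * X h \<omega> - (k \<bullet> h) * poly (pderiv p) (X k \<omega>)))"
    by (intro integrable_L2_mult L2 in_L2_diff pX in_L2_cmult poly_X_L2)
  have m1: "(\<lambda>q. \<Phi> (fst q) (snd q)) \<in> borel_measurable (borel \<Otimes>\<^sub>M borel)"
    unfolding \<Phi>_def by measurable
  have m2: "(\<lambda>q. \<Phi>' (fst q) (snd q)) \<in> borel_measurable (borel \<Otimes>\<^sub>M borel)"
    unfolding \<Phi>'_def by measurable
  have mX: "(\<lambda>\<omega>. (X h \<omega>, \<lambda>i. X (kk i) \<omega>)) \<in> M \<rightarrow>\<^sub>M borel \<Otimes>\<^sub>M borel"
    by (intro measurable_Pair X_measurable measurable_coordinatewise_then_product)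
  have mT: "(\<lambda>\<omega>. \<Phi>' (X h \<omega>) (\<lambda>i. X (kk i) \<omega>) - X h \<omega> * \<Phi> (X h \<omega>) (\<lambda>i. X (kk i) \<omega>)) \<in> borel_measurable M"
    using measurable_compose[OF mX m1] measurable_compose[OF mX m2]
    by (auto intro!: borel_measurable_diff borel_measurable_times)
  have iT: "integrable M (\<lambda>\<omega>. \<Phi>' (X h \<omega>) (\<lambda>i. X (kk i) \<omega>) - X h \<omega> * \<Phi> (X h \<omega>) (\<lambda>i. X (kk i) \<omega>))"
    using Bochner_Integration.integrable_diff[OF i1 i2] by (subst integrable_cong_AE[OF mT _ AE_eq]) auto
  have "0 = (LINT \<omega>|M. \<Phi>' (X h \<omega>) (\<lambda>i. X (kk i) \<omega>) - X h \<omega> * \<Phi> (X h \<omega>) (\<lambda>i. X (kk i) \<omega>))"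
    by (rule orthogonal_integration_by_parts[OF h orth m1 m2 D C bnd iT, symmetric])
  also have "\<dots> = (LINT \<omega>|M. (G \<omega> \<bullet> h) * poly p (X k \<omega>) - F \<omega> * (poly p (X k \<omega>) * X h \<omega> - (k \<bullet> h) * poly (pderiv p) (X k \<omega>)))"
    using Bochner_Integration.integrable_diff[OF i1 i2] by (intro integral_cong_AE[OF mT _ AE_eq]) auto
  finally show ?thesis using i1 i2 by simp
qed

text \<open>The test variable is fixed and square integrable, so both sides pass to the L2 limits
  that define the derivative. Since the right-hand side involves Z only, the formula also yields
  closability.\<close>

lemma malliavin_integration_by_parts:
  assumes ZU: "has_malliavin_derivative M X Z U" and h: "norm h = 1"
  shows "(LINT \<omega>|M. (U \<omega> \<bullet> h) * poly p (X k \<omega>))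
    = (LINT \<omega>|M. Z \<omega> * (poly p (X k \<omega>) * X h \<omega> - (k \<bullet> h) * poly (pderiv p) (X k \<omega>)))"
proof -
  obtain F G where FG: "\<And>j. smooth_cylindrical X (F j) (G j)" and FZ: "L2_tendsto M F Z" and GU: "L2_tendsto M G U"
    using ZU unfolding has_malliavin_derivative_def by blast
  have pX: "in_L2 M (\<lambda>\<omega>. poly p (X k \<omega>) * X h \<omega>)"
    using poly_X_mult_L2[of p k "[:0, 1:]" h] by simp
  have "in_L2 M (\<lambda>\<omega>. poly p (X k \<omega>) *\<^sub>R h)"
    by (rule in_L2_bound[OF poly_X_L2[of p k]]) (auto simp: h)
  from L2_inner_tendsto[OF GU L2_tendsto_const[OF this]]
  have "(\<lambda>j. LINT \<omega>|M. (G j \<omega> \<bullet> h) * poly p (X k \<omega>)) \<longlonglongrightarrow> (LINT \<omega>|M. (U \<omega> \<bullet> h) * poly p (X k \<omega>))"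
    by (simp add: mult.commute)
  moreover have "(\<lambda>j. LINT \<omega>|M. F j \<omega> * (poly p (X k \<omega>) * X h \<omega> - (k \<bullet> h) * poly (pderiv p) (X k \<omega>)))
    \<longlonglongrightarrow> (LINT \<omega>|M. Z \<omega> * (poly p (X k \<omega>) * X h \<omega> - (k \<bullet> h) * poly (pderiv p) (X k \<omega>)))"
    by (intro L2_mult_tendsto[OF FZ L2_tendsto_const] in_L2_diff pX in_L2_cmult poly_X_L2)
  ultimately show ?thesis
    unfolding smooth_cylindrical_integration_by_parts[OF FG h] by (rule LIMSEQ_unique)
qed

end

section \<open>Smooth cutoffs\<close>

text \<open>The classical flat function exp (-1/x), multiplied by polynomials in 1/x so that the
  family is closed under differentiation.\<close>

definition exp_tail :: "real poly \<Rightarrow> real \<Rightarrow> real" where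
  "exp_tail p x = (if x > 0 then poly p (1 / x) * exp (- (1 / x)) else 0)"

text \<open>With y = 1/x, exponential decay beats every power of y.\<close>

lemma exp_tail_tendsto_0: "(exp_tail p \<longlongrightarrow> 0) (at 0)"
proof -
  have "((\<lambda>y. \<Sum>i\<le>degree p. coeff p i * (y ^ i / exp y)) \<longlongrightarrow> (\<Sum>i\<le>degree p. coeff p i * 0)) at_top"
    by (intro tendsto_intros tendsto_power_div_exp_0)
  then have lim: "((\<lambda>y. poly p y * exp (- y)) \<longlongrightarrow> 0) at_top"
    by (simp add: poly_altdef sum_distrib_right exp_minus divide_inverse mult.assoc)
  have "((\<lambda>x. poly p (inverse x) * exp (- inverse x)) \<longlongrightarrow> 0) (at_right 0)"
    by (rule filterlim_compose[OF lim filterlim_inverse_at_top_right])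
  then have "(exp_tail p \<longlongrightarrow> 0) (at_right 0)"
    by (rule Lim_transform_eventually)
      (auto simp: eventually_at_filter exp_tail_def inverse_eq_divide)
  moreover have "(exp_tail p \<longlongrightarrow> 0) (at_left 0)"
    by (rule Lim_transform_eventually[OF tendsto_const]) (auto simp: eventually_at_filter exp_tail_def)
  ultimately show ?thesis by (simp add: filterlim_split_at)
qed

text \<open>In terms of y = 1/x the derivative is y^2 (p(y) - p'(y)) exp (-y), a member of the same
  family.\<close>

lemma exp_tail_has_derivative:
  "(exp_tail p has_real_derivative exp_tail ([:0, 0, 1:] * (p - pderiv p)) x) (at x)"
proof -
  consider "x > 0" | "x < 0" | "x = 0" by linarith
  then show ?thesis
  proof cases
    case 1
    have "((\<lambda>x. 1 / x) has_real_derivative - (1 / x\<^sup>2)) (at x)"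
      using 1 by (auto intro!: derivative_eq_intros simp: power2_eq_square)
    then have "((\<lambda>x. poly p (1 / x)) has_real_derivative poly (pderiv p) (1 / x) * - (1 / x\<^sup>2)) (at x)"
      by (rule DERIV_chain2[OF poly_DERIV])
    moreover have "((\<lambda>x. exp (- (1 / x))) has_real_derivative exp (- (1 / x)) * (1 / x\<^sup>2)) (at x)"
      using 1 by (auto intro!: derivative_eq_intros simp: power2_eq_square)
    ultimately have "((\<lambda>x. poly p (1 / x) * exp (- (1 / x))) has_real_derivative exp_tail ([:0, 0, 1:] * (p - pderiv p)) x) (at x)"
      by (rule DERIV_mult[THEN DERIV_cong]) (use 1 in \<open>simp add: exp_tail_def power2_eq_square algebra_simps\<close>)
    moreover have "\<forall>\<^sub>F y in nhds x. y \<in> {0<..}" using 1 by (intro eventually_nhds_in_open) auto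
    then have "\<forall>\<^sub>F y in nhds x. exp_tail p y = poly p (1 / y) * exp (- (1 / y))"
      by eventually_elim (simp add: exp_tail_def)
    ultimately show ?thesis by (subst DERIV_cong_ev[OF refl _ refl])
  next
    case 2
    then have "\<forall>\<^sub>F y in nhds x. y \<in> {..<0}" by (intro eventually_nhds_in_open) auto
    then have "\<forall>\<^sub>F y in nhds x. exp_tail p y = 0"
      by eventually_elim (simp add: exp_tail_def)
    then show ?thesis using 2 by (subst DERIV_cong_ev[OF refl _ refl]) (auto simp: exp_tail_def)
  next
    case 3
    \<comment> \<open>To the right of 0 the difference quotient is the member of the family with
      polynomial \<open>[:0, 1:] * p\<close>, and so tends to 0 by flatness.\<close>
    have "((\<lambda>y. (exp_tail p y - exp_tail p 0) / (y - 0)) \<longlongrightarrow> 0) (at 0)"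
      by (rule Lim_transform_eventually[OF exp_tail_tendsto_0[of "[:0, 1:] * p"]])
        (auto simp: eventually_at_filter exp_tail_def)
    then show ?thesis using 3 by (simp add: has_field_derivative_iff exp_tail_def)
  qed
qed

text \<open>The bound 2 comes from y^2 \<le> 2 exp y for y = 1/x.\<close>

lemma exp_tail_bounds: "0 \<le> exp_tail 1 x" "exp_tail 1 x \<le> 1" "\<bar>exp_tail [:0, 0, 1:] x\<bar> \<le> 2"
proof -
  show "0 \<le> exp_tail 1 x" "exp_tail 1 x \<le> 1" by (simp_all add: exp_tail_def)
  show "\<bar>exp_tail [:0, 0, 1:] x\<bar> \<le> 2"
  proof (cases "x > 0")
    case True
    define y where "y = 1 / x"
    have "y\<^sup>2 \<le> 2 * exp y"
    proof -
      have "0 \<le> y" using True by (simp add: y_def)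
      then show ?thesis using exp_lower_Taylor_quadratic[of y] by simp
    qed
    then have "y\<^sup>2 * exp (- y) \<le> 2 * exp y * exp (- y)" by (intro mult_right_mono) auto
    also have "2 * exp y * exp (- y) = 2" by (simp add: mult.assoc exp_add[symmetric])
    finally have "y * y * exp (- y) \<le> 2" by (simp add: power2_eq_square)
    then show ?thesis using True by (simp add: exp_tail_def y_def[symmetric])
  qed (simp add: exp_tail_def)
qed

text \<open>A smooth bump supported in [-1, 1]; \<open>exp 2\<close> cancels the value exp (-1) that
  each factor takes at 0.\<close>

definition cutoff :: "real \<Rightarrow> real" where
  "cutoff x = exp 2 * (exp_tail 1 (1 + x) * exp_tail 1 (1 - x))"

text \<open>\<open>[:0, 0, 1:]\<close> is the polynomial y^2 (p - p') for p = 1.\<close>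

definition cutoff_deriv :: "real \<Rightarrow> real" where
  "cutoff_deriv x = exp 2 * (exp_tail [:0, 0, 1:] (1 + x) * exp_tail 1 (1 - x) - exp_tail 1 (1 + x) * exp_tail [:0, 0, 1:] (1 - x))"

lemma cutoff_has_derivative: "(cutoff has_real_derivative cutoff_deriv x) (at x)"
proof -
  have e: "(exp_tail 1 has_real_derivative exp_tail [:0, 0, 1:] x) (at x)" for x
    using exp_tail_has_derivative[of 1 x] by simp
  have 1: "((\<lambda>x. exp_tail 1 (1 + x)) has_real_derivative exp_tail [:0, 0, 1:] (1 + x) * 1) (at x)"
    by (rule DERIV_chain2[OF e]) (auto intro!: derivative_eq_intros)
  have 2: "((\<lambda>x. exp_tail 1 (1 - x)) has_real_derivative exp_tail [:0, 0, 1:] (1 - x) * (- 1)) (at x)"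
    by (rule DERIV_chain2[OF e]) (auto intro!: derivative_eq_intros)
  show ?thesis
    unfolding cutoff_def[abs_def] cutoff_deriv_def
    by (rule DERIV_cmult[OF DERIV_mult[OF 1 2], THEN DERIV_cong]) (simp add: algebra_simps)
qed

lemma cutoff_bounds: "\<bar>cutoff x\<bar> \<le> exp 2" "\<bar>cutoff_deriv x\<bar> \<le> 4 * exp 2"
proof -
  note b = exp_tail_bounds[of "1 + x"] exp_tail_bounds[of "1 - x"]
  have "\<bar>exp_tail 1 (1 + x) * exp_tail 1 (1 - x)\<bar> \<le> 1 * 1"
    unfolding abs_mult using b by (intro mult_mono) auto
  then show "\<bar>cutoff x\<bar> \<le> exp 2" by (simp add: cutoff_def abs_mult)
  have "\<bar>exp_tail [:0, 0, 1:] (1 + x) * exp_tail 1 (1 - x)\<bar> \<le> 2 * 1"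
    unfolding abs_mult using b by (intro mult_mono) auto
  moreover have "\<bar>exp_tail 1 (1 + x) * exp_tail [:0, 0, 1:] (1 - x)\<bar> \<le> 1 * 2"
    unfolding abs_mult using b by (intro mult_mono) auto
  ultimately have "\<bar>exp_tail [:0, 0, 1:] (1 + x) * exp_tail 1 (1 - x) - exp_tail 1 (1 + x) * exp_tail [:0, 0, 1:] (1 - x)\<bar> \<le> 4"
    by linarith
  then show "\<bar>cutoff_deriv x\<bar> \<le> 4 * exp 2" by (simp add: cutoff_deriv_def abs_mult)
qed

lemma cutoff_0: "cutoff 0 = 1"
proof -
  have "exp 2 * (exp (- 1) * exp (- 1)) = (1 :: real)" by (simp add: exp_add[symmetric])
  then show ?thesis by (simp add: cutoff_def exp_tail_def)
qed

lemma cutoff_support: "cutoff x \<noteq> 0 \<Longrightarrow> \<bar>x\<bar> \<le> 1"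
  by (auto simp: cutoff_def exp_tail_def abs_le_iff split: if_splits)

section \<open>A class of smooth functions\<close>

text \<open>The rules make the class closed under partial derivatives, which yields smoothness.\<close>

inductive smooth_class :: "nat \<Rightarrow> ((nat \<Rightarrow> real) \<Rightarrow> real) \<Rightarrow> bool" for n where
  base: "smooth_on_Rn n f \<Longrightarrow> smooth_class n f"
| const: "smooth_class n (\<lambda>_. c)"
| coord: "i < n \<Longrightarrow> smooth_class n (\<lambda>x. x i)"
| tail: "i < n \<Longrightarrow> smooth_class n (\<lambda>x. exp_tail p (a * x i + b))"
| add: "smooth_class n f \<Longrightarrow> smooth_class n g \<Longrightarrow> smooth_class n (\<lambda>x. f x + g x)"
| mult: "smooth_class n f \<Longrightarrow> smooth_class n g \<Longrightarrow> smooth_class n (\<lambda>x. f x * g x)"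
| sin: "smooth_class n f \<Longrightarrow> smooth_class n (\<lambda>x. sin (f x))"
| cos: "smooth_class n f \<Longrightarrow> smooth_class n (\<lambda>x. cos (f x))"

lemma smooth_on_Rn_pderivative:
  assumes "smooth_on_Rn n f" "i < n"
  shows "smooth_on_Rn n (pderivative i f)"
  unfolding smooth_on_Rn_def
proof (intro conjI allI impI)
  show "fun_on_Rn n (pderivative i f)" using assms smooth_on_RnD(1) fun_on_Rn_pderivative by blast
  fix js :: "nat list" assume "set js \<subseteq> {..<n}"
  then have "set (js @ [i]) \<subseteq> {..<n}" using assms(2) by auto
  from assms(1)[unfolded smooth_on_Rn_def, THEN conjunct2, rule_format, OF this]
  show "continuous_on UNIV (foldr pderivative js (pderivative i f))"
    "\<And>j x. j < n \<Longrightarrow> (\<lambda>t. foldr pderivative js (pderivative i f) (x(j := t))) differentiable at (x j)"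
    by simp_all
qed

text \<open>The partial derivative must belong to the class, not merely exist: only then can the
  statement be iterated.\<close>

lemma smooth_class_properties:
  assumes "smooth_class n f"
  shows "fun_on_Rn n f" "continuous_on UNIV f"
    and "i < n \<Longrightarrow> \<exists>f'. smooth_class n f' \<and> (\<forall>x. ((\<lambda>t. f (x(i := t))) has_real_derivative f' x) (at (x i)))"
proof -
  have "fun_on_Rn n f \<and> continuous_on UNIV f \<and>
    (\<forall>i<n. \<exists>f'. smooth_class n f' \<and> (\<forall>x. ((\<lambda>t. f (x(i := t))) has_real_derivative f' x) (at (x i))))"
    using assms
  proof induction
    case (base f)
    then show ?case using smooth_on_RnD[OF base] smooth_class.base[OF smooth_on_Rn_pderivative[OF base]] by blast
  next
    case (const c)
    have "\<exists>f'. smooth_class n f' \<and> (\<forall>x :: nat \<Rightarrow> real. ((\<lambda>t. c) has_real_derivative f' x) (at (x i)))" for i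
      by (rule exI[of _ "\<lambda>_. 0"]) (auto intro: smooth_class.const)
    then show ?case by (auto simp: fun_on_Rn_def)
  next
    case (coord i)
    have "\<exists>f'. smooth_class n f' \<and> (\<forall>x. ((\<lambda>t. (x(j := t)) i) has_real_derivative f' x) (at (x j)))" for j
      by (rule exI[of _ "\<lambda>_. if j = i then 1 else 0"]) (auto intro: smooth_class.const)
    then show ?case using coord by (auto simp: fun_on_Rn_def)
  next
    case (tail i p a b)
    define q where "q = [:0, 0, 1:] * (p - pderiv p)"
    have c: "continuous_on UNIV (exp_tail p)"
      using exp_tail_has_derivative by (meson DERIV_isCont continuous_at_imp_continuous_on)
    have "\<exists>f'. smooth_class n f' \<and> (\<forall>x. ((\<lambda>t. exp_tail p (a * (x(j := t)) i + b)) has_real_derivative f' x) (at (x j)))" for j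
    proof (cases "j = i")
      case True
      have "((\<lambda>t. exp_tail p (a * t + b)) has_real_derivative a * exp_tail q (a * x i + b)) (at (x i))" for x
        unfolding q_def
        by (rule DERIV_chain2[OF exp_tail_has_derivative, THEN DERIV_cong]) (auto intro!: derivative_eq_intros)
      then show ?thesis
        using True smooth_class.mult[OF smooth_class.const[of n a] smooth_class.tail[OF tail, of q a b]]
        by (intro exI[of _ "\<lambda>x. a * exp_tail q (a * x i + b)"]) simp
    next
      case False
      then show ?thesis by (intro exI[of _ "\<lambda>_. 0"]) (auto intro: smooth_class.const)
    qed
    moreover have "continuous_on UNIV (\<lambda>x. exp_tail p (a * x i + b))"
      by (rule continuous_on_compose2[OF c]) (auto intro!: continuous_intros)
    ultimately show ?case using tail by (auto simp: fun_on_Rn_def)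
  next
    case (add f g)
    have "\<exists>f'. smooth_class n f' \<and> (\<forall>x. ((\<lambda>t. f (x(i := t)) + g (x(i := t))) has_real_derivative f' x) (at (x i)))" if i: "i < n" for i
    proof -
      obtain f' g' where 1: "smooth_class n f'" "smooth_class n g'"
        and 2: "\<And>x. ((\<lambda>t. f (x(i := t))) has_real_derivative f' x) (at (x i))"
          "\<And>x. ((\<lambda>t. g (x(i := t))) has_real_derivative g' x) (at (x i))"
        using add.IH i by blast
      show ?thesis
        by (rule exI[of _ "\<lambda>x. f' x + g' x"]) (auto intro!: smooth_class.add 1 DERIV_add 2)
    qed
    moreover have "fun_on_Rn n (\<lambda>x. f x + g x)" using add.IH unfolding fun_on_Rn_def by metis
    moreover have "continuous_on UNIV (\<lambda>x. f x + g x)" using add.IH by (intro continuous_intros) auto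
    ultimately show ?case by blast
  next
    case (mult f g)
    have "\<exists>f'. smooth_class n f' \<and> (\<forall>x. ((\<lambda>t. f (x(i := t)) * g (x(i := t))) has_real_derivative f' x) (at (x i)))" if i: "i < n" for i
    proof -
      obtain f' g' where 1: "smooth_class n f'" "smooth_class n g'"
        and 2: "\<And>x. ((\<lambda>t. f (x(i := t))) has_real_derivative f' x) (at (x i))"
          "\<And>x. ((\<lambda>t. g (x(i := t))) has_real_derivative g' x) (at (x i))"
        using mult.IH i by blast
      have "((\<lambda>t. f (x(i := t)) * g (x(i := t))) has_real_derivative f' x * g x + g' x * f x) (at (x i))" for x
        using DERIV_mult[OF 2(1)[of x] 2(2)[of x]] by simp
      then show ?thesis
        by (intro exI[of _ "\<lambda>x. f' x * g x + g' x * f x"] conjI smooth_class.add smooth_class.mult 1 mult.hyps) simp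
    qed
    moreover have "fun_on_Rn n (\<lambda>x. f x * g x)" using mult.IH unfolding fun_on_Rn_def by metis
    moreover have "continuous_on UNIV (\<lambda>x. f x * g x)" using mult.IH by (intro continuous_intros) auto
    ultimately show ?case by blast
  next
    case (sin f)
    have "\<exists>f'. smooth_class n f' \<and> (\<forall>x. ((\<lambda>t. sin (f (x(i := t)))) has_real_derivative f' x) (at (x i)))" if i: "i < n" for i
    proof -
      obtain f' where 1: "smooth_class n f'" and 2: "\<And>x. ((\<lambda>t. f (x(i := t))) has_real_derivative f' x) (at (x i))"
        using sin.IH i by blast
      have "((\<lambda>t. sin (f (x(i := t)))) has_real_derivative cos (f x) * f' x) (at (x i))" for x
        using DERIV_chain2[OF DERIV_sin 2[of x]] by simp
      then show ?thesis
        by (intro exI[of _ "\<lambda>x. cos (f x) * f' x"] conjI smooth_class.mult smooth_class.cos 1 sin.hyps) simp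
    qed
    moreover have "fun_on_Rn n (\<lambda>x. sin (f x))" using sin.IH unfolding fun_on_Rn_def by metis
    moreover have "continuous_on UNIV (\<lambda>x. sin (f x))" using sin.IH by (intro continuous_intros) auto
    ultimately show ?case by blast
  next
    case (cos f)
    have "\<exists>f'. smooth_class n f' \<and> (\<forall>x. ((\<lambda>t. cos (f (x(i := t)))) has_real_derivative f' x) (at (x i)))" if i: "i < n" for i
    proof -
      obtain f' where 1: "smooth_class n f'" and 2: "\<And>x. ((\<lambda>t. f (x(i := t))) has_real_derivative f' x) (at (x i))"
        using cos.IH i by blast
      have "((\<lambda>t. cos (f (x(i := t)))) has_real_derivative - 1 * sin (f x) * f' x) (at (x i))" for x
        using DERIV_chain2[OF DERIV_cos 2[of x]] by simp
      then show ?thesis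
        by (intro exI[of _ "\<lambda>x. - 1 * sin (f x) * f' x"] conjI smooth_class.mult smooth_class.sin smooth_class.const 1 cos.hyps) simp
    qed
    moreover have "fun_on_Rn n (\<lambda>x. cos (f x))" using cos.IH unfolding fun_on_Rn_def by metis
    moreover have "continuous_on UNIV (\<lambda>x. cos (f x))" using cos.IH by (intro continuous_intros) auto
    ultimately show ?case by blast
  qed
  then show "fun_on_Rn n f" "continuous_on UNIV f"
    "i < n \<Longrightarrow> \<exists>f'. smooth_class n f' \<and> (\<forall>x. ((\<lambda>t. f (x(i := t))) has_real_derivative f' x) (at (x i)))"
    by auto
qed

text \<open>Uniqueness of derivatives identifies \<open>pderivative i g\<close> with the
  representative found in the class, so all iterated partial derivatives stay in the class.\<close>

lemma smooth_class_imp_smooth: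
  assumes "smooth_class n f"
  shows "smooth_on_Rn n f"
proof -
  have pd: "smooth_class n (pderivative i g)" if g: "smooth_class n g" and i: "i < n" for i g
  proof -
    obtain g' where g': "smooth_class n g'" "\<And>x. ((\<lambda>t. g (x(i := t))) has_real_derivative g' x) (at (x i))"
      using smooth_class_properties(3)[OF g i] by blast
    have "pderivative i g = g'"
      unfolding pderivative_def using g'(2)[THEN DERIV_imp_deriv] by (intro ext)
    then show ?thesis using g'(1) by simp
  qed
  have "smooth_class n (foldr pderivative js f)" if "set js \<subseteq> {..<n}" for js
    using that by (induction js) (auto intro: assms pd)
  then show ?thesis
    unfolding smooth_on_Rn_def
    using smooth_class_properties(1)[OF assms] smooth_class_properties(2,3)
    by (meson real_differentiable_def)
qed

lemma smooth_class_sum: "(\<And>i. i \<in> I \<Longrightarrow> smooth_class n (f i)) \<Longrightarrow> smooth_class n (\<lambda>x. \<Sum>i\<in>I. f i x)"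
  by (induction I rule: infinite_finite_induct) (auto intro: smooth_class.intros)

lemma smooth_class_prod: "(\<And>i. i \<in> I \<Longrightarrow> smooth_class n (f i)) \<Longrightarrow> smooth_class n (\<lambda>x. \<Prod>i\<in>I. f i x)"
  by (induction I rule: infinite_finite_induct) (auto intro: smooth_class.intros)

lemma smooth_class_poly: "i < n \<Longrightarrow> smooth_class n (\<lambda>x. poly p (x i))"
  by (induction p) (simp_all add: smooth_class.intros)

lemma smooth_class_cutoff:
  assumes "i < n"
  shows "smooth_class n (\<lambda>x. cutoff (a * x i))"
  using smooth_class.mult[OF smooth_class.const[of n "exp 2"] smooth_class.mult[OF smooth_class.tail[OF assms, of 1 a 1] smooth_class.tail[OF assms, of 1 "- a" 1]]]
  by (simp add: cutoff_def add.commute)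

section \<open>Malliavin derivatives of polynomial variables\<close>

text \<open>\<open>f 0 = 0\<close> preserves compact support; smoothness of the composition is
  delegated to closure of the class under f.\<close>

lemma smooth_cylindrical_compose:
  assumes FG: "smooth_cylindrical X F G"
    and cls: "\<And>n \<psi>. smooth_class n \<psi> \<Longrightarrow> smooth_class n (\<lambda>x. f (\<psi> x))"
    and d: "\<And>x. (f has_real_derivative f' x) (at x)" and "f 0 = 0"
  shows "smooth_cylindrical X (\<lambda>\<omega>. f (F \<omega>)) (\<lambda>\<omega>. f' (F \<omega>) *\<^sub>R G \<omega>)"
proof -
  obtain n \<psi> \<phi> where n: "1 \<le> n" and s: "smooth_on_Rn n \<psi>" "compact_support_on_Rn n \<psi>"
    and F: "F = (\<lambda>\<omega>. \<psi> (\<lambda>i. X (\<phi> i) \<omega>))"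
    and G: "G = (\<lambda>\<omega>. \<Sum>i<n. pderivative i \<psi> (\<lambda>j. X (\<phi> j) \<omega>) *\<^sub>R \<phi> i)"
    using FG unfolding smooth_cylindrical_def by blast
  have "smooth_on_Rn n (\<lambda>x. f (\<psi> x))"
    by (rule smooth_class_imp_smooth[OF cls[OF smooth_class.base[OF s(1)]]])
  moreover have "compact_support_on_Rn n (\<lambda>x. f (\<psi> x))"
    using s(2) \<open>f 0 = 0\<close> unfolding compact_support_on_Rn_def by metis
  moreover have "pderivative i (\<lambda>x. f (\<psi> x)) x = f' (\<psi> x) * pderivative i \<psi> x" if i: "i < n" for i x
  proof -
    have "((\<lambda>t. f (\<psi> (x(i := t)))) has_real_derivative f' (\<psi> x) * pderivative i \<psi> x) (at (x i))"
      using DERIV_chain2[OF d smooth_on_RnD(3)[OF s(1) i, of x]] by simp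
    then show ?thesis unfolding pderivative_def[of i "\<lambda>x. f (\<psi> x)"] by (rule DERIV_imp_deriv)
  qed
  then have "(\<lambda>\<omega>. f' (F \<omega>) *\<^sub>R G \<omega>) = (\<lambda>\<omega>. \<Sum>i<n. pderivative i (\<lambda>x. f (\<psi> x)) (\<lambda>j. X (\<phi> j) \<omega>) *\<^sub>R \<phi> i)"
    by (simp add: F G scaleR_sum_right)
  ultimately show ?thesis
    unfolding smooth_cylindrical_def using n F by blast
qed

lemma smooth_cylindrical_sin:
  "smooth_cylindrical X F G \<Longrightarrow> smooth_cylindrical X (\<lambda>\<omega>. sin (t * F \<omega>)) (\<lambda>\<omega>. (t * cos (t * F \<omega>)) *\<^sub>R G \<omega>)"
proof (rule smooth_cylindrical_compose[where f = "\<lambda>x. sin (t * x)" and f' = "\<lambda>x. t * cos (t * x)"])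
  show "smooth_class n (\<lambda>x. sin (t * \<psi> x))" if "smooth_class n \<psi>" for n \<psi>
    by (rule smooth_class.sin[OF smooth_class.mult[OF smooth_class.const that]])
qed (auto intro!: derivative_eq_intros)

lemma smooth_cylindrical_cos:
  "smooth_cylindrical X F G \<Longrightarrow> smooth_cylindrical X (\<lambda>\<omega>. cos (t * F \<omega>) - 1) (\<lambda>\<omega>. (- t * sin (t * F \<omega>)) *\<^sub>R G \<omega>)"
proof (rule smooth_cylindrical_compose[where f = "\<lambda>x. cos (t * x) - 1" and f' = "\<lambda>x. - t * sin (t * x)"])
  show "smooth_class n (\<lambda>x. cos (t * \<psi> x) - 1)" if "smooth_class n \<psi>" for n \<psi>
    using smooth_class.add[OF smooth_class.cos[OF smooth_class.mult[OF smooth_class.const[of n t] that]] smooth_class.const[of n "- 1"]]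
    by simp
qed (auto intro!: derivative_eq_intros)

lemma L2_tendsto_close:
  fixes F :: "nat \<Rightarrow> 'a \<Rightarrow> 'b::{real_normed_vector, second_countable_topology}"
  assumes F: "\<And>k. in_L2 M (F k)" and Y: "L2_tendsto M Y y"
    and close: "\<And>k. (LINT \<omega>|M. (norm (F k \<omega> - Y k \<omega>))\<^sup>2) \<le> e k" and e: "e \<longlonglongrightarrow> 0"
  shows "L2_tendsto M F y"
proof -
  have "L2_tendsto M (\<lambda>k \<omega>. F k \<omega> - Y k \<omega>) (\<lambda>_. 0)"
    by (rule L2_tendsto_bound[OF _ _ _ e]) (use F L2_tendstoD(1)[OF Y] close in \<open>auto intro: in_L2_diff\<close>)
  from L2_tendsto_add[OF this Y] show ?thesis by simp
qed

context isonormal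
begin

text \<open>The graph of the derivative is closed: \<open>Y k\<close> and \<open>U k\<close> are
  approximated simultaneously within 1 / (k + 1) in squared norm, which turns a limit of limits into
  a limit of smooth cylindrical variables.\<close>

lemma has_malliavin_derivative_limit:
  assumes YU: "\<And>k. has_malliavin_derivative M X (Y k) (U k)"
    and Y: "L2_tendsto M Y y" and U: "L2_tendsto M U u"
  shows "has_malliavin_derivative M X y u"
proof -
  have "\<exists>F G. smooth_cylindrical X F G \<and> (LINT \<omega>|M. (norm (F \<omega> - Y k \<omega>))\<^sup>2) \<le> 1 / real (Suc k)
      \<and> (LINT \<omega>|M. (norm (G \<omega> - U k \<omega>))\<^sup>2) \<le> 1 / real (Suc k)" for k
  proof -
    obtain F G where FG: "\<And>j. smooth_cylindrical X (F j) (G j)" "L2_tendsto M F (Y k)" "L2_tendsto M G (U k)"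
      using YU[of k] unfolding has_malliavin_derivative_def by blast
    have "\<forall>\<^sub>F j in sequentially. (LINT \<omega>|M. (norm (F j \<omega> - Y k \<omega>))\<^sup>2) < 1 / real (Suc k)"
      by (rule order_tendstoD(2)[OF L2_tendstoD(3)[OF FG(2)]]) simp
    moreover have "\<forall>\<^sub>F j in sequentially. (LINT \<omega>|M. (norm (G j \<omega> - U k \<omega>))\<^sup>2) < 1 / real (Suc k)"
      by (rule order_tendstoD(2)[OF L2_tendstoD(3)[OF FG(3)]]) simp
    ultimately have "\<forall>\<^sub>F j in sequentially. (LINT \<omega>|M. (norm (F j \<omega> - Y k \<omega>))\<^sup>2) < 1 / real (Suc k)
      \<and> (LINT \<omega>|M. (norm (G j \<omega> - U k \<omega>))\<^sup>2) < 1 / real (Suc k)" by (rule eventually_conj)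
    from eventually_happens'[OF sequentially_bot this]
    obtain j where "(LINT \<omega>|M. (norm (F j \<omega> - Y k \<omega>))\<^sup>2) < 1 / real (Suc k)"
      "(LINT \<omega>|M. (norm (G j \<omega> - U k \<omega>))\<^sup>2) < 1 / real (Suc k)" by blast
    then show ?thesis using FG(1)[of j] by (intro exI[of _ "F j"] exI[of _ "G j"] conjI less_imp_le)
  qed
  then have "\<forall>k. \<exists>p. smooth_cylindrical X (fst p) (snd p) \<and> (LINT \<omega>|M. (norm (fst p \<omega> - Y k \<omega>))\<^sup>2) \<le> 1 / real (Suc k)
      \<and> (LINT \<omega>|M. (norm (snd p \<omega> - U k \<omega>))\<^sup>2) \<le> 1 / real (Suc k)"
    unfolding split_paired_Ex fst_conv snd_conv by blast
  from choice[OF this] obtain p where p: "\<forall>k. smooth_cylindrical X (fst (p k)) (snd (p k))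
      \<and> (LINT \<omega>|M. (norm (fst (p k) \<omega> - Y k \<omega>))\<^sup>2) \<le> 1 / real (Suc k)
      \<and> (LINT \<omega>|M. (norm (snd (p k) \<omega> - U k \<omega>))\<^sup>2) \<le> 1 / real (Suc k)" ..
  define F G where "F k = fst (p k)" and "G k = snd (p k)" for k
  have FG: "smooth_cylindrical X (F k) (G k)"
    and c: "(LINT \<omega>|M. (norm (F k \<omega> - Y k \<omega>))\<^sup>2) \<le> 1 / real (Suc k)"
      "(LINT \<omega>|M. (norm (G k \<omega> - U k \<omega>))\<^sup>2) \<le> 1 / real (Suc k)" for k
    using p by (simp_all add: F_def G_def)
  have lim: "(\<lambda>k. 1 / real (Suc k)) \<longlonglongrightarrow> 0"
    using LIMSEQ_inverse_real_of_nat by (simp add: inverse_eq_divide)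
  show ?thesis
    unfolding has_malliavin_derivative_def
    using FG L2_tendsto_close[OF smooth_cylindrical_L2(1)[OF FG] Y c(1) lim]
      L2_tendsto_close[OF smooth_cylindrical_L2(2)[OF FG] U c(2) lim] by blast
qed

text \<open>A sum of compactly supported functions of different coordinates is not compactly supported, so the
  whole sum is multiplied by cutoffs in all coordinates.\<close>

lemma poly_combination_has_malliavin_derivative:
  fixes n :: nat
  assumes n: "1 \<le> n"
  shows "has_malliavin_derivative M X (\<lambda>\<omega>. \<Sum>l<n. poly (p l) (X (\<phi> l) \<omega>))
    (\<lambda>\<omega>. \<Sum>l<n. poly (pderiv (p l)) (X (\<phi> l) \<omega>) *\<^sub>R \<phi> l)"
proof -
  \<comment> \<open>Scaling by 1 / (N + 1) stretches the cutoffs to the box of radius N + 1.\<close>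
  define a where "a N = 1 / real (Suc N)" for N
  have a: "a N > 0" "a N \<le> 1" "a \<longlonglongrightarrow> 0" for N
    using LIMSEQ_inverse_real_of_nat by (simp_all add: a_def[abs_def] inverse_eq_divide)
  define S where "S x = (\<Sum>l<n. poly (p l) (x l))" for x :: "nat \<Rightarrow> real"
  define C where "C N J x = (\<Prod>j\<in>J. cutoff (a N * x j))" for N J and x :: "nat \<Rightarrow> real"
  define \<psi> where "\<psi> N x = S x * C N {..<n} x" for N x
  \<comment> \<open>Product rule in coordinate i: only one cutoff factor depends on it, and
    differentiating that factor brings out \<open>a N\<close>, which sends the extra term to
    0.\<close>
  define D where "D N i x = (poly (pderiv (p i)) (x i) * cutoff (a N * x i) + S x * (a N * cutoff_deriv (a N * x i))) * C N ({..<n} - {i}) x" for N i x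
  have smooth: "smooth_on_Rn n (\<psi> N)" for N
    unfolding \<psi>_def[abs_def] S_def[abs_def] C_def[abs_def]
    by (intro smooth_class_imp_smooth smooth_class.mult smooth_class_sum smooth_class_prod smooth_class_poly smooth_class_cutoff) auto
  have supp: "compact_support_on_Rn n (\<psi> N)" for N
    unfolding compact_support_on_Rn_def
  proof (intro exI[of _ "real (Suc N)"] allI impI)
    fix x i assume "\<psi> N x \<noteq> 0" "i < n"
    then have "cutoff (a N * x i) \<noteq> 0" by (auto simp: \<psi>_def C_def)
    then have "\<bar>a N * x i\<bar> \<le> 1" by (rule cutoff_support)
    then show "\<bar>x i\<bar> \<le> real (Suc N)" by (simp add: a_def abs_mult field_simps)
  qed
  have pd: "pderivative i (\<psi> N) x = D N i x" if i: "i < n" for N i x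
  proof -
    define T where "T = (\<Sum>l\<in>{..<n} - {i}. poly (p l) (x l))"
    have S: "S (x(i := t)) = poly (p i) t + T" for t
    proof -
      have "(\<Sum>l\<in>{..<n} - {i}. poly (p l) ((x(i := t)) l)) = T" unfolding T_def by (intro sum.cong) auto
      then show ?thesis unfolding S_def using i by (subst sum.remove[of _ i]) auto
    qed
    have C: "C N {..<n} (x(i := t)) = cutoff (a N * t) * C N ({..<n} - {i}) x" for t
    proof -
      have "C N ({..<n} - {i}) (x(i := t)) = C N ({..<n} - {i}) x" unfolding C_def by (intro prod.cong) auto
      then show ?thesis unfolding C_def using i by (subst prod.remove[of _ i]) auto
    qed
    have eq: "(\<lambda>t. \<psi> N (x(i := t))) = (\<lambda>t. ((poly (p i) t + T) * cutoff (a N * t)) * C N ({..<n} - {i}) x)"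
      by (simp add: \<psi>_def S C mult.assoc)
    have 1: "((\<lambda>t. cutoff (a N * t)) has_real_derivative cutoff_deriv (a N * t) * a N) (at t)" for t
      by (rule DERIV_chain2[OF cutoff_has_derivative]) (auto intro!: derivative_eq_intros)
    have 2: "((\<lambda>t. poly (p i) t + T) has_real_derivative poly (pderiv (p i)) t) (at t)" for t
      by (auto intro!: derivative_eq_intros poly_DERIV)
    have "((\<lambda>t. \<psi> N (x(i := t))) has_real_derivative D N i x) (at (x i))"
      unfolding eq using S[of "x i"]
      by (intro DERIV_cmult_right[OF DERIV_mult[OF 2 1], THEN DERIV_cong]) (simp add: D_def algebra_simps)
    then show ?thesis unfolding pderivative_def by (rule DERIV_imp_deriv)
  qed
  define E where "E = exp (2::real)"
  have E: "E \<ge> 1" by (simp add: E_def)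
  have cb: "\<bar>cutoff x\<bar> \<le> E" "\<bar>cutoff_deriv x\<bar> \<le> 4 * E" for x using cutoff_bounds by (auto simp: E_def)
  have Cb: "\<bar>C N J x\<bar> \<le> E ^ card J" if "finite J" for N J x
    unfolding C_def abs_prod using cb prod_mono[of J "\<lambda>j. \<bar>cutoff (a N * x j)\<bar>" "\<lambda>_. E"] by simp
  have cut_lim: "(\<lambda>N. cutoff (a N * r)) \<longlonglongrightarrow> 1" for r
  proof -
    have "isCont cutoff 0" using cutoff_has_derivative DERIV_isCont by blast
    moreover have "(\<lambda>N. a N * r) \<longlonglongrightarrow> 0" using tendsto_mult_right[OF a(3), of r] by simp
    ultimately show ?thesis using isCont_tendsto_compose[of 0 cutoff "\<lambda>N. a N * r"] by (simp add: cutoff_0)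
  qed
  have C_lim: "(\<lambda>N. C N J x) \<longlonglongrightarrow> 1" for J x
    using tendsto_prod[of J "\<lambda>j N. cutoff (a N * x j)" "\<lambda>_. 1" sequentially, OF cut_lim] by (simp add: C_def)
  have \<psi>_lim: "(\<lambda>N. \<psi> N x) \<longlonglongrightarrow> S x" for x
    using tendsto_mult_left[OF C_lim, of "S x"] by (simp add: \<psi>_def)
  have D_lim: "(\<lambda>N. D N i x) \<longlonglongrightarrow> poly (pderiv (p i)) (x i)" for i x
  proof -
    have "(\<lambda>N. a N * cutoff_deriv (a N * x i)) \<longlonglongrightarrow> 0"
    proof (rule Lim_null_comparison)
      show "\<forall>\<^sub>F N in sequentially. norm (a N * cutoff_deriv (a N * x i)) \<le> a N * (4 * E)"
        using cb a(1) by (intro always_eventually allI) (simp add: abs_mult abs_of_pos mult_left_mono less_imp_le)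
      show "(\<lambda>N. a N * (4 * E)) \<longlonglongrightarrow> 0" using tendsto_mult_right[OF a(3), of "4 * E"] by simp
    qed
    then have "(\<lambda>N. D N i x) \<longlonglongrightarrow> (poly (pderiv (p i)) (x i) * 1 + S x * 0) * 1"
      unfolding D_def by (intro tendsto_intros cut_lim C_lim)
    then show ?thesis by simp
  qed
  define Xs where "Xs \<omega> i = X (\<phi> i) \<omega>" for \<omega> i
  have SL2: "in_L2 M (\<lambda>\<omega>. S (Xs \<omega>))"
    unfolding S_def Xs_def by (intro in_L2_sum poly_X_L2)
  have absL2: "in_L2 M (\<lambda>\<omega>. \<bar>f \<omega>\<bar>)" if "in_L2 M f" for f :: "'a \<Rightarrow> real"
    by (rule in_L2_bound[OF that]) (use that in \<open>auto dest: in_L2_measurable\<close>)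
  note sc = smooth_on_RnD[OF smooth]
  have L: "L2_tendsto M (\<lambda>N \<omega>. \<psi> N (Xs \<omega>)) (\<lambda>\<omega>. S (Xs \<omega>))"
  proof (rule L2_tendsto_dominated)
    show "(\<lambda>\<omega>. \<psi> N (Xs \<omega>)) \<in> borel_measurable M" for N
      unfolding Xs_def by (rule cylindrical_measurable[OF sc(2)])
    show "in_L2 M (\<lambda>\<omega>. E ^ n * \<bar>S (Xs \<omega>)\<bar>)" by (intro in_L2_cmult absL2 SL2)
    show "AE \<omega> in M. norm (\<psi> N (Xs \<omega>)) \<le> E ^ n * \<bar>S (Xs \<omega>)\<bar>" for N
    proof (rule AE_I2)
      fix \<omega>
      show "norm (\<psi> N (Xs \<omega>)) \<le> E ^ n * \<bar>S (Xs \<omega>)\<bar>"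
      proof -
        have "\<bar>C N {..<n} (Xs \<omega>)\<bar> \<le> E ^ n" using Cb[of "{..<n}"] by simp
        then have "\<bar>C N {..<n} (Xs \<omega>)\<bar> * \<bar>S (Xs \<omega>)\<bar> \<le> E ^ n * \<bar>S (Xs \<omega>)\<bar>"
          by (rule mult_right_mono) simp
        then show ?thesis by (simp add: \<psi>_def abs_mult mult.commute)
      qed
    qed
  qed (use \<psi>_lim SL2 in \<open>auto dest: in_L2_measurable\<close>)
  have LD: "L2_tendsto M (\<lambda>N \<omega>. D N i (Xs \<omega>) *\<^sub>R \<phi> i) (\<lambda>\<omega>. poly (pderiv (p i)) (X (\<phi> i) \<omega>) *\<^sub>R \<phi> i)"
    if i: "i < n" for i
  proof (rule L2_tendsto_dominated)
    have "(\<lambda>\<omega>. D N i (Xs \<omega>)) \<in> borel_measurable M" for N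
      using cylindrical_measurable[OF sc(4)[OF i, of N], of \<phi>] by (simp add: pd[OF i] Xs_def[abs_def])
    then show "(\<lambda>\<omega>. D N i (Xs \<omega>) *\<^sub>R \<phi> i) \<in> borel_measurable M" for N by simp
    \<comment> \<open>A majorant independent of N: the other n - 1 cutoffs contribute at most
      \<open>E ^ (n - 1)\<close>, and \<open>a N\<close> is at most 1.\<close>
    define w where "w \<omega> = E * E ^ (n - 1) * norm (\<phi> i) * \<bar>poly (pderiv (p i)) (X (\<phi> i) \<omega>)\<bar>
        + 4 * E * E ^ (n - 1) * norm (\<phi> i) * \<bar>S (Xs \<omega>)\<bar>" for \<omega>
    show "in_L2 M w" unfolding w_def by (intro in_L2_add in_L2_cmult absL2 SL2 poly_X_L2)
    show "AE \<omega> in M. norm (D N i (Xs \<omega>) *\<^sub>R \<phi> i) \<le> w \<omega>" for N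
    proof (rule AE_I2)
      fix \<omega>
      have card: "card ({..<n} - {i}) = n - 1" using i by simp
      define P where "P = \<bar>poly (pderiv (p i)) (X (\<phi> i) \<omega>)\<bar>"
      have 1: "\<bar>poly (pderiv (p i)) (Xs \<omega> i) * cutoff (a N * Xs \<omega> i)\<bar> \<le> P * E"
        unfolding abs_mult P_def Xs_def using cb by (intro mult_left_mono) auto
      have "\<bar>a N * cutoff_deriv (a N * Xs \<omega> i)\<bar> \<le> 1 * (4 * E)"
        unfolding abs_mult using cb a(1)[of N] a(2)[of N] by (intro mult_mono) auto
      then have 2: "\<bar>S (Xs \<omega>) * (a N * cutoff_deriv (a N * Xs \<omega> i))\<bar> \<le> \<bar>S (Xs \<omega>)\<bar> * (4 * E)"
        unfolding abs_mult[of "S (Xs \<omega>)"] by (intro mult_left_mono) auto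
      have "\<bar>D N i (Xs \<omega>)\<bar> \<le> (P * E + \<bar>S (Xs \<omega>)\<bar> * (4 * E)) * E ^ (n - 1)"
        unfolding D_def abs_mult[of _ "C N ({..<n} - {i}) (Xs \<omega>)"]
        using Cb[of "{..<n} - {i}"] E
        by (intro mult_mono order_trans[OF abs_triangle_ineq add_mono[OF 1 2]]) (auto simp: card P_def)
      then have "\<bar>D N i (Xs \<omega>)\<bar> * norm (\<phi> i) \<le> (P * E + \<bar>S (Xs \<omega>)\<bar> * (4 * E)) * E ^ (n - 1) * norm (\<phi> i)"
        by (rule mult_right_mono) simp
      then show "norm (D N i (Xs \<omega>) *\<^sub>R \<phi> i) \<le> w \<omega>" by (simp add: w_def P_def algebra_simps)
    qed
    show "AE \<omega> in M. (\<lambda>N. D N i (Xs \<omega>) *\<^sub>R \<phi> i) \<longlonglongrightarrow> poly (pderiv (p i)) (X (\<phi> i) \<omega>) *\<^sub>R \<phi> i"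
    proof (rule AE_I2)
      fix \<omega>
      show "(\<lambda>N. D N i (Xs \<omega>) *\<^sub>R \<phi> i) \<longlonglongrightarrow> poly (pderiv (p i)) (X (\<phi> i) \<omega>) *\<^sub>R \<phi> i"
        using tendsto_scaleR[OF D_lim[of i "Xs \<omega>"] tendsto_const[of "\<phi> i"]] by (simp only: Xs_def)
    qed
  qed measurable
  have cyl: "smooth_cylindrical X (\<lambda>\<omega>. \<psi> N (Xs \<omega>)) (\<lambda>\<omega>. \<Sum>i<n. D N i (Xs \<omega>) *\<^sub>R \<phi> i)" for N
    unfolding smooth_cylindrical_def
    by (intro exI[of _ n] exI[of _ "\<psi> N"] exI[of _ \<phi>] conjI n smooth supp) (simp_all add: pd Xs_def[abs_def])
  show ?thesis
    unfolding has_malliavin_derivative_def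
  proof (intro exI conjI allI)
    show "smooth_cylindrical X (\<lambda>\<omega>. \<psi> N (Xs \<omega>)) (\<lambda>\<omega>. \<Sum>i<n. D N i (Xs \<omega>) *\<^sub>R \<phi> i)" for N by (rule cyl)
    show "L2_tendsto M (\<lambda>N \<omega>. \<psi> N (Xs \<omega>)) (\<lambda>\<omega>. \<Sum>l<n. poly (p l) (X (\<phi> l) \<omega>))"
      using L by (simp add: S_def Xs_def)
    show "L2_tendsto M (\<lambda>N \<omega>. \<Sum>i<n. D N i (Xs \<omega>) *\<^sub>R \<phi> i) (\<lambda>\<omega>. \<Sum>l<n. poly (pderiv (p l)) (X (\<phi> l) \<omega>) *\<^sub>R \<phi> l)"
      by (intro L2_tendsto_sum LD) simp
  qed
qed

end

section \<open>Hermite polynomials and the Wiener chaos\<close>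

text \<open>The Hermite polynomials as objects of type \<open>real poly\<close>, to which
  \<open>pderiv\<close> and the integration by parts formula apply.\<close>

fun hermite_poly :: "nat \<Rightarrow> real poly" where
  "hermite_poly 0 = 1"
| "hermite_poly (Suc 0) = [:0, 1:]"
| "hermite_poly (Suc (Suc m)) = [:0, 1:] * hermite_poly (Suc m) - smult (real (Suc m)) (hermite_poly m)"

lemma poly_hermite_poly: "poly (hermite_poly m) x = hermite m x"
  by (induction m rule: hermite_poly.induct) auto

lemma pderiv_hermite_poly: "pderiv (hermite_poly (Suc m)) = smult (real (Suc m)) (hermite_poly m)"
proof (induction m rule: less_induct)
  case (less m)
  show ?case
  proof (cases m)
    case 0
    then show ?thesis by (simp add: pderiv_pCons)
  next
    case (Suc j)
    have IH1: "pderiv (hermite_poly (Suc j)) = smult (real (Suc j)) (hermite_poly j)"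
      using less[of j] Suc by simp
    \<comment> \<open>Up to the common factor this is H_j' = x H_j - H_(j+1); for j = 0 both sides
      vanish.\<close>
    have IH0: "smult (real (Suc j)) (pderiv (hermite_poly j)) = smult (real (Suc j)) ([:0, 1:] * hermite_poly j - hermite_poly (Suc j))"
    proof (cases j)
      case (Suc i)
      then show ?thesis using less[of i] \<open>m = Suc j\<close> by simp
    qed simp
    have "pderiv (hermite_poly (Suc m)) = hermite_poly (Suc j) + [:0, 1:] * pderiv (hermite_poly (Suc j)) - smult (real (Suc j)) (pderiv (hermite_poly j))"
      by (simp add: Suc pderiv_diff pderiv_mult pderiv_smult pderiv_pCons del: hermite_poly.simps(2))
    also have "\<dots> = hermite_poly (Suc j) + smult (real (Suc j)) (hermite_poly (Suc j))"
      unfolding IH1 IH0 by (simp add: smult_diff_right)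
    also have "\<dots> = smult (real (Suc m)) (hermite_poly m)"
      by (intro poly_eqI) (simp add: Suc algebra_simps del: hermite_poly.simps)
    finally show ?thesis .
  qed
qed

text \<open>Passing from p to x p - p' is the adjoint of differentiation for the Gaussian weight. It
  raises the Hermite degree by one, so integration by parts against H_m (X h) in the unit direction
  h yields H_(m+1) (X h).\<close>

lemma hermite_poly_Suc: "hermite_poly (Suc m) = [:0, 1:] * hermite_poly m - pderiv (hermite_poly m)"
proof (cases m)
  case (Suc j)
  then show ?thesis by (simp only: hermite_poly.simps(3) pderiv_hermite_poly)
qed simp

lemma L2_norm_orthogonal_sum:
  fixes V :: "'i \<Rightarrow> 'a \<Rightarrow> 'b::{real_inner, second_countable_topology}"
  assumes "finite I" and V: "\<And>m. in_L2 M (V m)"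
    and orth: "\<And>m l. m \<noteq> l \<Longrightarrow> (LINT \<omega>|M. V m \<omega> \<bullet> V l \<omega>) = 0"
  shows "(LINT \<omega>|M. (norm (\<Sum>m\<in>I. V m \<omega>))\<^sup>2) = (\<Sum>m\<in>I. (LINT \<omega>|M. (norm (V m \<omega>))\<^sup>2))"
  using \<open>finite I\<close>
proof (induction I)
  case (insert x I)
  have "(LINT \<omega>|M. V x \<omega> \<bullet> (\<Sum>m\<in>I. V m \<omega>)) = (\<Sum>m\<in>I. (LINT \<omega>|M. V x \<omega> \<bullet> V m \<omega>))"
    unfolding inner_sum_right by (intro Bochner_Integration.integral_sum integrable_L2_inner V)
  also have "\<dots> = 0" using insert.hyps by (intro sum.neutral ballI orth) auto
  finally have 0: "(LINT \<omega>|M. V x \<omega> \<bullet> (\<Sum>m\<in>I. V m \<omega>)) = 0" .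
  show ?case
    using L2_norm_add[OF V[of x] in_L2_sum[of I M V, OF V], of 1] 0 insert by simp
qed simp

text \<open>Pythagoras turns the Cauchy condition in L2 for the partial sums into the scalar one for
  the squared norms.\<close>

lemma L2_orthogonal_series:
  fixes V :: "nat \<Rightarrow> 'a \<Rightarrow> 'b::{real_inner, banach, second_countable_topology}"
  assumes "finite_measure M" and V: "\<And>m. in_L2 M (V m)"
    and orth: "\<And>m l. m \<noteq> l \<Longrightarrow> (LINT \<omega>|M. V m \<omega> \<bullet> V l \<omega>) = 0"
    and sm: "summable (\<lambda>m. LINT \<omega>|M. (norm (V m \<omega>))\<^sup>2)"
  shows "\<exists>v. L2_tendsto M (\<lambda>N \<omega>. \<Sum>m<N. V m \<omega>) v"
proof -
  interpret finite_measure M by fact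
  define e where "e m = (LINT \<omega>|M. (norm (V m \<omega>))\<^sup>2)" for m
  have sq: "(LINT \<omega>|M. (norm (\<Sum>m\<in>I. V m \<omega>))\<^sup>2) = (\<Sum>m\<in>I. e m)" if "finite I" for I
    unfolding e_def by (rule L2_norm_orthogonal_sum[OF that V orth])
  \<comment> \<open>At least one of the two index intervals is empty; their union covers both orders
    of a and b.\<close>
  have diff: "(LINT \<omega>|M. (norm ((\<Sum>m<a. V m \<omega>) - (\<Sum>m<b. V m \<omega>)))\<^sup>2) = (\<Sum>m\<in>{a..<b} \<union> {b..<a}. e m)" for a b
  proof -
    have "(\<Sum>m<a. V m \<omega>) - (\<Sum>m<b. V m \<omega>) = (\<Sum>m\<in>{b..<a}. V m \<omega>) - (\<Sum>m\<in>{a..<b}. V m \<omega>)" for \<omega>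
    proof (cases "a \<le> b")
      case True
      then have "(\<Sum>m<b. V m \<omega>) = (\<Sum>m<a. V m \<omega>) + (\<Sum>m\<in>{a..<b}. V m \<omega>)"
        using sum.atLeastLessThan_concat[of 0 a b "\<lambda>m. V m \<omega>"] by (simp add: atLeast0LessThan)
      then show ?thesis using True by simp
    next
      case False
      then have "(\<Sum>m<a. V m \<omega>) = (\<Sum>m<b. V m \<omega>) + (\<Sum>m\<in>{b..<a}. V m \<omega>)"
        using sum.atLeastLessThan_concat[of 0 b a "\<lambda>m. V m \<omega>"] by (simp add: atLeast0LessThan)
      then show ?thesis using False by simp
    qed
    then have "norm ((\<Sum>m<a. V m \<omega>) - (\<Sum>m<b. V m \<omega>)) = norm (\<Sum>m\<in>{a..<b} \<union> {b..<a}. V m \<omega>)" for \<omega>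
      by (cases "a \<le> b") (simp_all add: norm_minus_commute)
    then show ?thesis using sq[of "{a..<b} \<union> {b..<a}"] by simp
  qed
  have e0: "e m \<ge> 0" for m by (simp add: e_def)
  show ?thesis
  proof (rule L2_complete)
    fix \<epsilon> :: real assume \<epsilon>: "\<epsilon> > 0"
    obtain N where N: "\<And>a b. N \<le> a \<Longrightarrow> norm (sum e {a..<b}) < \<epsilon>"
      using sm \<epsilon> unfolding summable_Cauchy e_def by blast
    have "(\<Sum>m\<in>{a..<b} \<union> {b..<a}. e m) < \<epsilon>" if "N \<le> a" "N \<le> b" for a b
      using N[of a b] N[of b a] that e0 by (cases "a \<le> b") (auto simp: sum_nonneg)
    then show "\<exists>N. \<forall>a\<ge>N. \<forall>b\<ge>N. (LINT \<omega>|M. (norm ((\<Sum>m<a. V m \<omega>) - (\<Sum>m<b. V m \<omega>)))\<^sup>2) < \<epsilon>"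
      unfolding diff by blast
  qed (intro in_L2_sum V)
qed

lemma sum_lessThan_add: "(\<Sum>i<n + k. f i) = (\<Sum>i<n. f i) + (\<Sum>i<k. f (n + i :: nat))"
  for f :: "nat \<Rightarrow> 'b::comm_monoid_add"
  by (induction k) (auto simp: add.assoc)

section \<open>Chaos variables paired with their derivatives\<close>

context isonormal
begin

definition poly_sum :: "('a \<Rightarrow> real) \<Rightarrow> ('a \<Rightarrow> 'h) \<Rightarrow> bool" where
  "poly_sum P D \<longleftrightarrow> (\<exists>(n::nat) p h. P = (\<lambda>\<omega>. \<Sum>i<n. poly (p i) (X (h i) \<omega>)) \<and>
     D = (\<lambda>\<omega>. \<Sum>i<n. poly (pderiv (p i)) (X (h i) \<omega>) *\<^sub>R h i))"

text \<open>Limits of polynomial sums rather than of smooth cylindrical variables: polynomial sums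
  add by concatenation, while a sum of compactly supported functions of different coordinates loses
  compact support.\<close>

definition poly_limit :: "('a \<Rightarrow> real) \<Rightarrow> ('a \<Rightarrow> 'h) \<Rightarrow> bool" where
  "poly_limit Y U \<longleftrightarrow> (\<exists>P D. (\<forall>k. poly_sum (P k) (D k)) \<and> L2_tendsto M P Y \<and> L2_tendsto M D U)"

text \<open>For m = 0 the truncated \<open>m - 1\<close> is harmless, because the factor
  \<open>real m\<close> vanishes.\<close>

definition hermite_sum :: "nat \<Rightarrow> ('a \<Rightarrow> real) \<Rightarrow> ('a \<Rightarrow> 'h) \<Rightarrow> bool" where
  "hermite_sum m P D \<longleftrightarrow> (\<exists>(n::nat) c h. (\<forall>i<n. norm (h i) = 1) \<and> P = (\<lambda>\<omega>. \<Sum>i<n. c i * hermite m (X (h i) \<omega>)) \<and>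
     D = (\<lambda>\<omega>. \<Sum>i<n. (c i * (real m * hermite (m - 1) (X (h i) \<omega>))) *\<^sub>R h i))"

text \<open>\<open>U\<close> is a derivative of \<open>Y\<close>, and \<open>- L Y = m Y\<close> in weak form.\<close>

definition chaos_pair :: "nat \<Rightarrow> ('a \<Rightarrow> real) \<Rightarrow> ('a \<Rightarrow> 'h) \<Rightarrow> bool" where
  "chaos_pair m Y U \<longleftrightarrow> poly_limit Y U \<and>
     (\<forall>F G. has_malliavin_derivative M X F G \<longrightarrow> (LINT \<omega>|M. G \<omega> \<bullet> U \<omega>) = real m * (LINT \<omega>|M. F \<omega> * Y \<omega>))"

lemma poly_sum_has_malliavin_derivative:
  assumes "poly_sum P D"
  shows "has_malliavin_derivative M X P D"
proof -
  obtain n :: nat and p h where P: "P = (\<lambda>\<omega>. \<Sum>i<n. poly (p i) (X (h i) \<omega>))"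
    and D: "D = (\<lambda>\<omega>. \<Sum>i<n. poly (pderiv (p i)) (X (h i) \<omega>) *\<^sub>R h i)"
    using assms unfolding poly_sum_def by blast
  show ?thesis
  proof (cases "n = 0")
    case True
    then show ?thesis
      using poly_combination_has_malliavin_derivative[of 1 "\<lambda>_. 0" "\<lambda>_. 0"] by (simp add: P D)
  next
    case False
    then show ?thesis unfolding P D by (intro poly_combination_has_malliavin_derivative) simp
  qed
qed

lemma poly_sum_linear:
  assumes "poly_sum P D" "poly_sum Q E"
  shows "poly_sum (\<lambda>\<omega>. P \<omega> + t * Q \<omega>) (\<lambda>\<omega>. D \<omega> + t *\<^sub>R E \<omega>)"
proof -
  obtain n :: nat and p h where P: "P = (\<lambda>\<omega>. \<Sum>i<n. poly (p i) (X (h i) \<omega>))"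
    and D: "D = (\<lambda>\<omega>. \<Sum>i<n. poly (pderiv (p i)) (X (h i) \<omega>) *\<^sub>R h i)"
    using assms(1) unfolding poly_sum_def by blast
  obtain n' :: nat and p' h' where Q: "Q = (\<lambda>\<omega>. \<Sum>i<n'. poly (p' i) (X (h' i) \<omega>))"
    and E: "E = (\<lambda>\<omega>. \<Sum>i<n'. poly (pderiv (p' i)) (X (h' i) \<omega>) *\<^sub>R h' i)"
    using assms(2) unfolding poly_sum_def by blast
  show ?thesis
    unfolding poly_sum_def
    by (rule exI[of _ "n + n'"], rule exI[of _ "\<lambda>i. if i < n then p i else smult t (p' (i - n))"],
        rule exI[of _ "\<lambda>i. if i < n then h i else h' (i - n)"])
      (simp add: P Q D E sum_lessThan_add sum_distrib_left scaleR_sum_right pderiv_smult)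
qed

lemma hermite_sum_linear:
  assumes "hermite_sum m P D" "hermite_sum m Q E"
  shows "hermite_sum m (\<lambda>\<omega>. P \<omega> + t * Q \<omega>) (\<lambda>\<omega>. D \<omega> + t *\<^sub>R E \<omega>)"
proof -
  obtain n :: nat and c h where h: "\<forall>i<n. norm (h i) = 1" and P: "P = (\<lambda>\<omega>. \<Sum>i<n. c i * hermite m (X (h i) \<omega>))"
    and D: "D = (\<lambda>\<omega>. \<Sum>i<n. (c i * (real m * hermite (m - 1) (X (h i) \<omega>))) *\<^sub>R h i)"
    using assms(1) unfolding hermite_sum_def by blast
  obtain n' :: nat and c' h' where h': "\<forall>i<n'. norm (h' i) = 1" and Q: "Q = (\<lambda>\<omega>. \<Sum>i<n'. c' i * hermite m (X (h' i) \<omega>))"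
    and E: "E = (\<lambda>\<omega>. \<Sum>i<n'. (c' i * (real m * hermite (m - 1) (X (h' i) \<omega>))) *\<^sub>R h' i)"
    using assms(2) unfolding hermite_sum_def by blast
  show ?thesis
    unfolding hermite_sum_def
    by (rule exI[of _ "n + n'"], rule exI[of _ "\<lambda>i. if i < n then c i else t * c' (i - n)"],
        rule exI[of _ "\<lambda>i. if i < n then h i else h' (i - n)"])
      (use h h' in \<open>simp add: P Q D E sum_lessThan_add sum_distrib_left scaleR_sum_right mult.assoc\<close>)
qed

lemma hermite_sum_zero: "hermite_sum m (\<lambda>_. 0) (\<lambda>_. 0)"
  unfolding hermite_sum_def by (rule exI[of _ 0]) simp

lemma hermite_sum_imp_poly_sum:
  assumes "hermite_sum m P D" "1 \<le> m"
  shows "poly_sum P D"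
proof -
  obtain j where j: "m = Suc j" using assms(2) by (cases m) auto
  show ?thesis
    using assms(1) unfolding hermite_sum_def poly_sum_def j
  proof (elim exE conjE)
    fix n :: nat and c and h :: "nat \<Rightarrow> 'h"
    assume "P = (\<lambda>\<omega>. \<Sum>i<n. c i * hermite (Suc j) (X (h i) \<omega>))"
      "D = (\<lambda>\<omega>. \<Sum>i<n. (c i * (real (Suc j) * hermite (Suc j - 1) (X (h i) \<omega>))) *\<^sub>R h i)"
    then show "\<exists>(n::nat) p h. P = (\<lambda>\<omega>. \<Sum>i<n. poly (p i) (X (h i) \<omega>)) \<and> D = (\<lambda>\<omega>. \<Sum>i<n. poly (pderiv (p i)) (X (h i) \<omega>) *\<^sub>R h i)"
      by (intro exI[of _ n] exI[of _ "\<lambda>i. smult (c i) (hermite_poly (Suc j))"] exI[of _ h])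
        (simp add: pderiv_smult pderiv_hermite_poly poly_hermite_poly mult.assoc del: hermite_poly.simps)
  qed
qed

lemma poly_limit_has_malliavin_derivative:
  "poly_limit Y U \<Longrightarrow> has_malliavin_derivative M X Y U"
  unfolding poly_limit_def
  using has_malliavin_derivative_limit poly_sum_has_malliavin_derivative by blast

lemma has_malliavin_derivative_L2:
  assumes "has_malliavin_derivative M X F G"
  shows "in_L2 M F" "in_L2 M G"
  using assms unfolding has_malliavin_derivative_def by (auto dest: L2_tendstoD)

lemma poly_limit_linear:
  assumes "poly_limit Y U" "poly_limit Z V"
  shows "poly_limit (\<lambda>\<omega>. Y \<omega> + t * Z \<omega>) (\<lambda>\<omega>. U \<omega> + t *\<^sub>R V \<omega>)"
proof -
  obtain P D where 1: "\<And>k. poly_sum (P k) (D k)" "L2_tendsto M P Y" "L2_tendsto M D U"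
    using assms(1) unfolding poly_limit_def by blast
  obtain Q E where 2: "\<And>k. poly_sum (Q k) (E k)" "L2_tendsto M Q Z" "L2_tendsto M E V"
    using assms(2) unfolding poly_limit_def by blast
  have "L2_tendsto M (\<lambda>k \<omega>. P k \<omega> + t * Q k \<omega>) (\<lambda>\<omega>. Y \<omega> + t * Z \<omega>)"
    using L2_tendsto_add[OF 1(2) L2_tendsto_scaleR[OF 2(2), of t]] by simp
  moreover have "L2_tendsto M (\<lambda>k \<omega>. D k \<omega> + t *\<^sub>R E k \<omega>) (\<lambda>\<omega>. U \<omega> + t *\<^sub>R V \<omega>)"
    by (rule L2_tendsto_add[OF 1(3) L2_tendsto_scaleR[OF 2(3)]])
  ultimately show ?thesis
    unfolding poly_limit_def
    by (intro exI[of _ "\<lambda>k \<omega>. P k \<omega> + t * Q k \<omega>"] exI[of _ "\<lambda>k \<omega>. D k \<omega> + t *\<^sub>R E k \<omega>"])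
      (auto intro: poly_sum_linear 1 2)
qed

lemma poly_limit_zero: "poly_limit (\<lambda>_. 0) (\<lambda>_. 0)"
  unfolding poly_limit_def poly_sum_def
  by (intro exI[of _ "\<lambda>_ _. 0"] conjI allI exI[of _ 0] L2_tendsto_const) auto

lemma poly_limit_sum:
  assumes "\<And>m. m \<in> I \<Longrightarrow> poly_limit (Y m) (U m)"
  shows "poly_limit (\<lambda>\<omega>. \<Sum>m\<in>I. t m * Y m \<omega>) (\<lambda>\<omega>. \<Sum>m\<in>I. t m *\<^sub>R U m \<omega>)"
  using assms
proof (induction I rule: infinite_finite_induct)
  case (insert x I)
  then show ?case
    using poly_limit_linear[OF insert.IH, of "Y x" "U x" "t x"] by (simp add: add.commute)
qed (auto intro: poly_limit_zero)

text \<open>Integration by parts in a unit direction v against H_(m-1) (X v) gives E[F H_m (X v)],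
  since x H_(m-1) - H_(m-1)' = H_m. The derivative of H_m supplies the factor m.\<close>

lemma hermite_sum_malliavin:
  assumes FG: "has_malliavin_derivative M X F G" and PD: "hermite_sum m P D" and m: "1 \<le> m"
  shows "(LINT \<omega>|M. G \<omega> \<bullet> D \<omega>) = real m * (LINT \<omega>|M. F \<omega> * P \<omega>)"
proof -
  obtain j where j: "m = Suc j" using m by (cases m) auto
  obtain n :: nat and c h where h: "\<forall>i<n. norm (h i) = 1" and P: "P = (\<lambda>\<omega>. \<Sum>i<n. c i * hermite m (X (h i) \<omega>))"
    and D: "D = (\<lambda>\<omega>. \<Sum>i<n. (c i * (real m * hermite (m - 1) (X (h i) \<omega>))) *\<^sub>R h i)"
    using PD unfolding hermite_sum_def by blast
  note FG2 = has_malliavin_derivative_L2[OF FG]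
  have HL2: "in_L2 M (\<lambda>\<omega>. hermite k (X v \<omega>))" for k v
    using poly_X_L2[of "hermite_poly k" v] by (simp add: poly_hermite_poly)
  have vL2: "in_L2 M (\<lambda>\<omega>. hermite k (X v \<omega>) *\<^sub>R v)" if "norm v = 1" for k v
    by (rule in_L2_bound[OF HL2[of k v]]) (use HL2 that in \<open>auto dest: in_L2_measurable\<close>)
  have step: "(LINT \<omega>|M. G \<omega> \<bullet> (hermite j (X v \<omega>) *\<^sub>R v)) = (LINT \<omega>|M. F \<omega> * hermite m (X v \<omega>))"
    if v: "norm v = 1" for v
  proof -
    have "v \<bullet> v = 1" using v by (simp add: norm_eq_1)
    moreover have "hermite m x = x * hermite j x - poly (pderiv (hermite_poly j)) x" for x
      using arg_cong[OF hermite_poly_Suc[of j], of "\<lambda>p. poly p x"] by (simp add: poly_hermite_poly j)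
    ultimately show ?thesis
      using malliavin_integration_by_parts[OF FG v, of "hermite_poly j" v]
      by (simp add: poly_hermite_poly mult.commute)
  qed
  have "(LINT \<omega>|M. G \<omega> \<bullet> D \<omega>) = (LINT \<omega>|M. (\<Sum>i<n. (c i * real m) * (G \<omega> \<bullet> (hermite j (X (h i) \<omega>) *\<^sub>R h i))))"
    by (simp add: D j inner_sum_right mult_ac)
  also have "\<dots> = (\<Sum>i<n. (c i * real m) * (LINT \<omega>|M. G \<omega> \<bullet> (hermite j (X (h i) \<omega>) *\<^sub>R h i)))"
    by (subst Bochner_Integration.integral_sum) (use h in \<open>auto intro!: integrable_mult_right integrable_L2_inner FG2 vL2 simp del: inner_scaleR_right\<close>)
  also have "\<dots> = (\<Sum>i<n. (c i * real m) * (LINT \<omega>|M. F \<omega> * hermite m (X (h i) \<omega>)))"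
    using h by (intro sum.cong refl) (simp only: step lessThan_iff)
  also have "\<dots> = real m * (LINT \<omega>|M. (\<Sum>i<n. c i * (F \<omega> * hermite m (X (h i) \<omega>))))"
  proof -
    have "(LINT \<omega>|M. (\<Sum>i<n. c i * (F \<omega> * hermite m (X (h i) \<omega>)))) = (\<Sum>i<n. c i * (LINT \<omega>|M. F \<omega> * hermite m (X (h i) \<omega>)))"
      by (subst Bochner_Integration.integral_sum) (simp_all add: integrable_L2_mult FG2 HL2)
    then show ?thesis by (simp add: sum_distrib_left mult_ac)
  qed
  also have "\<dots> = real m * (LINT \<omega>|M. F \<omega> * P \<omega>)"
    by (simp add: P sum_distrib_left mult_ac)
  finally show ?thesis .
qed

text \<open>Testing \<open>hermite_sum_malliavin\<close> on a Hermite sum itself gives E|D|^2 = m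
  E[P^2], so on a fixed chaos L2 convergence of the variables forces convergence of their
  derivatives. The weak eigenvalue identity survives the limit.\<close>

lemma wiener_chaos_pair:
  assumes Y: "Y \<in> wiener_chaos M X m" and m: "1 \<le> m"
  shows "\<exists>U. chaos_pair m Y U"
proof -
  obtain F where F: "\<And>k. \<exists>(n::nat) (c::nat \<Rightarrow> real) h. (\<forall>i<n. norm (h i) = 1) \<and>
      F k = (\<lambda>\<omega>. \<Sum>i<n. c i * hermite m (X (h i) \<omega>))" and FY: "L2_tendsto M F Y"
    using Y m unfolding wiener_chaos_def by auto
  have "\<exists>D. hermite_sum m (F k) D" for k
    using F[of k] unfolding hermite_sum_def by metis
  then obtain D where FD: "\<And>k. hermite_sum m (F k) (D k)" by metis
  note has = poly_sum_has_malliavin_derivative[OF hermite_sum_imp_poly_sum[OF _ m]]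
  note FL2 = L2_tendstoD[OF FY]
  note DL2 = has_malliavin_derivative_L2(2)[OF has[OF FD]]
  have iso: "(LINT \<omega>|M. (norm (D k \<omega> - D l \<omega>))\<^sup>2) = real m * (LINT \<omega>|M. (norm (F k \<omega> - F l \<omega>))\<^sup>2)" for k l
  proof -
    have h: "hermite_sum m (\<lambda>\<omega>. F k \<omega> - F l \<omega>) (\<lambda>\<omega>. D k \<omega> - D l \<omega>)"
      using hermite_sum_linear[OF FD[of k] FD[of l], of "- 1"] by simp
    show ?thesis
      using hermite_sum_malliavin[OF has[OF h] h m] unfolding power2_norm_eq_inner inner_real_def .
  qed
  have "\<exists>U. L2_tendsto M D U"
  proof (rule L2_complete[OF DL2])
    fix e :: real assume e: "e > 0"
    have m0: "real m > 0" using m by simp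
    have "\<forall>\<^sub>F k in sequentially. (LINT \<omega>|M. (norm (F k \<omega> - Y \<omega>))\<^sup>2) < e / (4 * real m)"
      by (rule order_tendstoD(2)[OF FL2(3)]) (use e m in simp)
    \<comment> \<open>The threshold \<open>e / (4 * real m)\<close> allows for two errors with
      factor 2 each and for the factor m in \<open>iso\<close>.\<close>
    then obtain N where N: "\<And>k. k \<ge> N \<Longrightarrow> (LINT \<omega>|M. (norm (F k \<omega> - Y \<omega>))\<^sup>2) < e / (4 * real m)"
      unfolding eventually_sequentially by blast
    have "(LINT \<omega>|M. (norm (D k \<omega> - D l \<omega>))\<^sup>2) < e" if "k \<ge> N" "l \<ge> N" for k l
    proof -
      have i: "integrable M (\<lambda>\<omega>. (norm (F k \<omega> - Y \<omega>))\<^sup>2)" for k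
        using in_L2_diff[OF FL2(1) FL2(2)] by (rule in_L2_integrable_power2)
      have "(LINT \<omega>|M. (norm (F k \<omega> - F l \<omega>))\<^sup>2) \<le> (LINT \<omega>|M. 2 * (norm (F k \<omega> - Y \<omega>))\<^sup>2 + 2 * (norm (F l \<omega> - Y \<omega>))\<^sup>2)"
      proof (rule integral_mono)
        show "integrable M (\<lambda>\<omega>. (norm (F k \<omega> - F l \<omega>))\<^sup>2)"
          using in_L2_diff[OF FL2(1) FL2(1)] by (rule in_L2_integrable_power2)
        show "(norm (F k \<omega> - F l \<omega>))\<^sup>2 \<le> 2 * (norm (F k \<omega> - Y \<omega>))\<^sup>2 + 2 * (norm (F l \<omega> - Y \<omega>))\<^sup>2" for \<omega>
          using power2_norm_add_le[of "F k \<omega> - Y \<omega>" "Y \<omega> - F l \<omega>"] by (simp add: power2_commute[of "F l \<omega>"])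
      qed (use i in auto)
      also have "\<dots> < 2 * (e / (4 * real m)) + 2 * (e / (4 * real m))"
        using i[of k] i[of l] N[OF that(1)] N[OF that(2)] by simp
      also have "\<dots> = e / real m" using m0 by (simp add: field_simps)
      finally show ?thesis unfolding iso using m0 by (simp add: field_simps)
    qed
    then show "\<exists>N. \<forall>k\<ge>N. \<forall>l\<ge>N. (LINT \<omega>|M. (norm (D k \<omega> - D l \<omega>))\<^sup>2) < e" by blast
  qed
  then obtain U where DU: "L2_tendsto M D U" by blast
  have "poly_limit Y U"
    unfolding poly_limit_def using hermite_sum_imp_poly_sum[OF FD m] FY DU by blast
  moreover have "(LINT \<omega>|M. B \<omega> \<bullet> U \<omega>) = real m * (LINT \<omega>|M. A \<omega> * Y \<omega>)"
    if AB: "has_malliavin_derivative M X A B" for A B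
  proof (rule LIMSEQ_unique)
    note AB2 = has_malliavin_derivative_L2[OF AB]
    show "(\<lambda>k. LINT \<omega>|M. B \<omega> \<bullet> D k \<omega>) \<longlonglongrightarrow> (LINT \<omega>|M. B \<omega> \<bullet> U \<omega>)"
      by (rule L2_inner_tendsto[OF L2_tendsto_const[OF AB2(2)] DU])
    show "(\<lambda>k. LINT \<omega>|M. B \<omega> \<bullet> D k \<omega>) \<longlonglongrightarrow> real m * (LINT \<omega>|M. A \<omega> * Y \<omega>)"
      unfolding hermite_sum_malliavin[OF AB FD m]
      by (intro tendsto_mult_left L2_mult_tendsto[OF L2_tendsto_const[OF AB2(1)] FY])
  qed
  ultimately show ?thesis unfolding chaos_pair_def by blast
qed

lemma chaos_pair_malliavin:
  "chaos_pair m Y U \<Longrightarrow> has_malliavin_derivative M X Y U"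
  using poly_limit_has_malliavin_derivative unfolding chaos_pair_def by blast

lemma chaos_pair_inner:
  "chaos_pair m Y U \<Longrightarrow> has_malliavin_derivative M X F G \<Longrightarrow>
    (LINT \<omega>|M. G \<omega> \<bullet> U \<omega>) = real m * (LINT \<omega>|M. F \<omega> * Y \<omega>)"
  unfolding chaos_pair_def by blast

text \<open>By symmetry of the inner product E<U, V> equals both l E[Y W] and m E[Y W].\<close>

lemma chaos_pair_orthogonal:
  assumes "chaos_pair m Y U" "chaos_pair l W V" "m \<noteq> l"
  shows "(LINT \<omega>|M. Y \<omega> * W \<omega>) = 0" "(LINT \<omega>|M. U \<omega> \<bullet> V \<omega>) = 0"
proof -
  have "(LINT \<omega>|M. U \<omega> \<bullet> V \<omega>) = real l * (LINT \<omega>|M. Y \<omega> * W \<omega>)"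
    by (rule chaos_pair_inner[OF assms(2) chaos_pair_malliavin[OF assms(1)]])
  moreover have "(LINT \<omega>|M. V \<omega> \<bullet> U \<omega>) = real m * (LINT \<omega>|M. W \<omega> * Y \<omega>)"
    by (rule chaos_pair_inner[OF assms(1) chaos_pair_malliavin[OF assms(2)]])
  ultimately have "real l * (LINT \<omega>|M. Y \<omega> * W \<omega>) = real m * (LINT \<omega>|M. Y \<omega> * W \<omega>)"
    by (simp add: inner_commute mult.commute)
  then show "(LINT \<omega>|M. Y \<omega> * W \<omega>) = 0" using assms(3) by simp
  then show "(LINT \<omega>|M. U \<omega> \<bullet> V \<omega>) = 0" using \<open>(LINT \<omega>|M. U \<omega> \<bullet> V \<omega>) = real l * _\<close> by simp
qed

text \<open>The constant 1 has derivative 0; as a test variable it gives m E[Y] = 0.\<close>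

lemma chaos_pair_mean:
  assumes "chaos_pair m Y U" "1 \<le> m"
  shows "(LINT \<omega>|M. Y \<omega>) = 0"
proof -
  have "has_malliavin_derivative M X (\<lambda>\<omega>. 1) (\<lambda>\<omega>. 0)"
    using poly_combination_has_malliavin_derivative[of 1 "\<lambda>_. 1" "\<lambda>_. 0"] by simp
  from chaos_pair_inner[OF assms(1) this] show ?thesis using assms(2) by simp
qed

text \<open>Hilbert space projection onto the closed span, which shows that the choice in
  \<open>chaos_proj\<close> is not void. A minimising sequence in the span \<open>H\<close> is
  Cauchy by the parallelogram law, its limit lies in the chaos by definition, and minimality gives
  orthogonality.\<close>

lemma chaos_projection_exists:
  assumes Z: "in_L2 M Z" and m: "1 \<le> m"
  shows "\<exists>Y. Y \<in> wiener_chaos M X m \<and> (\<forall>W\<in>wiener_chaos M X m. (LINT \<omega>|M. (Z \<omega> - Y \<omega>) * W \<omega>) = 0)"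
proof -
  define H where "H = {P. \<exists>D. hermite_sum m P D}"
  define q where "q P = (LINT \<omega>|M. (norm (Z \<omega> - P \<omega>))\<^sup>2)" for P
  have HL2: "in_L2 M P" if "P \<in> H" for P
    using that has_malliavin_derivative_L2(1)[OF poly_sum_has_malliavin_derivative[OF hermite_sum_imp_poly_sum[OF _ m]]]
    unfolding H_def by blast
  have Hlin: "(\<lambda>\<omega>. P \<omega> + t * Q \<omega>) \<in> H" if "P \<in> H" "Q \<in> H" for P Q t
    using that hermite_sum_linear unfolding H_def by blast
  have H0: "(\<lambda>_. 0) \<in> H" unfolding H_def using hermite_sum_zero by blast
  have chaosI: "Y \<in> wiener_chaos M X m" if "\<And>k. P k \<in> H" "L2_tendsto M P Y" for P Y
  proof -
    have "\<exists>(n::nat) (c::nat \<Rightarrow> real) h. (\<forall>i<n. norm (h i) = 1) \<and>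
        P k = (\<lambda>\<omega>. \<Sum>i<n. c i * hermite m (X (h i) \<omega>))" for k
      using that(1)[of k] unfolding H_def hermite_sum_def by blast
    then have "\<exists>F. (\<forall>k. \<exists>(n::nat) (c::nat \<Rightarrow> real) h. (\<forall>i<n. norm (h i) = 1) \<and>
        F k = (\<lambda>\<omega>. \<Sum>i<n. c i * hermite m (X (h i) \<omega>))) \<and> L2_tendsto M F Y"
      using that(2) by (intro exI[of _ P] conjI allI)
    then show ?thesis using m unfolding wiener_chaos_def by simp
  qed
  define d where "d = Inf (q ` H)"
  have bdd: "bdd_below (q ` H)" by (rule bdd_belowI[of _ 0]) (auto simp: q_def)
  have dle: "d \<le> q P" if "P \<in> H" for P unfolding d_def using that bdd by (intro cInf_lower) auto
  have "\<exists>P\<in>H. q P < d + 1 / real (Suc k)" for k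
  proof -
    have "Inf (q ` H) < d + 1 / real (Suc k)" by (simp add: d_def)
    then show ?thesis using cInf_lessD[of "q ` H"] H0 by blast
  qed
  then obtain P where P: "\<And>k. P k \<in> H" "\<And>k. q (P k) < d + 1 / real (Suc k)" by metis
  note PL2 = HL2[OF P(1)]
  have par: "(LINT \<omega>|M. (norm (P k \<omega> - P l \<omega>))\<^sup>2) \<le> 2 / real (Suc k) + 2 / real (Suc l)" for k l
  proof -
    \<comment> \<open>The midpoint again lies in \<open>H\<close>, so its squared distance to Z
      cannot fall below the infimum \<open>d\<close>.\<close>
    define R where "R \<omega> = 1/2 * P k \<omega> + 1/2 * P l \<omega>" for \<omega>
    have R: "R \<in> H" unfolding R_def using Hlin[OF Hlin[OF H0 P(1)[of k], of "1/2"] P(1)[of l], of "1/2"] by simp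
    have i: "integrable M (\<lambda>\<omega>. (norm (Z \<omega> - Q \<omega>))\<^sup>2)" if "Q \<in> H" for Q
      using in_L2_diff[OF Z HL2[OF that]] by (rule in_L2_integrable_power2)
    have "(norm (P k \<omega> - P l \<omega>))\<^sup>2 = 2 * (norm (Z \<omega> - P k \<omega>))\<^sup>2 + 2 * (norm (Z \<omega> - P l \<omega>))\<^sup>2 - 4 * (norm (Z \<omega> - R \<omega>))\<^sup>2" for \<omega>
      by (simp add: R_def power2_eq_square field_simps)
    then have "(LINT \<omega>|M. (norm (P k \<omega> - P l \<omega>))\<^sup>2) = 2 * q (P k) + 2 * q (P l) - 4 * q R"
      using i[OF P(1)[of k]] i[OF P(1)[of l]] i[OF R] by (simp add: q_def)
    also have "\<dots> \<le> 2 * (1 / real (Suc k)) + 2 * (1 / real (Suc l))"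
      using P(2)[of k] P(2)[of l] dle[OF R] by linarith
    finally show ?thesis by simp
  qed
  have "\<exists>Y. L2_tendsto M P Y"
  proof (rule L2_complete[OF PL2])
    fix e :: real assume "e > 0"
    then obtain N where N: "1 / real (Suc N) < e / 4" using nat_approx_posE[of "e / 4"] by auto
    have "(LINT \<omega>|M. (norm (P k \<omega> - P l \<omega>))\<^sup>2) < e" if "k \<ge> N" "l \<ge> N" for k l
    proof -
      have "1 / real (Suc k) \<le> 1 / real (Suc N)" "1 / real (Suc l) \<le> 1 / real (Suc N)"
        using that by (auto intro!: divide_left_mono)
      then have "2 / real (Suc k) + 2 / real (Suc l) < e" using N by linarith
      with par[of k l] show ?thesis by linarith
    qed
    then show "\<exists>N. \<forall>k\<ge>N. \<forall>l\<ge>N. (LINT \<omega>|M. (norm (P k \<omega> - P l \<omega>))\<^sup>2) < e" by blast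
  qed
  then obtain Y where PY: "L2_tendsto M P Y" by blast
  note YL2 = L2_tendstoD(2)[OF PY]
  have qlim: "(\<lambda>k. q (\<lambda>\<omega>. P k \<omega> + t * Q \<omega>)) \<longlonglongrightarrow> (LINT \<omega>|M. (norm (Z \<omega> - Y \<omega> + (- t) *\<^sub>R Q \<omega>))\<^sup>2)" if Q: "Q \<in> H" for Q t
  proof -
    have L: "L2_tendsto M (\<lambda>k \<omega>. Z \<omega> - (P k \<omega> + t * Q \<omega>)) (\<lambda>\<omega>. Z \<omega> - (Y \<omega> + t * Q \<omega>))"
      by (intro L2_tendsto_diff L2_tendsto_add PY L2_tendsto_const Z in_L2_cmult HL2 Q)
    from L2_mult_tendsto[OF L L] show ?thesis
      by (simp add: q_def power2_eq_square algebra_simps)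
  qed
  have "(\<lambda>k. q (P k)) \<longlonglongrightarrow> d"
  proof (rule tendsto_sandwich)
    show "\<forall>\<^sub>F k in sequentially. d \<le> q (P k)" using dle P(1) by simp
    show "\<forall>\<^sub>F k in sequentially. q (P k) \<le> d + 1 / real (Suc k)"
      by (intro always_eventually allI less_imp_le P)
    have "(\<lambda>k. 1 / real (Suc k)) \<longlonglongrightarrow> 0" using LIMSEQ_inverse_real_of_nat by (simp add: inverse_eq_divide)
    from tendsto_add[OF tendsto_const[of d] this] show "(\<lambda>k. d + 1 / real (Suc k)) \<longlonglongrightarrow> d" by simp
  qed simp
  with qlim[OF H0, of 0] have d: "(LINT \<omega>|M. (norm (Z \<omega> - Y \<omega>))\<^sup>2) = d"
    using LIMSEQ_unique[of "\<lambda>k. q (P k)" "LINT \<omega>|M. (norm (Z \<omega> - Y \<omega>))\<^sup>2" d] by simp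
  have orthH: "(LINT \<omega>|M. (Z \<omega> - Y \<omega>) * Q \<omega>) = 0" if Q: "Q \<in> H" for Q
  proof -
    define b c where "b = (LINT \<omega>|M. (Z \<omega> - Y \<omega>) * Q \<omega>)" and "c = (LINT \<omega>|M. (norm (Q \<omega>))\<^sup>2)"
    \<comment> \<open>First variation: moving from Y in the direction Q cannot decrease the
      distance. The comparison is made along the sequence \<open>P k\<close>, because Y itself need
      not lie in \<open>H\<close>.\<close>
    have ge: "0 \<le> 2 * t * b + t\<^sup>2 * c" for t
    proof -
      have "d \<le> (LINT \<omega>|M. (norm (Z \<omega> - Y \<omega> + (- (- t)) *\<^sub>R Q \<omega>))\<^sup>2)"
        by (rule LIMSEQ_le_const[OF qlim[OF Q]]) (use dle Hlin[OF P(1) Q] in blast)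
      also have "\<dots> = d + 2 * t * b + t\<^sup>2 * c"
        using L2_norm_add[OF in_L2_diff[OF Z YL2] HL2[OF Q], of t] d by (simp add: b_def c_def)
      finally show ?thesis by simp
    qed
    have "c \<ge> 0" by (simp add: c_def)
    have "b = 0"
    proof (cases "c = 0")
      case True
      then have "b * b \<le> 0" using ge[of "- b"] by simp
      then show ?thesis using zero_le_square[of b] by (simp add: order_antisym_conv)
    next
      case False
      have "2 * (- b / c) * b + (- b / c)\<^sup>2 * c = - (b\<^sup>2 / c)"
        using False by (simp add: field_simps power2_eq_square)
      then have "b\<^sup>2 / c \<le> 0" using ge[of "- b / c"] by simp
      moreover have "b\<^sup>2 / c \<ge> 0" using \<open>c \<ge> 0\<close> by simp
      ultimately show ?thesis using False by simp
    qed
    then show ?thesis by (simp add: b_def)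
  qed
  have "(LINT \<omega>|M. (Z \<omega> - Y \<omega>) * W \<omega>) = 0" if W: "W \<in> wiener_chaos M X m" for W
  proof -
    obtain F where F: "\<And>k. \<exists>(n::nat) (c::nat \<Rightarrow> real) h. (\<forall>i<n. norm (h i) = 1) \<and>
        F k = (\<lambda>\<omega>. \<Sum>i<n. c i * hermite m (X (h i) \<omega>))" and FW: "L2_tendsto M F W"
      using W m unfolding wiener_chaos_def by auto
    have "F k \<in> H" for k using F[of k] unfolding H_def hermite_sum_def by blast
    then have "(\<lambda>k. LINT \<omega>|M. (Z \<omega> - Y \<omega>) * F k \<omega>) = (\<lambda>_. 0)" using orthH by simp
    moreover have "(\<lambda>k. LINT \<omega>|M. (Z \<omega> - Y \<omega>) * F k \<omega>) \<longlonglongrightarrow> (LINT \<omega>|M. (Z \<omega> - Y \<omega>) * W \<omega>)"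
      by (rule L2_mult_tendsto[OF L2_tendsto_const[OF in_L2_diff[OF Z YL2]] FW])
    ultimately show ?thesis by (simp add: LIMSEQ_const_iff)
  qed
  then show ?thesis using chaosI[OF P(1) PY] by blast
qed

end

section \<open>Completeness of the chaos and uniqueness of the derivative\<close>

context isonormal
begin

lemma hermite_X_L2: "in_L2 M (\<lambda>\<omega>. hermite m (X h \<omega>))"
  using poly_X_L2[of "hermite_poly m" h] by (simp add: poly_hermite_poly)

lemma hermite_in_wiener_chaos:
  assumes "norm h = 1" "1 \<le> m"
  shows "(\<lambda>\<omega>. hermite m (X h \<omega>)) \<in> wiener_chaos M X m"
proof -
  have "\<exists>(n::nat) c v. (\<forall>i<n. norm (v i) = 1) \<and> (\<lambda>\<omega>. hermite m (X h \<omega>)) = (\<lambda>\<omega>. \<Sum>i<n. c i * hermite m (X (v i) \<omega>))"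
    using assms(1) by (intro exI[of _ 1] exI[of _ "\<lambda>_. 1"] exI[of _ "\<lambda>_. h"]) simp
  then have "\<exists>F. (\<forall>k::nat. \<exists>(n::nat) c v. (\<forall>i<n. norm (v i) = 1) \<and> F k = (\<lambda>\<omega>. \<Sum>i<n. c i * hermite m (X (v i) \<omega>)))
      \<and> L2_tendsto M F (\<lambda>\<omega>. hermite m (X h \<omega>))"
    by (intro exI[of _ "\<lambda>_ \<omega>. hermite m (X h \<omega>)"] conjI allI L2_tendsto_const hermite_X_L2)
  then show ?thesis using assms(2) by (simp add: wiener_chaos_def)
qed

text \<open>The recurrence x H_m = H_(m+1) + m H_(m-1) trades one power of X u for Hermite degrees,
  so the induction runs over the power with the degree arbitrary.\<close>

lemma AE_zero_if_orthogonal_hermite: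
  assumes sets: "sets M = sets_generated_by M X" and W: "in_L2 M W"
    and mean: "(LINT \<omega>|M. W \<omega>) = (0::real)"
    and orth: "\<And>h m. norm h = 1 \<Longrightarrow> 1 \<le> m \<Longrightarrow> (LINT \<omega>|M. W \<omega> * hermite m (X h \<omega>)) = 0"
  shows "AE \<omega> in M. W \<omega> = 0"
proof (rule AE_zero_if_orthogonal_powers[OF sets W])
  have unit: "(LINT \<omega>|M. W \<omega> * (X u \<omega> ^ n * hermite m (X u \<omega>))) = 0" if u: "norm u = 1" for u n m
  proof (induction n arbitrary: m)
    case 0
    show ?case
    proof (cases m)
      case (Suc j)
      then show ?thesis using orth[OF u, of m] by simp
    qed (use mean in simp)
  next
    case (Suc n)
    have L: "in_L2 M (\<lambda>\<omega>. X u \<omega> ^ n * hermite l (X u \<omega>))" for l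
      using poly_X_L2[of "monom 1 n * hermite_poly l" u] by (simp add: poly_monom poly_hermite_poly)
    \<comment> \<open>For m = 0 the truncated index m - 1 is multiplied by 0.\<close>
    have eq: "x ^ Suc n * hermite m x = x ^ n * hermite (Suc m) x + real m * (x ^ n * hermite (m - 1) x)" for x
      by (cases m) (simp_all add: algebra_simps)
    have "(LINT \<omega>|M. W \<omega> * (X u \<omega> ^ Suc n * hermite m (X u \<omega>)))
      = (LINT \<omega>|M. W \<omega> * (X u \<omega> ^ n * hermite (Suc m) (X u \<omega>)) + real m * (W \<omega> * (X u \<omega> ^ n * hermite (m - 1) (X u \<omega>))))"
      unfolding eq by (simp only: distrib_left mult.left_commute)
    also have "\<dots> = 0"
      using integrable_L2_mult[OF W L] Suc.IH by simp
    finally show ?case .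
  qed
  show "(LINT \<omega>|M. W \<omega> * X h \<omega> ^ m) = 0" for h m
  proof (cases rule: X_normalize[of h])
    case (1 u)
    have [measurable]: "W \<in> borel_measurable M" using W by (auto dest: in_L2_measurable)
    have "(LINT \<omega>|M. W \<omega> * X h \<omega> ^ m) = (LINT \<omega>|M. norm h ^ m * (W \<omega> * (X u \<omega> ^ m * hermite 0 (X u \<omega>))))"
      by (rule integral_cong_AE) (use 1(2) in \<open>auto elim!: eventually_mono simp: power_mult_distrib\<close>)
    then show ?thesis using unit[OF 1(1), of m 0] by simp
  next
    case 2
    have [measurable]: "W \<in> borel_measurable M" using W by (auto dest: in_L2_measurable)
    have "(LINT \<omega>|M. W \<omega> * X h \<omega> ^ m) = (LINT \<omega>|M. 0 ^ m * W \<omega>)"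
      by (rule integral_cong_AE) (use 2(2) in \<open>auto elim!: eventually_mono\<close>)
    then show ?thesis using mean by simp
  qed
qed

text \<open>Closability. In each unit direction the coordinate of the difference is orthogonal to
  all powers of all X h by integration by parts, hence 0 almost surely; separability of the Hilbert
  space collects the exceptional sets into one.\<close>

lemma malliavin_derivative_unique:
  assumes sets: "sets M = sets_generated_by M X"
    and A: "has_malliavin_derivative M X Y A" and B: "has_malliavin_derivative M X Y B"
  shows "AE \<omega> in M. A \<omega> = B \<omega>"
proof -
  note L2 = has_malliavin_derivative_L2(2)[OF A] has_malliavin_derivative_L2(2)[OF B]
  have inner_L2: "in_L2 M (\<lambda>\<omega>. V \<omega> \<bullet> h)" if "in_L2 M V" for V :: "'a \<Rightarrow> 'h" and h
  proof (rule in_L2_bound[OF in_L2_scaleR[OF that, of "norm h"]])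
    show "(\<lambda>\<omega>. V \<omega> \<bullet> h) \<in> borel_measurable M" using in_L2_measurable[OF that] by measurable
    show "AE \<omega> in M. norm (V \<omega> \<bullet> h) \<le> norm (norm h *\<^sub>R V \<omega>)"
    proof (rule AE_I2)
      fix \<omega>
      show "norm (V \<omega> \<bullet> h) \<le> norm (norm h *\<^sub>R V \<omega>)"
        using Cauchy_Schwarz_ineq2[of "V \<omega>" h] by (simp add: mult.commute)
    qed
  qed
  have unit: "AE \<omega> in M. (A \<omega> - B \<omega>) \<bullet> u = 0" if u: "norm u = 1" for u
  proof (rule AE_zero_if_orthogonal_powers[OF sets])
    show "in_L2 M (\<lambda>\<omega>. (A \<omega> - B \<omega>) \<bullet> u)" by (intro inner_L2 in_L2_diff L2)
    show "(LINT \<omega>|M. ((A \<omega> - B \<omega>) \<bullet> u) * X h \<omega> ^ m) = 0" for h m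
    proof -
      have p: "in_L2 M (\<lambda>\<omega>. X h \<omega> ^ m)" using poly_X_L2[of "monom 1 m" h] by (simp add: poly_monom)
      have "(LINT \<omega>|M. (A \<omega> \<bullet> u) * X h \<omega> ^ m) = (LINT \<omega>|M. (B \<omega> \<bullet> u) * X h \<omega> ^ m)"
        using malliavin_integration_by_parts[OF A u, of "monom 1 m" h]
          malliavin_integration_by_parts[OF B u, of "monom 1 m" h] by (simp add: poly_monom)
      then show ?thesis
        using integrable_L2_mult[OF inner_L2[OF L2(1)] p] integrable_L2_mult[OF inner_L2[OF L2(2)] p]
        by (simp add: inner_diff_left left_diff_distrib)
    qed
  qed
  have all: "AE \<omega> in M. (A \<omega> - B \<omega>) \<bullet> h = 0" for h
  proof (cases "h = 0")
    case False
    define u where "u = h /\<^sub>R norm h"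
    have "norm u = 1" and h: "h = norm h *\<^sub>R u" using False by (simp_all add: u_def)
    from unit[OF this(1)] have "AE \<omega> in M. (A \<omega> - B \<omega>) \<bullet> (norm h *\<^sub>R u) = 0"
      by eventually_elim simp
    then show ?thesis unfolding h[symmetric] .
  qed simp
  obtain D :: "'h set" where D: "countable D" "\<And>S. open S \<Longrightarrow> S \<noteq> {} \<Longrightarrow> \<exists>d\<in>D. d \<in> S"
    using countable_dense_exists by blast
  have "AE \<omega> in M. \<forall>d\<in>D. (A \<omega> - B \<omega>) \<bullet> d = 0"
    using D(1) all by (simp add: AE_ball_countable)
  then show ?thesis
  proof eventually_elim
    case (elim \<omega>)
    define v where "v = A \<omega> - B \<omega>"
    \<comment> \<open>For nonzero v the open half-space of all x with
      \<open>0 < v \<bullet> x\<close> would contain a point of the countable dense set.\<close>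
    have "v = 0"
    proof (rule ccontr)
      assume "v \<noteq> 0"
      then have "v \<in> {x. 0 < v \<bullet> x}" by simp
      moreover have "open {x. 0 < v \<bullet> x}" by (intro open_Collect_less continuous_intros)
      ultimately obtain d where "d \<in> D" "0 < v \<bullet> d" using D(2)[of "{x. 0 < v \<bullet> x}"] by blast
      then show False using elim by (simp add: v_def)
    qed
    then show ?case by (simp add: v_def)
  qed
qed

text \<open>The identity \<open>Z = \<delta> (- D L\<^sup>-\<^sup>1 Z)\<close> for centered \<open>Z\<close>, in weak form.\<close>

lemma OU_pinv_malliavin:
  assumes sets: "sets M = sets_generated_by M X" and Z: "in_L2 M Z" and mean: "(LINT \<omega>|M. Z \<omega>) = 0"
  shows "\<exists>U. has_malliavin_derivative M X (OU_pinv M X Z) U \<and>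
    (\<forall>F G. has_malliavin_derivative M X F G \<longrightarrow> (LINT \<omega>|M. F \<omega> * Z \<omega>) = - (LINT \<omega>|M. G \<omega> \<bullet> U \<omega>))"
proof -
  \<comment> \<open>\<open>J m\<close> lies in the chaos of order m + 1: order 0 does not occur in
    L^-1, and Z has no component there because its mean is 0.\<close>
  define J where "J m = chaos_proj M X (Suc m) Z" for m
  have Jex: "J m \<in> wiener_chaos M X (Suc m) \<and> (\<forall>W\<in>wiener_chaos M X (Suc m). (LINT \<omega>|M. (Z \<omega> - J m \<omega>) * W \<omega>) = 0)" for m
    unfolding J_def chaos_proj_def by (rule someI_ex[OF chaos_projection_exists[OF Z]]) simp
  then have J: "J m \<in> wiener_chaos M X (Suc m)"
    and Jorth: "W \<in> wiener_chaos M X (Suc m) \<Longrightarrow> (LINT \<omega>|M. (Z \<omega> - J m \<omega>) * W \<omega>) = 0" for m W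
    by blast+
  have "\<exists>U. chaos_pair (Suc m) (J m) U" for m by (rule wiener_chaos_pair[OF J]) simp
  then have "\<forall>m. \<exists>U. chaos_pair (Suc m) (J m) U" ..
  from choice[OF this] obtain U where JU: "chaos_pair (Suc m) (J m) (U m)" for m by blast
  note has = chaos_pair_malliavin[OF JU]
  note JL2 = has_malliavin_derivative_L2(1)[OF has] and UL2 = has_malliavin_derivative_L2(2)[OF has]
  have orth: "(LINT \<omega>|M. J m \<omega> \<bullet> J l \<omega>) = 0" "(LINT \<omega>|M. U m \<omega> \<bullet> U l \<omega>) = 0" if "m \<noteq> l" for m l
    using chaos_pair_orthogonal[OF JU[of m] JU[of l]] that by simp_all
  define e where "e m = (LINT \<omega>|M. (norm (J m \<omega>))\<^sup>2)" for m
  have e0: "e m \<ge> 0" for m by (simp add: e_def)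
  have ZJ: "(LINT \<omega>|M. Z \<omega> * J m \<omega>) = e m" for m
    using Jorth[OF J[of m]] integrable_L2_mult[OF Z JL2] integrable_L2_mult[OF JL2 JL2]
    by (simp add: e_def left_diff_distrib power2_eq_square)
  have eU: "(LINT \<omega>|M. (norm (U m \<omega>))\<^sup>2) = real (Suc m) * e m" for m
    using chaos_pair_inner[OF JU has, of m m] unfolding e_def power2_norm_eq_inner inner_real_def .
  define S where "S N \<omega> = (\<Sum>m<N. J m \<omega>)" for N \<omega>
  have SL2: "in_L2 M (S N)" for N unfolding S_def by (intro in_L2_sum JL2)
  \<comment> \<open>Bessel's inequality; it controls the three series summed below.\<close>
  have bessel: "(\<Sum>m<N. e m) \<le> (LINT \<omega>|M. (norm (Z \<omega>))\<^sup>2)" for N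
  proof -
    have "(LINT \<omega>|M. Z \<omega> \<bullet> S N \<omega>) = (\<Sum>m<N. (LINT \<omega>|M. Z \<omega> * J m \<omega>))"
      unfolding S_def inner_real_def sum_distrib_left
      by (intro Bochner_Integration.integral_sum integrable_L2_mult Z JL2)
    then have ZS: "(LINT \<omega>|M. Z \<omega> \<bullet> S N \<omega>) = (\<Sum>m<N. e m)" by (simp only: ZJ)
    have SS: "(LINT \<omega>|M. (norm (S N \<omega>))\<^sup>2) = (\<Sum>m<N. e m)"
      unfolding S_def e_def by (rule L2_norm_orthogonal_sum[OF _ JL2 orth(1)]) auto
    have "0 \<le> (LINT \<omega>|M. (norm (Z \<omega> + (- 1) *\<^sub>R S N \<omega>))\<^sup>2)" by simp
    also have "\<dots> = (LINT \<omega>|M. (norm (Z \<omega>))\<^sup>2) - (\<Sum>m<N. e m)"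
      unfolding L2_norm_add[OF Z SL2] ZS SS by simp
    finally show ?thesis by simp
  qed
  have sm: "summable e" by (rule summableI_nonneg_bounded[OF e0 bessel])
  define t where "t m = - (1 / real (Suc m))" for m
  \<comment> \<open>The square of 1 / (m + 1) outweighs the factor m + 1 in E|U m|^2, so the
    termwise differentiated series converges for every square integrable Z.\<close>
  have t2: "(t m)\<^sup>2 * real (Suc m) \<le> 1" "(t m)\<^sup>2 \<le> 1" for m
  proof -
    have "(t m)\<^sup>2 * real (Suc m) = 1 / real (Suc m)" by (simp add: t_def power2_eq_square)
    then show "(t m)\<^sup>2 * real (Suc m) \<le> 1" by simp
    have "\<bar>t m\<bar> \<le> 1" by (simp add: t_def)
    then show "(t m)\<^sup>2 \<le> 1" by (simp only: abs_square_le_1)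
  qed
  have "\<exists>v. L2_tendsto M (\<lambda>N \<omega>. \<Sum>m<N. J m \<omega>) v"
    by (rule L2_orthogonal_series[OF finite_measure_axioms JL2 orth(1)]) (use sm in \<open>simp_all add: e_def[abs_def]\<close>)
  then obtain \<zeta> where \<zeta>: "L2_tendsto M S \<zeta>" unfolding S_def by blast
  have "\<exists>v. L2_tendsto M (\<lambda>N \<omega>. \<Sum>m<N. t m * J m \<omega>) v"
  proof (rule L2_orthogonal_series[OF finite_measure_axioms])
    show "summable (\<lambda>m. LINT \<omega>|M. (norm (t m * J m \<omega>))\<^sup>2)"
    proof (rule summable_comparison_test'[OF sm, of 0])
      fix m
      have "(LINT \<omega>|M. (norm (t m * J m \<omega>))\<^sup>2) = (t m)\<^sup>2 * e m" by (simp add: e_def power_mult_distrib)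
      also have "\<dots> \<le> 1 * e m" by (intro mult_right_mono t2 e0)
      finally show "norm (LINT \<omega>|M. (norm (t m * J m \<omega>))\<^sup>2) \<le> e m" by simp
    qed
    show "(LINT \<omega>|M. (t m * J m \<omega>) \<bullet> (t l * J l \<omega>)) = 0" if "m \<noteq> l" for m l
    proof -
      have "(LINT \<omega>|M. (t m * J m \<omega>) \<bullet> (t l * J l \<omega>)) = (LINT \<omega>|M. (t m * t l) * (J m \<omega> \<bullet> J l \<omega>))"
        by (simp add: mult_ac)
      then show ?thesis using orth(1)[OF that] by simp
    qed
  qed (intro in_L2_cmult JL2)
  moreover have "(\<lambda>N \<omega>. \<Sum>m = 1..N. - (1 / real m) * chaos_proj M X m Z \<omega>) = (\<lambda>N \<omega>. \<Sum>m<N. t m * J m \<omega>)"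
    by (simp add: sum.atLeast1_atMost_eq t_def J_def)
  ultimately have OU: "L2_tendsto M (\<lambda>N \<omega>. \<Sum>m<N. t m * J m \<omega>) (OU_pinv M X Z)"
    unfolding OU_pinv_def by (simp only: someI_ex)
  have "\<exists>v. L2_tendsto M (\<lambda>N \<omega>. \<Sum>m<N. t m *\<^sub>R U m \<omega>) v"
  proof (rule L2_orthogonal_series[OF finite_measure_axioms])
    show "summable (\<lambda>m. LINT \<omega>|M. (norm (t m *\<^sub>R U m \<omega>))\<^sup>2)"
    proof (rule summable_comparison_test'[OF sm, of 0])
      fix m
      have "(LINT \<omega>|M. (norm (t m *\<^sub>R U m \<omega>))\<^sup>2) = (t m)\<^sup>2 * (LINT \<omega>|M. (norm (U m \<omega>))\<^sup>2)"
        by (simp add: power_mult_distrib)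
      also have "\<dots> = ((t m)\<^sup>2 * real (Suc m)) * e m" unfolding eU by simp
      also have "\<dots> \<le> 1 * e m" by (intro mult_right_mono t2 e0)
      finally show "norm (LINT \<omega>|M. (norm (t m *\<^sub>R U m \<omega>))\<^sup>2) \<le> e m" by simp
    qed
    show "(LINT \<omega>|M. (t m *\<^sub>R U m \<omega>) \<bullet> (t l *\<^sub>R U l \<omega>)) = 0" if "m \<noteq> l" for m l
      using orth(2)[OF that] by simp
  qed (intro in_L2_scaleR UL2)
  then obtain V where V: "L2_tendsto M (\<lambda>N \<omega>. \<Sum>m<N. t m *\<^sub>R U m \<omega>) V" by blast
  have pl: "poly_limit (J m) (U m)" for m using JU[of m] by (simp add: chaos_pair_def)
  have "has_malliavin_derivative M X (\<lambda>\<omega>. \<Sum>m<N. t m * J m \<omega>) (\<lambda>\<omega>. \<Sum>m<N. t m *\<^sub>R U m \<omega>)" for N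
    by (intro poly_limit_has_malliavin_derivative poly_limit_sum pl)
  then have OUV: "has_malliavin_derivative M X (OU_pinv M X Z) V"
    by (rule has_malliavin_derivative_limit[OF _ OU V])
  \<comment> \<open>Completeness: Z and the sum of its projections have the same mean and the same
    integrals against all Hermite variables.\<close>
  have "AE \<omega> in M. Z \<omega> - \<zeta> \<omega> = 0"
  proof (rule AE_zero_if_orthogonal_hermite[OF sets in_L2_diff[OF Z L2_tendstoD(2)[OF \<zeta>]]])
    have lim: "(\<lambda>N. LINT \<omega>|M. (Z \<omega> - S N \<omega>) * H \<omega>) \<longlonglongrightarrow> (LINT \<omega>|M. (Z \<omega> - \<zeta> \<omega>) * H \<omega>)" if "in_L2 M H" for H
      by (intro L2_mult_tendsto L2_tendsto_diff L2_tendsto_const Z \<zeta> that)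
    have mJ: "(LINT \<omega>|M. J m \<omega>) = 0" for m by (rule chaos_pair_mean[OF JU]) simp
    have "(LINT \<omega>|M. (Z \<omega> - S N \<omega>) * 1) = 0" for N
      using integrable_L2[OF Z] integrable_L2[OF JL2] mJ mean by (simp add: S_def)
    then show "(LINT \<omega>|M. Z \<omega> - \<zeta> \<omega>) = 0"
      using lim[of "\<lambda>_. 1"] by (simp add: LIMSEQ_const_iff)
    show "(LINT \<omega>|M. (Z \<omega> - \<zeta> \<omega>) * hermite m (X h \<omega>)) = 0" if h: "norm h = 1" and m: "1 \<le> m" for h m
    proof -
      obtain j where j: "m = Suc j" using m by (cases m) auto
      define H where "H \<omega> = hermite m (X h \<omega>)" for \<omega>
      have Hc: "H \<in> wiener_chaos M X m" unfolding H_def by (rule hermite_in_wiener_chaos[OF h m])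
      have HL2: "in_L2 M H" unfolding H_def by (rule hermite_X_L2)
      obtain UH where HU: "chaos_pair m H UH" using wiener_chaos_pair[OF Hc m] by blast
      have JH: "(LINT \<omega>|M. J l \<omega> * H \<omega>) = 0" if "l \<noteq> j" for l
        by (rule chaos_pair_orthogonal(1)[OF JU HU]) (use that j in simp)
      \<comment> \<open>Only the component \<open>J j\<close> meets \<open>H\<close>, so the
        integral is exactly 0 once that component is included in the sum.\<close>
      have "(LINT \<omega>|M. (Z \<omega> - S N \<omega>) * H \<omega>) = 0" if N: "N > j" for N
      proof -
        have "(LINT \<omega>|M. S N \<omega> * H \<omega>) = (\<Sum>l<N. (LINT \<omega>|M. J l \<omega> * H \<omega>))"
          unfolding S_def sum_distrib_right by (intro Bochner_Integration.integral_sum integrable_L2_mult JL2 HL2)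
        also have "\<dots> = (LINT \<omega>|M. J j \<omega> * H \<omega>)"
          using N by (subst sum.remove[of _ j]) (auto simp: JH)
        also have "\<dots> = (LINT \<omega>|M. Z \<omega> * H \<omega>)"
          using Jorth[of H j] Hc integrable_L2_mult[OF Z HL2] integrable_L2_mult[OF JL2 HL2]
          by (simp add: j left_diff_distrib)
        finally show ?thesis
          using integrable_L2_mult[OF Z HL2] integrable_L2_mult[OF SL2 HL2] by (simp add: left_diff_distrib)
      qed
      then have "\<forall>\<^sub>F N in sequentially. (LINT \<omega>|M. (Z \<omega> - S N \<omega>) * H \<omega>) = 0"
        by (intro eventually_mono[OF eventually_gt_at_top[of j]])
      then have "(\<lambda>N. LINT \<omega>|M. (Z \<omega> - S N \<omega>) * H \<omega>) \<longlonglongrightarrow> 0" by (rule tendsto_eventually)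
      from LIMSEQ_unique[OF lim[OF HL2] this] show ?thesis by (simp add: H_def)
    qed
  qed
  then have Z\<zeta>: "AE \<omega> in M. Z \<omega> = \<zeta> \<omega>" by simp
  have "(LINT \<omega>|M. F \<omega> * Z \<omega>) = - (LINT \<omega>|M. G \<omega> \<bullet> V \<omega>)"
    if FG: "has_malliavin_derivative M X F G" for F G
  proof -
    note FG2 = has_malliavin_derivative_L2[OF FG]
    \<comment> \<open>\<open>t m\<close> is minus the reciprocal of the eigenvalue m + 1, so the
      m-th term becomes -E[F J_m].\<close>
    have eq: "(LINT \<omega>|M. G \<omega> \<bullet> (\<Sum>m<N. t m *\<^sub>R U m \<omega>)) = - (LINT \<omega>|M. F \<omega> * S N \<omega>)" for N
    proof -
      have "(LINT \<omega>|M. G \<omega> \<bullet> (\<Sum>m<N. t m *\<^sub>R U m \<omega>)) = (\<Sum>m<N. (LINT \<omega>|M. t m * (G \<omega> \<bullet> U m \<omega>)))"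
        unfolding inner_sum_right inner_scaleR_right
        by (intro Bochner_Integration.integral_sum integrable_mult_right integrable_L2_inner FG2 UL2)
      also have "\<dots> = (\<Sum>m<N. - (LINT \<omega>|M. F \<omega> * J m \<omega>))"
        using chaos_pair_inner[OF JU FG] by (intro sum.cong refl) (simp add: t_def)
      also have "\<dots> = - (LINT \<omega>|M. F \<omega> * S N \<omega>)"
        unfolding S_def sum_distrib_left
        by (subst Bochner_Integration.integral_sum) (simp_all add: integrable_L2_mult FG2 JL2 sum_negf)
      finally show ?thesis .
    qed
    have "(\<lambda>N. LINT \<omega>|M. G \<omega> \<bullet> (\<Sum>m<N. t m *\<^sub>R U m \<omega>)) \<longlonglongrightarrow> (LINT \<omega>|M. G \<omega> \<bullet> V \<omega>)"
      by (rule L2_inner_tendsto[OF L2_tendsto_const[OF FG2(2)] V])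
    moreover have "(\<lambda>N. LINT \<omega>|M. G \<omega> \<bullet> (\<Sum>m<N. t m *\<^sub>R U m \<omega>)) \<longlonglongrightarrow> - (LINT \<omega>|M. F \<omega> * \<zeta> \<omega>)"
      unfolding eq by (intro tendsto_minus L2_mult_tendsto[OF L2_tendsto_const[OF FG2(1)] \<zeta>])
    ultimately have "(LINT \<omega>|M. G \<omega> \<bullet> V \<omega>) = - (LINT \<omega>|M. F \<omega> * \<zeta> \<omega>)"
      by (rule LIMSEQ_unique)
    moreover have "(LINT \<omega>|M. F \<omega> * \<zeta> \<omega>) = (LINT \<omega>|M. F \<omega> * Z \<omega>)"
    proof (rule integral_cong_AE)
      show "AE \<omega> in M. F \<omega> * \<zeta> \<omega> = F \<omega> * Z \<omega>" using Z\<zeta> by eventually_elim simp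
    qed (use FG2 Z L2_tendstoD(2)[OF \<zeta>] in \<open>auto intro!: borel_measurable_times dest: in_L2_measurable\<close>)
    ultimately show ?thesis by simp
  qed
  then show ?thesis using OUV by blast
qed

end

section \<open>Stein's identity for Malliavin differentiable variables\<close>

context isonormal
begin

lemma smooth_cylindrical_has_malliavin_derivative:
  "smooth_cylindrical X F G \<Longrightarrow> has_malliavin_derivative M X F G"
  unfolding has_malliavin_derivative_def
  by (intro exI[of _ "\<lambda>_. F"] exI[of _ "\<lambda>_. G"] conjI allI L2_tendsto_const smooth_cylindrical_L2)

text \<open>Splitting c(F k) G k = c(F k) (G k - g) + c(F k) g: the first part is small because c is
  bounded, the second converges by dominated convergence, which is where almost everywhere
  convergence of F k enters.\<close>

lemma L2_tendsto_bounded_composition: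
  fixes G :: "nat \<Rightarrow> 'a \<Rightarrow> 'b::{real_normed_vector, second_countable_topology}"
  assumes F: "\<And>k. F k \<in> borel_measurable M" and Z: "Z \<in> borel_measurable M"
    and lim: "AE \<omega> in M. (\<lambda>k. F k \<omega>) \<longlonglongrightarrow> (Z \<omega> :: real)"
    and G: "L2_tendsto M G g"
    and c: "continuous_on UNIV c" "\<And>x. \<bar>c x\<bar> \<le> 1"
  shows "L2_tendsto M (\<lambda>k \<omega>. c (F k \<omega>) *\<^sub>R G k \<omega>) (\<lambda>\<omega>. c (Z \<omega>) *\<^sub>R g \<omega>)"
proof -
  have [measurable]: "c \<in> borel_measurable borel" by (rule borel_measurable_continuous_onI[OF c(1)])
  note [measurable] = F Z
  note GD = L2_tendstoD[OF G]
  have "L2_tendsto M (\<lambda>k \<omega>. c (F k \<omega>) *\<^sub>R (G k \<omega> - g \<omega>)) (\<lambda>_. 0)"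
  proof (rule L2_tendsto_bound[OF _ _ _ GD(3)])
    show in2: "in_L2 M (\<lambda>\<omega>. c (F k \<omega>) *\<^sub>R (G k \<omega> - g \<omega>))" for k
      by (rule in_L2_mult_bounded[OF in_L2_diff[OF GD(1,2)] _ c(2)]) measurable
    show "(LINT \<omega>|M. (norm (c (F k \<omega>) *\<^sub>R (G k \<omega> - g \<omega>) - 0))\<^sup>2) \<le> (LINT \<omega>|M. (norm (G k \<omega> - g \<omega>))\<^sup>2)" for k
    proof (rule integral_mono)
      show "integrable M (\<lambda>\<omega>. (norm (c (F k \<omega>) *\<^sub>R (G k \<omega> - g \<omega>) - 0))\<^sup>2)"
        using in_L2_integrable_power2[OF in2] by simp
      show "integrable M (\<lambda>\<omega>. (norm (G k \<omega> - g \<omega>))\<^sup>2)"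
        by (rule in_L2_integrable_power2[OF in_L2_diff[OF GD(1,2)]])
      show "(norm (c (F k \<omega>) *\<^sub>R (G k \<omega> - g \<omega>) - 0))\<^sup>2 \<le> (norm (G k \<omega> - g \<omega>))\<^sup>2" for \<omega>
        using mult_right_mono[OF c(2)[of "F k \<omega>"] norm_ge_zero[of "G k \<omega> - g \<omega>"]]
        by (intro power_mono) simp_all
    qed
  qed simp
  moreover have "L2_tendsto M (\<lambda>k \<omega>. c (F k \<omega>) *\<^sub>R g \<omega>) (\<lambda>\<omega>. c (Z \<omega>) *\<^sub>R g \<omega>)"
  proof (rule L2_tendsto_dominated)
    have gm [measurable]: "g \<in> borel_measurable M" using GD(2) by (rule in_L2_measurable)
    show "(\<lambda>\<omega>. c (F k \<omega>) *\<^sub>R g \<omega>) \<in> borel_measurable M" "(\<lambda>\<omega>. c (Z \<omega>) *\<^sub>R g \<omega>) \<in> borel_measurable M" for k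
      by measurable
    show "AE \<omega> in M. (\<lambda>k. c (F k \<omega>) *\<^sub>R g \<omega>) \<longlonglongrightarrow> c (Z \<omega>) *\<^sub>R g \<omega>"
      using lim
    proof eventually_elim
      case (elim \<omega>)
      then show ?case
        using c(1) by (intro tendsto_scaleR tendsto_const isCont_tendsto_compose[of _ c])
          (auto simp: continuous_on_eq_continuous_at)
    qed
    show "in_L2 M (\<lambda>\<omega>. norm (g \<omega>))" by (rule in_L2_bound[OF GD(2)]) auto
    show "AE \<omega> in M. norm (c (F k \<omega>) *\<^sub>R g \<omega>) \<le> norm (g \<omega>)" for k
    proof (rule AE_I2)
      fix \<omega>
      show "norm (c (F k \<omega>) *\<^sub>R g \<omega>) \<le> norm (g \<omega>)"
        using mult_right_mono[OF c(2)[of "F k \<omega>"] norm_ge_zero[of "g \<omega>"]] by simp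
    qed
  qed
  ultimately have "L2_tendsto M (\<lambda>k \<omega>. c (F k \<omega>) *\<^sub>R (G k \<omega> - g \<omega>) + c (F k \<omega>) *\<^sub>R g \<omega>) (\<lambda>\<omega>. 0 + c (Z \<omega>) *\<^sub>R g \<omega>)"
    by (rule L2_tendsto_add)
  then show ?thesis by (simp add: scaleR_add_right[symmetric] del: scaleR_diff_right)
qed

text \<open>The chain rule for sine and cosine is applied only to smooth cylindrical approximants of
  Z; the resulting identities between expectations are then passed to the limit.\<close>

lemma malliavin_stein_identity:
  assumes sets: "sets M = sets_generated_by M X" and Z: "Z \<in> D12 M X" and mean: "(LINT \<omega>|M. Z \<omega>) = 0"
    and T_def: "\<And>\<omega>. T \<omega> = malliavin_D M X Z \<omega> \<bullet> (- malliavin_D M X (OU_pinv M X Z) \<omega>)"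
  shows "in_L2 M Z" "integrable M T" "(LINT \<omega>|M. (Z \<omega>)\<^sup>2) = (LINT \<omega>|M. T \<omega>)"
    "(LINT \<omega>|M. Z \<omega> * sin (t * Z \<omega>)) = t * (LINT \<omega>|M. cos (t * Z \<omega>) * T \<omega>)"
    "(LINT \<omega>|M. Z \<omega> * (cos (t * Z \<omega>) - 1)) = - t * (LINT \<omega>|M. sin (t * Z \<omega>) * T \<omega>)"
proof -
  define A where "A = malliavin_D M X Z"
  define B where "B = malliavin_D M X (OU_pinv M X Z)"
  have "\<exists>U. has_malliavin_derivative M X Z U" using Z by (simp add: D12_def)
  then have A: "has_malliavin_derivative M X Z A"
    unfolding A_def malliavin_D_def by (rule someI_ex)
  note AL2 = has_malliavin_derivative_L2[OF A]
  show "in_L2 M Z" by (rule AL2)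
  obtain U where U: "has_malliavin_derivative M X (OU_pinv M X Z) U"
    and ident: "\<And>F G. has_malliavin_derivative M X F G \<Longrightarrow> (LINT \<omega>|M. F \<omega> * Z \<omega>) = - (LINT \<omega>|M. G \<omega> \<bullet> U \<omega>)"
    using OU_pinv_malliavin[OF sets AL2(1) mean] by blast
  have B: "has_malliavin_derivative M X (OU_pinv M X Z) B"
    unfolding B_def malliavin_D_def by (rule someI[of _ U]) (rule U)
  note BL2 = has_malliavin_derivative_L2(2)[OF B] and UL2 = has_malliavin_derivative_L2(2)[OF U]
  note [measurable] = in_L2_measurable[OF AL2(1)] in_L2_measurable[OF AL2(2)] in_L2_measurable[OF BL2] in_L2_measurable[OF UL2]
  \<comment> \<open>The identity is known for the derivative of the series; uniqueness transfers it
    to the version chosen by \<open>malliavin_D\<close>.\<close>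
  have UB: "AE \<omega> in M. U \<omega> = B \<omega>" by (rule malliavin_derivative_unique[OF sets U B])
  have T: "T \<omega> = - (A \<omega> \<bullet> B \<omega>)" for \<omega> by (simp add: T_def A_def B_def)
  have "T = (\<lambda>\<omega>. - (A \<omega> \<bullet> B \<omega>))" using T by (rule ext)
  then show "integrable M T" by (simp only:) (intro integrable_minus integrable_L2_inner AL2 BL2)
  have ident': "(LINT \<omega>|M. F \<omega> * Z \<omega>) = - (LINT \<omega>|M. G \<omega> \<bullet> B \<omega>)" if FG: "has_malliavin_derivative M X F G" for F G
  proof -
    have [measurable]: "G \<in> borel_measurable M" by (rule in_L2_measurable[OF has_malliavin_derivative_L2(2)[OF FG]])
    have "(LINT \<omega>|M. G \<omega> \<bullet> U \<omega>) = (LINT \<omega>|M. G \<omega> \<bullet> B \<omega>)"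
    proof (rule integral_cong_AE)
      show "AE \<omega> in M. G \<omega> \<bullet> U \<omega> = G \<omega> \<bullet> B \<omega>" using UB by eventually_elim simp
    qed measurable
    then show ?thesis using ident[OF FG] by simp
  qed
  show "(LINT \<omega>|M. (Z \<omega>)\<^sup>2) = (LINT \<omega>|M. T \<omega>)"
    using ident'[OF A] by (simp add: T power2_eq_square)
  obtain F0 G0 where FG0: "\<And>k. smooth_cylindrical X (F0 k) (G0 k)" "L2_tendsto M F0 Z" "L2_tendsto M G0 A"
    using A unfolding has_malliavin_derivative_def by blast
  \<comment> \<open>Almost everywhere convergence handles the bounded continuous factors
    \<open>sin (t * F k \<omega>)\<close> and \<open>cos (t * F k \<omega>)\<close>.\<close>
  obtain r where r: "strict_mono r" "AE \<omega> in M. (\<lambda>k. F0 (r k) \<omega>) \<longlonglongrightarrow> Z \<omega>"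
    using L2_tendsto_AE_subseq[OF FG0(2)] by blast
  define F G where "F k = F0 (r k)" and "G k = G0 (r k)" for k
  have cyl: "smooth_cylindrical X (F k) (G k)" for k unfolding F_def G_def by (rule FG0)
  have Flim: "AE \<omega> in M. (\<lambda>k. F k \<omega>) \<longlonglongrightarrow> Z \<omega>" unfolding F_def by (rule r)
  have GA: "L2_tendsto M G A" unfolding G_def by (rule L2_tendsto_subseq[OF FG0(3) r(1)])
  have Fm: "F k \<in> borel_measurable M" for k by (rule in_L2_measurable[OF smooth_cylindrical_L2(1)[OF cyl]])
  have comp: "(\<lambda>k. LINT \<omega>|M. c (F k \<omega>) * Z \<omega>) \<longlonglongrightarrow> (LINT \<omega>|M. c (Z \<omega>) * Z \<omega>)"
      "(\<lambda>k. LINT \<omega>|M. (c (F k \<omega>) *\<^sub>R G k \<omega>) \<bullet> B \<omega>) \<longlonglongrightarrow> (LINT \<omega>|M. (c (Z \<omega>) *\<^sub>R A \<omega>) \<bullet> B \<omega>)"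
    if c: "continuous_on UNIV c" "\<And>x. \<bar>c x\<bar> \<le> 1" for c :: "real \<Rightarrow> real"
  proof -
    have "L2_tendsto M (\<lambda>k \<omega>. c (F k \<omega>) *\<^sub>R Z \<omega>) (\<lambda>\<omega>. c (Z \<omega>) *\<^sub>R Z \<omega>)"
      by (rule L2_tendsto_bounded_composition[OF Fm _ Flim L2_tendsto_const[OF AL2(1)] c]) measurable
    from L2_mult_tendsto[OF this L2_tendsto_const[OF in_L2_const[of 1]]]
    show "(\<lambda>k. LINT \<omega>|M. c (F k \<omega>) * Z \<omega>) \<longlonglongrightarrow> (LINT \<omega>|M. c (Z \<omega>) * Z \<omega>)" by simp
    have "L2_tendsto M (\<lambda>k \<omega>. c (F k \<omega>) *\<^sub>R G k \<omega>) (\<lambda>\<omega>. c (Z \<omega>) *\<^sub>R A \<omega>)"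
      by (rule L2_tendsto_bounded_composition[OF Fm _ Flim GA c]) measurable
    then show "(\<lambda>k. LINT \<omega>|M. (c (F k \<omega>) *\<^sub>R G k \<omega>) \<bullet> B \<omega>) \<longlonglongrightarrow> (LINT \<omega>|M. (c (Z \<omega>) *\<^sub>R A \<omega>) \<bullet> B \<omega>)"
      by (rule L2_inner_tendsto[OF _ L2_tendsto_const[OF BL2]])
  qed
  have cs: "continuous_on UNIV (\<lambda>x. sin (t * x))" "continuous_on UNIV (\<lambda>x. cos (t * x))"
    by (auto intro!: continuous_intros)
  have "(LINT \<omega>|M. sin (t * F k \<omega>) * Z \<omega>) = - t * (LINT \<omega>|M. (cos (t * F k \<omega>) *\<^sub>R G k \<omega>) \<bullet> B \<omega>)" for k
    using ident'[OF smooth_cylindrical_has_malliavin_derivative[OF smooth_cylindrical_sin[OF cyl, of t k]]]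
    by (simp add: mult.assoc)
  moreover have "(\<lambda>k. - t * (LINT \<omega>|M. (cos (t * F k \<omega>) *\<^sub>R G k \<omega>) \<bullet> B \<omega>)) \<longlonglongrightarrow> - t * (LINT \<omega>|M. (cos (t * Z \<omega>) *\<^sub>R A \<omega>) \<bullet> B \<omega>)"
    by (intro tendsto_mult_left comp(2)[OF cs(2)]) simp
  ultimately have "(LINT \<omega>|M. sin (t * Z \<omega>) * Z \<omega>) = - t * (LINT \<omega>|M. (cos (t * Z \<omega>) *\<^sub>R A \<omega>) \<bullet> B \<omega>)"
    using LIMSEQ_unique[OF comp(1)[OF cs(1)]] by simp
  then show "(LINT \<omega>|M. Z \<omega> * sin (t * Z \<omega>)) = t * (LINT \<omega>|M. cos (t * Z \<omega>) * T \<omega>)"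
    by (simp add: T mult.commute)
  have L1: "integrable M (\<lambda>\<omega>. cos (t * f \<omega>) * Z \<omega>)" if "f \<in> borel_measurable M" for f
    using in_L2_mult_bounded[OF AL2(1), of "\<lambda>\<omega>. cos (t * f \<omega>)" 1] that integrable_L2 by fastforce
  \<comment> \<open>The subtracted constant 1 contributes only E[Z] = 0.\<close>
  have "(LINT \<omega>|M. cos (t * F k \<omega>) * Z \<omega>) = t * (LINT \<omega>|M. (sin (t * F k \<omega>) *\<^sub>R G k \<omega>) \<bullet> B \<omega>)" for k
    using ident'[OF smooth_cylindrical_has_malliavin_derivative[OF smooth_cylindrical_cos[OF cyl, of t k]]]
      L1[OF Fm, of k] integrable_L2[OF AL2(1)] mean
    by (simp add: mult.assoc left_diff_distrib)
  moreover have "(\<lambda>k. t * (LINT \<omega>|M. (sin (t * F k \<omega>) *\<^sub>R G k \<omega>) \<bullet> B \<omega>)) \<longlonglongrightarrow> t * (LINT \<omega>|M. (sin (t * Z \<omega>) *\<^sub>R A \<omega>) \<bullet> B \<omega>)"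
    by (intro tendsto_mult_left comp(2)[OF cs(1)]) simp
  ultimately have "(LINT \<omega>|M. cos (t * Z \<omega>) * Z \<omega>) = t * (LINT \<omega>|M. (sin (t * Z \<omega>) *\<^sub>R A \<omega>) \<bullet> B \<omega>)"
    using LIMSEQ_unique[OF comp(1)[OF cs(2)]] by simp
  then show "(LINT \<omega>|M. Z \<omega> * (cos (t * Z \<omega>) - 1)) = - t * (LINT \<omega>|M. sin (t * Z \<omega>) * T \<omega>)"
    using L1[of Z] integrable_L2[OF AL2(1)] mean
    by (simp add: T right_diff_distrib mult.commute)
qed

end

theorem theorem3p1:
  fixes M :: "'a measure"
    and X :: "'h::{real_inner, banach, second_countable_topology} \<Rightarrow> 'a \<Rightarrow> real"
    and Z :: "'a \<Rightarrow> real"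
    and g :: "real \<Rightarrow> real"
    and \<sigma>min :: real
  assumes "isonormal_process M X"
    and "sets M = sets_generated_by M X"
    and "Z \<in> D12 M X"
    and "(LINT \<omega>|M. Z \<omega>) = 0"
    and "g \<in> borel_measurable borel"
    and "AE \<omega> in M. g (Z \<omega>) =
           real_cond_exp M (vimage_algebra (space M) Z borel)
             (\<lambda>\<omega>. malliavin_D M X Z \<omega> \<bullet> (- malliavin_D M X (OU_pinv M X Z) \<omega>)) \<omega>"
    and "\<sigma>min > 0"
    and "AE \<omega> in M. g (Z \<omega>) \<ge> \<sigma>min\<^sup>2"
  shows "\<exists>\<rho> :: real \<Rightarrow> real.
           (\<forall>z. 0 \<le> \<rho> z) \<and>
           distributed M lborel Z (\<lambda>z. ennreal (\<rho> z)) \<and>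
           density_support \<rho> = UNIV \<and>
           (AE z in lborel.
              \<rho> z = (LINT \<omega>|M. \<bar>Z \<omega>\<bar>) / (2 * g z) * exp (- (LBINT x=0..ereal z. x / g x)))"
proof -
  interpret isonormal M X
    using assms(1) by (intro isonormal.intro isonormal_axioms.intro) (auto simp: isonormal_process_def)
  define T where "T \<omega> = malliavin_D M X Z \<omega> \<bullet> (- malliavin_D M X (OU_pinv M X Z) \<omega>)" for \<omega>
  note stein = malliavin_stein_identity[OF assms(2,3,4) T_def]
  note [measurable] = in_L2_measurable[OF stein(1)] borel_measurable_integrable[OF stein(2)] assms(5)
  define \<Z> where "\<Z> = vimage_algebra (space M) Z borel"
  have "sets \<Z> = {Z -` A \<inter> space M | A. A \<in> sets borel}"
    unfolding \<Z>_def by (rule sets_vimage_algebra2) simp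
  then have "subalgebra M \<Z>"
    unfolding subalgebra_def by (auto simp: \<Z>_def)
  then interpret finite_measure_subalgebra M \<Z>
    by unfold_locales
  have gZ: "AE \<omega> in M. g (Z \<omega>) = real_cond_exp M \<Z> T \<omega>"
    using assms(6) by (simp only: \<Z>_def T_def[abs_def])
  have gZm: "(\<lambda>\<omega>. g (Z \<omega>)) \<in> borel_measurable M" by measurable
  have gint: "integrable M (\<lambda>\<omega>. g (Z \<omega>))"
    by (subst integrable_cong_AE[OF gZm _ gZ]) (auto intro: real_cond_exp_int(1)[OF stein(2)])
  \<comment> \<open>The conditional expectation enters in this form: g(Z) and \<open>T\<close> have
    the same integrals against bounded functions of Z. The tests used are 1, cos (t z) and sin (t
    z).\<close>
  have cond: "(LINT \<omega>|M. f (Z \<omega>) * T \<omega>) = (LINT \<omega>|M. g (Z \<omega>) * f (Z \<omega>))"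
    if f: "f \<in> borel_measurable borel" "\<And>x. \<bar>f x\<bar> \<le> 1" for f :: "real \<Rightarrow> real"
  proof -
    note [measurable] = f(1)
    have "Z \<in> \<Z> \<rightarrow>\<^sub>M borel" unfolding \<Z>_def by (rule measurable_vimage_algebra1) simp
    then have fZ: "(\<lambda>\<omega>. f (Z \<omega>)) \<in> borel_measurable \<Z>" using f(1) by (rule measurable_compose)
    have "integrable M (\<lambda>\<omega>. f (Z \<omega>) * T \<omega>)"
    proof (rule Bochner_Integration.integrable_bound[OF stein(2)])
      show "AE \<omega> in M. norm (f (Z \<omega>) * T \<omega>) \<le> norm (T \<omega>)"
        using mult_right_mono[OF f(2) abs_ge_zero] by (intro AE_I2) (simp add: abs_mult)
    qed measurable
    from real_cond_exp_intg(2)[OF this fZ borel_measurable_integrable[OF stein(2)]]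
    have "(LINT \<omega>|M. f (Z \<omega>) * T \<omega>) = (LINT \<omega>|M. f (Z \<omega>) * real_cond_exp M \<Z> T \<omega>)" by simp
    also have "\<dots> = (LINT \<omega>|M. g (Z \<omega>) * f (Z \<omega>))"
    proof (rule integral_cong_AE)
      show "AE \<omega> in M. f (Z \<omega>) * real_cond_exp M \<Z> T \<omega> = g (Z \<omega>) * f (Z \<omega>)"
        using gZ by eventually_elim simp
    qed measurable
    finally show ?thesis .
  qed
  have "\<exists>\<rho> :: real \<Rightarrow> real. (\<forall>z. 0 < \<rho> z \<or> (0 \<le> \<rho> z \<and> g z < \<sigma>min\<^sup>2)) \<and> (AE z in lborel. g z \<ge> \<sigma>min\<^sup>2) \<and>
    distributed M lborel Z (\<lambda>z. ennreal (\<rho> z)) \<and>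
    (AE z in lborel. \<rho> z = (LINT \<omega>|M. \<bar>Z \<omega>\<bar>) / (2 * g z) * exp (- (LBINT x=0..ereal z. x / g x)))"
  proof (rule stein_identity_density)
    show "integrable M (\<lambda>\<omega>. (Z \<omega>)\<^sup>2)" using stein(1) by (simp add: in_L2_real_iff)
    show "(LINT \<omega>|M. (Z \<omega>)\<^sup>2) = (LINT \<omega>|M. g (Z \<omega>))"
      using cond[of "\<lambda>_. 1"] stein(3) by simp
    show "(LINT \<omega>|M. Z \<omega> * sin (t * Z \<omega>)) = t * (LINT \<omega>|M. g (Z \<omega>) * cos (t * Z \<omega>))" for t
      using cond[of "\<lambda>z. cos (t * z)"] stein(4) by simp
    show "(LINT \<omega>|M. Z \<omega> * (cos (t * Z \<omega>) - 1)) = - t * (LINT \<omega>|M. g (Z \<omega>) * sin (t * Z \<omega>))" for t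
      using cond[of "\<lambda>z. sin (t * z)"] stein(5) by simp
  qed (use assms gint in auto)
  then obtain \<rho> where \<rho>: "\<And>z. 0 < \<rho> z \<or> (0 \<le> \<rho> z \<and> g z < \<sigma>min\<^sup>2)" "AE z in lborel. g z \<ge> \<sigma>min\<^sup>2"
    "distributed M lborel Z (\<lambda>z. ennreal (\<rho> z))"
    "AE z in lborel. \<rho> z = (LINT \<omega>|M. \<bar>Z \<omega>\<bar>) / (2 * g z) * exp (- (LBINT x=0..ereal z. x / g x))"
    by blast
  \<comment> \<open>Off a null set \<rho> is positive, so an open set on which it vanishes almost
    everywhere is itself null, and therefore empty.\<close>
  have "U = {}" if U: "open U" "AE x in lborel. x \<in> U \<longrightarrow> \<rho> x = 0" for U
  proof -
    have "AE x in lborel. x \<notin> U"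
      using U(2) \<rho>(2)
    proof eventually_elim
      case (elim x)
      then show ?case using \<rho>(1)[of x] by auto
    qed
    then have "U \<in> null_sets lborel" using U(1) by (subst AE_iff_null_sets) auto
    then have "negligible U" unfolding negligible_iff_null_sets by (rule null_sets_completionI)
    then show ?thesis using open_not_negligible[OF U(1)] by blast
  qed
  then have "density_support \<rho> = UNIV" unfolding density_support_def by blast
  moreover have "0 \<le> \<rho> z" for z using \<rho>(1)[of z] by auto
  ultimately show ?thesis using \<rho>(3,4) by blast
qed

end
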